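(* There is an algorithm that, given an instance $(X,k)$ of \textsc{Exact Cover by Arithmetic Progressions} (\textsc{XCAP}) with $|X|=n$, correctly decides it in time $2^{O(k^3)}\cdot \mathrm{poly}(n)$.
   Context: An arithmetic progression (AP) is a finite sequence of integers of the form $a, a+d, a+2d, \dots, a+xd$ for integers $a$, $d$ and $x\ge 0$; an AP is identified with the set of its elements. \textsc{XCAP}: given a set $X$ of $n$ integers and an integer $k$, decide whether there exist $k$ pairwise disjoint APs $s_1,\dots,s_k$, each consisting only of elements of $X$, such that $s_1\cup\dots\cup s_k = X$. *)

theory Defs
  imports
    Complex_Main
    "HOL-Library.Landau_Symbols"
    "HOL-Computational_Algebra.Polynomial"
begin

text \<open>
  A one-element set is an arithmetic progression (\<open>x = 0\<close> or \<open>d = 0\<close>); the empty set is not.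
\<close>

definition is_AP :: "int set \<Rightarrow> bool" where
  "is_AP s \<longleftrightarrow> (\<exists>(a::int) (d::int) (x::nat). s = (\<lambda>i. a + int i * d) ` {0..x})"

text \<open>
  The tuple of progressions is a list, so that \<open>k\<close> counts exactly its entries; in particular a
  negative \<open>k\<close> is a no-instance.
\<close>

definition XCAP :: "int set \<Rightarrow> int \<Rightarrow> bool" where
  "XCAP X k \<longleftrightarrow>
     (\<exists>ss :: int set list.
        int (length ss) = k \<and>
        (\<forall>s\<in>set ss. is_AP s \<and> s \<subseteq> X) \<and>
        pairwise (\<lambda>i j. disjnt (ss ! i) (ss ! j)) {..<length ss} \<and>
        \<Union>(set ss) = X)"

text \<open>
  The model of computation is a random access machine on integers under the uniform cost measure,
  presented as a structured While language. The store consists of named unbounded arrays of integers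
  with indirect addressing; a scalar variable is an array used at index 0 only. Each operation costs
  one step, irrespective of the size of the operands, so that running times can be bounded in terms
  of the \<^emph>\<open>number\<close> of input integers. The only arithmetic operations are addition,
  subtraction and comparison. Multiplication and division are deliberately absent: at unit cost they
  would allow exponentially long numbers to be manipulated in few steps, and hence exponential
  computations to be packed into polynomial time. With addition and subtraction only, bit lengths
  grow by at most one per operation, and the model is equivalent to Turing machines up to factors
  polynomial in the running time and the bit length of the input.
\<close>

type_synonym store = "string \<Rightarrow> int \<Rightarrow> int"

datatype aexp =
    Const int
  | Read string aexp
  | Add aexp aexp
  | Sub aexp aexp

datatype bexp =
    Less aexp aexp
  | Neg bexp
  | Conj bexp bexp

datatype com =
    Skip
  | Write string aexp aexp
  | Seq com com
  | Cond bexp com com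
  | While bexp com

fun aval :: "aexp \<Rightarrow> store \<Rightarrow> int" where
  "aval (Const c) \<sigma> = c"
| "aval (Read v e) \<sigma> = \<sigma> v (aval e \<sigma>)"
| "aval (Add e1 e2) \<sigma> = aval e1 \<sigma> + aval e2 \<sigma>"
| "aval (Sub e1 e2) \<sigma> = aval e1 \<sigma> - aval e2 \<sigma>"

fun bval :: "bexp \<Rightarrow> store \<Rightarrow> bool" where
  "bval (Less e1 e2) \<sigma> \<longleftrightarrow> aval e1 \<sigma> < aval e2 \<sigma>"
| "bval (Neg b) \<sigma> \<longleftrightarrow> \<not> bval b \<sigma>"
| "bval (Conj b1 b2) \<sigma> \<longleftrightarrow> bval b1 \<sigma> \<and> bval b2 \<sigma>"

fun acost :: "aexp \<Rightarrow> nat" where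
  "acost (Const c) = 1"
| "acost (Read v e) = acost e + 1"
| "acost (Add e1 e2) = acost e1 + acost e2 + 1"
| "acost (Sub e1 e2) = acost e1 + acost e2 + 1"

fun bcost :: "bexp \<Rightarrow> nat" where
  "bcost (Less e1 e2) = acost e1 + acost e2 + 1"
| "bcost (Neg b) = bcost b + 1"
| "bcost (Conj b1 b2) = bcost b1 + bcost b2 + 1"

text \<open>
  \<open>exec c \<sigma> t \<tau>\<close>: started in store \<open>\<sigma>\<close>, program \<open>c\<close> halts after \<open>t\<close> steps in store \<open>\<tau>\<close>.
\<close>

inductive exec :: "com \<Rightarrow> store \<Rightarrow> nat \<Rightarrow> store \<Rightarrow> bool" where
  Skip: "exec Skip \<sigma> 1 \<sigma>"
| Write: "exec (Write v i e) \<sigma> (acost i + acost e + 1)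
            (\<sigma>(v := (\<sigma> v)(aval i \<sigma> := aval e \<sigma>)))"
| Seq: "exec c1 \<sigma> t1 \<sigma>' \<Longrightarrow> exec c2 \<sigma>' t2 \<sigma>'' \<Longrightarrow> exec (Seq c1 c2) \<sigma> (t1 + t2) \<sigma>''"
| CondTrue: "bval b \<sigma> \<Longrightarrow> exec c1 \<sigma> t \<sigma>' \<Longrightarrow> exec (Cond b c1 c2) \<sigma> (bcost b + 1 + t) \<sigma>'"
| CondFalse: "\<not> bval b \<sigma> \<Longrightarrow> exec c2 \<sigma> t \<sigma>' \<Longrightarrow> exec (Cond b c1 c2) \<sigma> (bcost b + 1 + t) \<sigma>'"
| WhileFalse: "\<not> bval b \<sigma> \<Longrightarrow> exec (While b c) \<sigma> (bcost b + 1) \<sigma>"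
| WhileTrue: "bval b \<sigma> \<Longrightarrow> exec c \<sigma> t1 \<sigma>' \<Longrightarrow> exec (While b c) \<sigma>' t2 \<sigma>'' \<Longrightarrow>
                exec (While b c) \<sigma> (bcost b + 1 + t1 + t2) \<sigma>''"

inductive_cases exec_SkipE: "exec Skip \<sigma> t \<tau>"
inductive_cases exec_WriteE: "exec (Write v i e) \<sigma> t \<tau>"
inductive_cases exec_SeqE: "exec (Seq c1 c2) \<sigma> t \<tau>"
inductive_cases exec_CondE: "exec (Cond b c1 c2) \<sigma> t \<tau>"
inductive_cases exec_WhileE: "exec (While b c) \<sigma> t \<tau>"

lemma exec_deterministic:
  "exec c \<sigma> t \<tau> \<Longrightarrow> exec c \<sigma> t' \<tau>' \<Longrightarrow> t' = t \<and> \<tau>' = \<tau>"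
proof (induction arbitrary: t' \<tau>' rule: exec.induct)
  case (Skip \<sigma>)
  then show ?case by (elim exec_SkipE) simp
next
  case (Write v i \<sigma> e)
  then show ?case by (elim exec_WriteE) simp
next
  case (Seq c1 \<sigma> t1 \<sigma>' c2 t2 \<sigma>'')
  from Seq.prems show ?case by (elim exec_SeqE) (metis Seq.IH)
next
  case (CondTrue b \<sigma> c1 t \<sigma>' c2)
  from CondTrue.prems show ?case by (rule exec_CondE) (use CondTrue.hyps(1) CondTrue.IH in simp_all)
next
  case (CondFalse b \<sigma> c2 t \<sigma>' c1)
  from CondFalse.prems show ?case by (rule exec_CondE) (use CondFalse.hyps(1) CondFalse.IH in simp_all)
next
  case (WhileFalse b \<sigma> c)
  from WhileFalse.prems show ?case by (rule exec_WhileE) (use WhileFalse.hyps(1) in simp_all)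
next
  case (WhileTrue b \<sigma> c t1 \<sigma>' t2 \<sigma>'')
  from WhileTrue.prems show ?case
  proof (rule exec_WhileE)
    fix u \<rho> u'
    assume "exec c \<sigma> u \<rho>" and rest: "exec (While b c) \<rho> u' \<tau>'"
      and t': "t' = Suc (bcost b + u + u')"
    then have "u = t1 \<and> \<rho> = \<sigma>'"
      using WhileTrue.IH(1) by blast
    moreover from this rest have "u' = t2 \<and> \<tau>' = \<sigma>''"
      using WhileTrue.IH(2) by blast
    ultimately show ?thesis
      using t' by simp
  qed (use WhileTrue.hyps(1) in simp_all)
qed

text \<open>
  The input set is presented as an array listing its elements in some order, not necessarily sorted.
\<close>

definition input_store :: "int list \<Rightarrow> int \<Rightarrow> store" where
  "input_store xs k = (\<lambda>v i.
     if v = ''X'' \<and> 0 \<le> i \<and> i < int (length xs) then xs ! nat i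
     else if v = ''n'' \<and> i = 0 then int (length xs)
     else if v = ''k'' \<and> i = 0 then k
     else 0)"

definition answer :: "bool \<Rightarrow> int" where
  "answer b = (if b then 1 else 0)"

text \<open>
  Program \<open>P\<close> decides XCAP, leaving the answer in the scalar \<open>out\<close>, within time \<open>T n k\<close> on every
  instance with \<open>n\<close> elements and parameter \<open>k\<close>, whatever the order in which the set is listed.
\<close>

definition decides_XCAP_in_time :: "com \<Rightarrow> (nat \<Rightarrow> int \<Rightarrow> real) \<Rightarrow> bool" where
  "decides_XCAP_in_time P T \<longleftrightarrow>
     (\<forall>(X :: int set) (k :: int) (xs :: int list). set xs = X \<and> distinct xs \<longrightarrow>
        (\<exists>t \<tau>. exec P (input_store xs k) t \<tau> \<and>
               \<tau> ''out'' 0 = answer (XCAP X k) \<and>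
               real t \<le> T (card X) k))"

end

theory Submission imports Defs begin

text \<open>
  Sweep through the sorted set from left to right, extending progressions whose differences are known. An element
  that exactly one of them expects next is given to it. All other elements need a decision, taken
  from an advice string: either one of the progressions expecting the element takes it, which stops
  the others, or a new progression starts, as a singleton if its difference is not known. Let the
  decisions follow a solution. Then every decision stops or starts a progression, unless the element
  belongs to a progression that was started as a singleton before. In this case the difference of the latter can be
  learnt, and the sweep is restarted. Thus there are at most \<open>k\<close> restarts and \<open>O(k\<^sup>2)\<close> decisions.

  The difference \<open>d\<close> to be learnt satisfies \<open>q d = r e\<close>, where \<open>e\<close> is the distance from the singleton or a
  known difference, \<open>q = O(k\<^sup>2)\<close> and \<open>r \<le> 2\<^sup>k\<close>. The bound on \<open>r\<close> is due to the theorem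
  that \<open>k\<close> residue classes covering \<open>2\<^sup>k\<close> consecutive integers cover all integers. Hence it suffices
  to try all advice strings of length \<open>O(k\<^sup>2)\<close> with entries below \<open>2\<^sup>O\<^sup>(\<^sup>k\<^sup>)\<close>, which are
  \<open>2\<^sup>O\<^sup>(\<^sup>k\<^sup>3\<^sup>)\<close> many.
\<close>

text \<open>The obstacle is that a solution contains unbounded data. Guessing the ends of its
  progressions would cost a factor \<open>n\<close> each. Therefore a block runs on past the end of
  its progression, and its stop is decided only at a collision, among at most \<open>k\<close>
  blocks. Differences cannot be guessed either, so they are expressed through lengths that the sweep
  has measured. A block that overruns may swallow elements of progressions whose own block is
  missing or a singleton. Hence a block may start at any element of its progression, and the element
  at which a difference is learnt may be far from the singleton, with many swallowed ones in
  between. This is the case that needs the covering theorem. Swallowing does no harm: a sweep that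
  reaches the end with at most \<open>k\<close> blocks exhibits a partition, whatever the advice
  was, and this partition need not be the solution that was followed. So soundness never mentions a
  solution, and only completeness does.\<close>

section \<open>Time-bounded total correctness\<close>

definition run :: "com \<Rightarrow> nat \<Rightarrow> store \<Rightarrow> (store \<Rightarrow> bool) \<Rightarrow> bool" where
  "run c t \<sigma> Q \<longleftrightarrow> (\<exists>t' \<tau>. exec c \<sigma> t' \<tau> \<and> t' \<le> t \<and> Q \<tau>)"

fun writes :: "com \<Rightarrow> string set" where
  "writes Skip = {}"
| "writes (Write v i e) = {v}"
| "writes (Seq c1 c2) = writes c1 \<union> writes c2"
| "writes (Cond b c1 c2) = writes c1 \<union> writes c2"
| "writes (While b c) = writes c"

lemma exec_frame: "exec c \<sigma> t \<tau> \<Longrightarrow> v \<notin> writes c \<Longrightarrow> \<tau> v = \<sigma> v"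
  by (induction rule: exec.induct) auto

lemma run_frame:
  assumes "run c t \<sigma> Q"
  shows "run c t \<sigma> (\<lambda>\<tau>. Q \<tau> \<and> (\<forall>v. v \<notin> writes c \<longrightarrow> \<tau> v = \<sigma> v))"
  using assms exec_frame unfolding run_def by blast

lemma run_mono:
  assumes "run c t \<sigma> P" "\<And>\<tau>. P \<tau> \<Longrightarrow> (\<And>v. v \<notin> writes c \<Longrightarrow> \<tau> v = \<sigma> v) \<Longrightarrow> Q \<tau>" "t \<le> t'"
  shows "run c t' \<sigma> Q"
  using run_frame[OF assms(1)] assms(2,3) unfolding run_def by (meson le_trans)

lemma run_Seq:
  assumes "run c1 t1 \<sigma> (\<lambda>\<tau>. run c2 t2 \<tau> Q)"
  shows "run (Seq c1 c2) (t1 + t2) \<sigma> Q"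
  using assms unfolding run_def by (meson add_mono exec.Seq)

lemma run_Cond:
  assumes "bval b \<sigma> \<Longrightarrow> run c1 t \<sigma> Q" "\<not> bval b \<sigma> \<Longrightarrow> run c2 t \<sigma> Q"
  shows "run (Cond b c1 c2) (bcost b + 1 + t) \<sigma> Q"
proof (cases "bval b \<sigma>")
  case True
  then obtain t' \<tau> where "exec c1 \<sigma> t' \<tau>" "t' \<le> t" "Q \<tau>"
    using assms(1) unfolding run_def by blast
  then show ?thesis
    unfolding run_def using CondTrue[OF True, of c1 t' \<tau> c2]
    by (intro exI[of _ "bcost b + 1 + t'"] exI[of _ \<tau>]) simp
next
  case False
  then obtain t' \<tau> where "exec c2 \<sigma> t' \<tau>" "t' \<le> t" "Q \<tau>"
    using assms(2) unfolding run_def by blast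
  then show ?thesis
    unfolding run_def using CondFalse[OF False, of c2 t' \<tau> c1]
    by (intro exI[of _ "bcost b + 1 + t'"] exI[of _ \<tau>]) simp
qed

text \<open>The index of \<open>Inv\<close> serves as a variant: it strictly decreases and thus
  bounds the number of rounds left. With a uniform bound \<open>t\<close> on the body this yields a
  product, counting \<open>m + 1\<close> tests.\<close>

lemma run_While:
  fixes Inv :: "nat \<Rightarrow> store \<Rightarrow> bool"
  assumes "Inv m \<sigma>"
    and body: "\<And>m \<tau>. Inv m \<tau> \<Longrightarrow> bval b \<tau> \<Longrightarrow> run c t \<tau> (\<lambda>\<tau>'. \<exists>m'<m. Inv m' \<tau>')"
    and post: "\<And>m \<tau>. Inv m \<tau> \<Longrightarrow> \<not> bval b \<tau> \<Longrightarrow> Q \<tau>"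
  shows "run (While b c) ((m + 1) * (bcost b + 1 + t)) \<sigma> Q"
  using assms(1)
proof (induction m arbitrary: \<sigma> rule: less_induct)
  case (less m)
  show ?case
  proof (cases "bval b \<sigma>")
    case True
    from body[OF less.prems True] obtain t1 \<tau>' m' where
      1: "exec c \<sigma> t1 \<tau>'" "t1 \<le> t" "m' < m" "Inv m' \<tau>'"
      unfolding run_def by blast
    from less.IH[OF 1(3,4)] obtain t2 \<tau> where
      2: "exec (While b c) \<tau>' t2 \<tau>" "t2 \<le> (m' + 1) * (bcost b + 1 + t)" "Q \<tau>"
      unfolding run_def by blast
    have "(m' + 1) * (bcost b + 1 + t) \<le> m * (bcost b + 1 + t)"
      using 1(3) by (intro mult_right_mono) auto
    then have "bcost b + 1 + t1 + t2 \<le> (m + 1) * (bcost b + 1 + t)"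
      using 1(2) 2(2) by simp
    then show ?thesis
      unfolding run_def using WhileTrue[OF True 1(1) 2(1)] 2(3) by blast
  next
    case False
    then show ?thesis
      unfolding run_def using WhileFalse[OF False, of c] post[OF less.prems False]
      by (intro exI[of _ "bcost b + 1"] exI[of _ \<sigma>]) simp
  qed
qed

text \<open>Loop-free code is executed symbolically by rewriting with \<^term>\<open>sem\<close>.\<close>

fun loop_free :: "com \<Rightarrow> bool" where
  "loop_free (Seq c1 c2) \<longleftrightarrow> loop_free c1 \<and> loop_free c2"
| "loop_free (Cond b c1 c2) \<longleftrightarrow> loop_free c1 \<and> loop_free c2"
| "loop_free (While b c) \<longleftrightarrow> False"
| "loop_free c \<longleftrightarrow> True"

fun sem :: "com \<Rightarrow> store \<Rightarrow> store" where
  "sem Skip \<sigma> = \<sigma>"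
| "sem (Write v i e) \<sigma> = \<sigma>(v := (\<sigma> v)(aval i \<sigma> := aval e \<sigma>))"
| "sem (Seq c1 c2) \<sigma> = sem c2 (sem c1 \<sigma>)"
| "sem (Cond b c1 c2) \<sigma> = (if bval b \<sigma> then sem c1 \<sigma> else sem c2 \<sigma>)"
| "sem (While b c) \<sigma> = \<sigma>"

fun maxcost :: "com \<Rightarrow> nat" where
  "maxcost Skip = 1"
| "maxcost (Write v i e) = acost i + acost e + 1"
| "maxcost (Seq c1 c2) = maxcost c1 + maxcost c2"
| "maxcost (Cond b c1 c2) = bcost b + 1 + maxcost c1 + maxcost c2"
| "maxcost (While b c) = 0"

lemma exec_sem:
  "loop_free c \<Longrightarrow> \<exists>t\<le>maxcost c. exec c \<sigma> t (sem c \<sigma>)"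
proof (induction c arbitrary: \<sigma>)
  case (Cond b c1 c2)
  then have lf: "loop_free c1" "loop_free c2"
    by auto
  obtain t1 where 1: "t1 \<le> maxcost c1" "exec c1 \<sigma> t1 (sem c1 \<sigma>)"
    using Cond.IH(1)[OF lf(1)] by blast
  obtain t2 where 2: "t2 \<le> maxcost c2" "exec c2 \<sigma> t2 (sem c2 \<sigma>)"
    using Cond.IH(2)[OF lf(2)] by blast
  show ?case
  proof (cases "bval b \<sigma>")
    case True
    then show ?thesis
      using CondTrue[OF True 1(2), of c2] 1(1)
      by (intro exI[of _ "bcost b + 1 + t1"]) simp
  next
    case False
    then show ?thesis
      using CondFalse[OF False 2(2), of c1] 2(1)
      by (intro exI[of _ "bcost b + 1 + t2"]) simp
  qed
next
  case (Seq c1 c2)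
  then have lf: "loop_free c1" "loop_free c2"
    by auto
  obtain t1 where 1: "t1 \<le> maxcost c1" "exec c1 \<sigma> t1 (sem c1 \<sigma>)"
    using Seq.IH(1)[OF lf(1)] by blast
  obtain t2 where 2: "t2 \<le> maxcost c2" "exec c2 (sem c1 \<sigma>) t2 (sem c2 (sem c1 \<sigma>))"
    using Seq.IH(2)[OF lf(2)] by blast
  show ?case
    using exec.Seq[OF 1(2) 2(2)] 1(1) 2(1) by (intro exI[of _ "t1 + t2"]) simp
next
  case Skip
  show ?case
    using exec.Skip by (intro exI[of _ 1]) simp
next
  case (Write v i e)
  show ?case
    using exec.Write[of v i e \<sigma>] by (intro exI[of _ "acost i + acost e + 1"]) (simp del: fun_upd_apply)
qed simp

lemma run_sem:
  "loop_free c \<Longrightarrow> maxcost c \<le> t \<Longrightarrow> Q (sem c \<sigma>) \<Longrightarrow> run c t \<sigma> Q"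
  using exec_sem[of c \<sigma>] unfolding run_def by (meson le_trans)

lemma run_sem_Seq:
  "loop_free c1 \<Longrightarrow> maxcost c1 \<le> t1 \<Longrightarrow> run c2 t2 (sem c1 \<sigma>) Q \<Longrightarrow> run (Seq c1 c2) (t1 + t2) \<sigma> Q"
  by (rule run_Seq) (rule run_sem)

abbreviation var :: "string \<Rightarrow> aexp" where
  "var v \<equiv> Read v (Const 0)"

abbreviation assign :: "string \<Rightarrow> aexp \<Rightarrow> com" where
  "assign v e \<equiv> Write v (Const 0) e"

abbreviation Leq :: "aexp \<Rightarrow> aexp \<Rightarrow> bexp" where
  "Leq e1 e2 \<equiv> Neg (Less e2 e1)"

abbreviation Equal :: "aexp \<Rightarrow> aexp \<Rightarrow> bexp" where
  "Equal e1 e2 \<equiv> Conj (Leq e1 e2) (Leq e2 e1)"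

definition For :: "string \<Rightarrow> aexp \<Rightarrow> com \<Rightarrow> com" where
  "For v e c = Seq (assign v (Const 0))
     (While (Less (var v) e) (Seq c (assign v (Add (var v) (Const 1)))))"

lemma writes_For [simp]: "writes (For v e c) = insert v (writes c)"
  by (auto simp: For_def)

lemma run_For:
  fixes Inv :: "nat \<Rightarrow> store \<Rightarrow> bool"
  assumes init: "Inv 0 \<sigma>"
    and bound: "\<And>\<tau>. (\<And>u. u \<notin> insert v (writes c) \<Longrightarrow> \<tau> u = \<sigma> u) \<Longrightarrow> aval e \<tau> = int N"
    and body: "\<And>i \<tau>. i < N \<Longrightarrow> Inv i \<tau> \<Longrightarrow> \<tau> v 0 = int i \<Longrightarrow>
        (\<And>u. u \<notin> insert v (writes c) \<Longrightarrow> \<tau> u = \<sigma> u) \<Longrightarrow> run c t \<tau> (Inv (Suc i))"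
    and v: "v \<notin> writes c" "\<And>i \<tau> f. Inv i \<tau> \<Longrightarrow> Inv i (\<tau>(v := f))"
    and post: "\<And>\<tau>. Inv N \<tau> \<Longrightarrow> (\<And>u. u \<notin> insert v (writes c) \<Longrightarrow> \<tau> u = \<sigma> u) \<Longrightarrow> Q \<tau>"
    and time: "(N + 1) * (acost e + 13 + t) \<le> T"
  shows "run (For v e c) T \<sigma> Q"
proof -
  define I where "I m \<tau> \<longleftrightarrow> (\<exists>i. i + m = N \<and> Inv i \<tau> \<and> \<tau> v 0 = int i \<and>
    (\<forall>u. u \<notin> insert v (writes c) \<longrightarrow> \<tau> u = \<sigma> u))" for m \<tau>
  let ?incr = "assign v (Add (var v) (Const 1))"
  let ?w = "While (Less (var v) e) (Seq c ?incr)"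
  have "run ?w ((N + 1) * (bcost (Less (var v) e) + 1 + (t + 6))) (sem (assign v (Const 0)) \<sigma>) Q"
  proof (rule run_While[where Inv = I and m = N])
    show "I N (sem (assign v (Const 0)) \<sigma>)"
      unfolding I_def using v(2)[OF init] by (intro exI[of _ 0]) simp
  next
    fix m \<tau>
    assume "I m \<tau>" and b: "bval (Less (var v) e) \<tau>"
    then obtain i where i: "i + m = N" "Inv i \<tau>" "\<tau> v 0 = int i"
      "\<And>u. u \<notin> insert v (writes c) \<Longrightarrow> \<tau> u = \<sigma> u"
      unfolding I_def by blast
    have "i < N"
      using b i(3) bound[OF i(4)] by simp
    have "run c t \<tau> (\<lambda>\<tau>'. run ?incr 6 \<tau>' (\<lambda>\<tau>'. \<exists>m'<m. I m' \<tau>'))"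
    proof (rule run_mono[OF body[OF \<open>i < N\<close> i(2,3,4)]])
      fix \<tau>'
      assume inv: "Inv (Suc i) \<tau>'" and fr: "\<And>u. u \<notin> writes c \<Longrightarrow> \<tau>' u = \<tau> u"
      have "I (m - 1) (sem ?incr \<tau>')"
        unfolding I_def using v(2)[OF inv] fr[OF v(1)] i(1,3,4) fr \<open>i < N\<close>
        by (intro exI[of _ "Suc i"]) simp
      moreover have "m - 1 < m"
        using \<open>i < N\<close> i(1) by simp
      ultimately show "run ?incr 6 \<tau>' (\<lambda>\<tau>'. \<exists>m'<m. I m' \<tau>')"
        by (intro run_sem) (auto simp del: sem.simps)
    qed auto
    then show "run (Seq c ?incr) (t + 6) \<tau> (\<lambda>\<tau>'. \<exists>m'<m. I m' \<tau>')"
      by (rule run_Seq)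
  next
    fix m \<tau>
    assume "I m \<tau>" and b: "\<not> bval (Less (var v) e) \<tau>"
    then obtain i where i: "i + m = N" "Inv i \<tau>" "\<tau> v 0 = int i"
      "\<And>u. u \<notin> insert v (writes c) \<Longrightarrow> \<tau> u = \<sigma> u"
      unfolding I_def by blast
    then have "i = N"
      using b bound[OF i(4)] by simp
    then show "Q \<tau>"
      using post i by blast
  qed
  \<comment> \<open>Initialisation costs 3; a round costs \<open>acost e + 4\<close> for the test
    and 6 for the increment, besides the body. Charging the 3 to every round gives the 13 in
    \<open>time\<close>.\<close>
  then have "run (For v e c) (3 + (N + 1) * (bcost (Less (var v) e) + 1 + (t + 6))) \<sigma> Q"
    unfolding For_def by (intro run_Seq[OF run_sem]) simp_all
  then show ?thesis
    by (rule run_mono) (use time in \<open>auto simp: algebra_simps\<close>)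
qed

section \<open>The covering theorem of Crittenden and Vanden Eynden\<close>

text \<open>A Vandermonde argument that does not ask the \<open>z i\<close> to be distinct.
  Subtracting \<open>z j\<close> times the sum at \<open>t\<close> from the sum at
  \<open>t + 1\<close> removes the term \<open>j\<close> and shortens the range of zeros by one. By
  induction the difference vanishes at \<open>t = 0\<close> too, and dividing by \<open>z j\<close>
  finishes.\<close>

lemma exponential_sum_zero:
  fixes c z :: "'i \<Rightarrow> complex"
  assumes "finite I" "\<And>i. i \<in> I \<Longrightarrow> z i \<noteq> 0"
    and "\<And>t. 1 \<le> t \<Longrightarrow> t \<le> card I \<Longrightarrow> (\<Sum>i\<in>I. c i * z i ^ t) = 0"
  shows "(\<Sum>i\<in>I. c i) = 0"
  using assms
proof (induction I arbitrary: c rule: finite_induct)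
  case empty
  then show ?case by simp
next
  case (insert j I)
  let ?f = "\<lambda>t. \<Sum>i\<in>insert j I. c i * z i ^ t"
  have shift: "(\<Sum>i\<in>I. c i * (z i - z j) * z i ^ t) = ?f (Suc t) - z j * ?f t" for t
    using insert.hyps by (simp add: algebra_simps sum.distrib sum_distrib_left sum_subtractf)
  have "(\<Sum>i\<in>I. c i * (z i - z j)) = 0"
  proof (rule insert.IH)
    fix t assume "1 \<le> t" "t \<le> card I"
    then show "(\<Sum>i\<in>I. c i * (z i - z j) * z i ^ t) = 0"
      using shift[of t] insert.prems(2)[of t] insert.prems(2)[of "Suc t"] insert.hyps by simp
  qed (use insert.prems(1) in auto)
  then have "z j * ?f 0 = ?f 1"
    using shift[of 0] by simp
  also have "?f 1 = 0"
    using insert.prems(2)[of 1] insert.hyps by simp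
  finally show ?case
    using insert.prems(1)[of j] by simp
qed

lemma cis_eq_1_iff_dvd:
  assumes "d > 0"
  shows "cis (2 * pi * of_int a / of_int d) = 1 \<longleftrightarrow> d dvd a"
proof
  assume "cis (2 * pi * of_int a / of_int d) = 1"
  then have "cos (2 * pi * of_int a / of_int d) = 1"
    by (metis Re_complex_of_real cis.sel(1) of_real_1)
  then obtain n :: int where "2 * pi * of_int a / of_int d = of_int n * 2 * pi"
    using cos_one_2pi_int by auto
  then have "real_of_int a = of_int (d * n)"
    using assms by (simp add: field_simps)
  then show "d dvd a"
    by (metis dvd_triv_left of_int_eq_iff)
next
  assume "d dvd a"
  then obtain n where "a = d * n"
    by blast
  then have "2 * pi * of_int a / of_int d = 2 * pi * of_int n"
    using assms by simp
  then show "cis (2 * pi * of_int a / of_int d) = 1"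
    by (metis cis_multiple_2pi Ints_of_int)
qed

lemma prod_one_minus:
  fixes x :: "'a \<Rightarrow> 'b::comm_ring_1"
  assumes "finite L"
  shows "(\<Prod>l\<in>L. 1 - x l) = (\<Sum>S\<in>Pow L. \<Prod>l\<in>S. - x l)"
  using prod_add[OF assms, of "\<lambda>l. - x l" "\<lambda>_. 1"] by simp

text \<open>
  The product of the factors \<open>1 - cis (2 \<pi> (c l + t e) / d l)\<close> vanishes exactly at the covered \<open>t\<close>, and
  expands into a sum of one exponential in \<open>t\<close> for each subset of \<open>L\<close>.
\<close>

theorem covering_extends:
  fixes c d :: "'l \<Rightarrow> int" and e :: int
  assumes "finite L" "\<And>l. l \<in> L \<Longrightarrow> d l > 0"
    and cov: "\<And>t. 1 \<le> t \<Longrightarrow> t \<le> 2 ^ card L \<Longrightarrow> \<exists>l\<in>L. d l dvd c l + int t * e"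
  shows "\<exists>l\<in>L. d l dvd c l"
proof -
  define w where "w l t = cis (2 * pi * of_int (c l + int t * e) / of_int (d l))" for l t
  define u where "u l = cis (2 * pi * of_int e / of_int (d l))" for l
  have w: "w l t = w l 0 * u l ^ t" for l t
    by (simp add: w_def u_def DeMoivre cis_mult add_divide_distrib algebra_simps)
  have expand: "(\<Prod>l\<in>L. 1 - w l t) = (\<Sum>S\<in>Pow L. (\<Prod>l\<in>S. - w l 0) * (\<Prod>l\<in>S. u l) ^ t)" for t
    unfolding prod_one_minus[OF assms(1)]
    by (intro sum.cong[OF refl]) (simp add: w[of _ t] prod.distrib prod_power_distrib flip: prod.distrib)
  have zero: "(\<Prod>l\<in>L. 1 - w l t) = 0 \<longleftrightarrow> (\<exists>l\<in>L. d l dvd c l + int t * e)" for t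
    unfolding w_def using assms(1) by (force simp: cis_eq_1_iff_dvd[OF assms(2)] simp del: of_int_add)
  \<comment> \<open>There are \<open>2 ^ card L\<close> exponentials, so that many consecutive zeros
    force one more at \<open>t = 0\<close>.\<close>
  have "(\<Sum>S\<in>Pow L. \<Prod>l\<in>S. - w l 0) = 0"
  proof (rule exponential_sum_zero)
    show "(\<Sum>S\<in>Pow L. (\<Prod>l\<in>S. - w l 0) * (\<Prod>l\<in>S. u l) ^ t) = 0"
      if "1 \<le> t" "t \<le> card (Pow L)" for t
      using cov[of t] zero[of t] expand[of t] that assms(1) by (simp add: card_Pow)
    show "(\<Prod>l\<in>S. u l) \<noteq> 0" if "S \<in> Pow L" for S
      using finite_subset[of S L] that assms(1) by (simp add: u_def prod_zero_iff)
  qed (use assms(1) in simp)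
  then show ?thesis
    using expand[of 0] zero[of 0] by simp
qed

section \<open>Partitions into arithmetic progressions\<close>

definition ap :: "int \<Rightarrow> int \<Rightarrow> nat \<Rightarrow> int set" where
  "ap a d m = (\<lambda>t. a + int t * d) ` {0..m}"

lemma mem_ap: "y \<in> ap a d m \<longleftrightarrow> (\<exists>t\<le>m. y = a + int t * d)"
  by (auto simp: ap_def)

lemma ap_Suc: "ap a d (Suc m) = insert (a + int (Suc m) * d) (ap a d m)"
  by (auto simp: ap_def atLeast0_atMost_Suc)

lemma ap_0: "ap a d 0 = {a}"
  by (auto simp: ap_def)

lemma is_AP_ap: "is_AP (ap a d m)"
  by (auto simp: is_AP_def ap_def)

lemma is_AP_positive:
  assumes "is_AP s"
  obtains a d m where "d > 0" "s = ap a d m"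
proof -
  obtain a d m where s: "s = ap a d m"
    using assms by (auto simp: is_AP_def ap_def)
  consider "d > 0" | "d = 0" | "d < 0"
    by linarith
  then show thesis
  proof cases
    case 2
    then have "s = ap a 1 0"
      by (auto simp: s mem_ap)
    then show thesis
      using that[of 1 a 0] by simp
  next
    case 3
    have rev: "a + int t * d = (a + int m * d) + int (m - t) * (- d)" if "t \<le> m" for t
      using that by (simp add: of_nat_diff algebra_simps)
    have rev': "(a + int m * d) + int t * (- d) = a + int (m - t) * d" if "t \<le> m" for t
      using that by (simp add: of_nat_diff algebra_simps)
    have "s = ap (a + int m * d) (- d) m"
    proof (rule set_eqI)
      fix y
      show "y \<in> s \<longleftrightarrow> y \<in> ap (a + int m * d) (- d) m"
        unfolding s mem_ap using rev rev' by (metis diff_le_self)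
    qed
    then show thesis
      using that[of "- d" "a + int m * d" m] 3 by simp
  qed (use that s in blast)
qed

definition AP_partition :: "int set \<Rightarrow> nat \<Rightarrow> bool" where
  "AP_partition X m \<longleftrightarrow> (\<exists>T. (\<forall>i<m. is_AP (T i)) \<and>
     (\<forall>i<m. \<forall>j<m. i \<noteq> j \<longrightarrow> disjnt (T i) (T j)) \<and> (\<Union>i<m. T i) = X)"

lemma XCAP_iff_AP_partition: "XCAP X (int m) \<longleftrightarrow> AP_partition X m"
proof
  assume "XCAP X (int m)"
  then obtain ss where ss: "length ss = m" "\<forall>s\<in>set ss. is_AP s \<and> s \<subseteq> X"
    "pairwise (\<lambda>i j. disjnt (ss ! i) (ss ! j)) {..<m}" "\<Union>(set ss) = X"
    unfolding XCAP_def by auto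
  have "(\<Union>i<m. ss ! i) = X"
    using ss(1,4) by (auto simp: set_conv_nth)
  then show "AP_partition X m"
    unfolding AP_partition_def using ss by (intro exI[of _ "\<lambda>i. ss ! i"]) (auto simp: pairwise_def)
next
  assume "AP_partition X m"
  then obtain T where "\<forall>i<m. is_AP (T i)"
    "\<forall>i<m. \<forall>j<m. i \<noteq> j \<longrightarrow> disjnt (T i) (T j)" "(\<Union>i<m. T i) = X"
    unfolding AP_partition_def by blast
  then show "XCAP X (int m)"
    unfolding XCAP_def by (intro exI[of _ "map T [0..<m]"]) (auto simp: pairwise_def)
qed

text \<open>With fewer parts than elements some progression has two elements, and its last one can
  be split off as a singleton.\<close>

lemma AP_partition_Suc:
  assumes "AP_partition X m" "m < card X"
  shows "AP_partition X (Suc m)"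
proof -
  obtain T where T: "\<And>i. i < m \<Longrightarrow> is_AP (T i)" "(\<Union>i<m. T i) = X"
    "\<And>i j. i < m \<Longrightarrow> j < m \<Longrightarrow> i \<noteq> j \<Longrightarrow> disjnt (T i) (T j)"
    using assms(1) unfolding AP_partition_def by blast
  have "\<exists>i<m. card (T i) > 1"
  proof (rule ccontr)
    assume "\<not> (\<exists>i<m. card (T i) > 1)"
    then have "(\<Sum>i<m. card (T i)) \<le> (\<Sum>i<m. 1)"
      by (intro sum_mono) (meson lessThan_iff not_less)
    moreover have "card X \<le> (\<Sum>i<m. card (T i))"
      using card_UN_le[of "{..<m}" T] T(2) by simp
    ultimately show False
      using assms(2) by simp
  qed
  then obtain i where i: "i < m" "card (T i) > 1"
    by blast
  obtain a d l where d: "d > 0" "T i = ap a d l"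
    by (rule is_AP_positive[OF T(1)[OF i(1)]])
  then obtain l' where l': "l = Suc l'"
    using i(2) by (cases l) (auto simp: ap_0)
  let ?z = "a + int l * d"
  have z: "?z \<notin> ap a d l'"
    using d(1) l' by (auto simp: mem_ap)
  have Ti: "T i = insert ?z (ap a d l')"
    using d(2) l' ap_Suc by simp
  define T' where "T' = T(i := ap a d l', m := {?z})"
  have "is_AP (T' j)" if "j < Suc m" for j
    using T(1) that is_AP_ap[of a d l'] is_AP_ap[of ?z 0 0] by (auto simp: T'_def ap_0 less_Suc_eq)
  moreover have "disjnt (T' j) (T' j')" if "j < Suc m" "j' < Suc m" "j \<noteq> j'" for j j'
    using T(3)[of j j'] T(3)[of i j] T(3)[of i j'] that i(1) z Ti
    by (auto simp: T'_def less_Suc_eq disjnt_def)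
  moreover have "(\<Union>j<Suc m. T' j) = X"
  proof -
    have "(\<Union>j<Suc m. T' j) = T' m \<union> T' i \<union> (\<Union>j\<in>{..<m} - {i}. T' j)"
      using i(1) by (auto simp: less_Suc_eq)
    also have "\<dots> = T i \<union> (\<Union>j\<in>{..<m} - {i}. T j)"
      using i(1) Ti by (auto simp: T'_def)
    also have "\<dots> = X"
      unfolding T(2)[symmetric] using i(1) by auto
    finally show ?thesis .
  qed
  ultimately show ?thesis
    unfolding AP_partition_def by blast
qed

lemma AP_partition_mono:
  assumes "AP_partition X m" "m \<le> k" "k \<le> card X"
  shows "AP_partition X k"
  using assms(2,3)
proof (induction k rule: dec_induct)
  case base
  then show ?case using assms(1) by simp
next
  case (step k)
  then show ?case by (intro AP_partition_Suc) auto
qed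

lemma AP_partition_le_card:
  assumes "AP_partition X m" "finite X"
  shows "m \<le> card X"
proof -
  obtain T where T: "\<And>i. i < m \<Longrightarrow> is_AP (T i)" "(\<Union>i<m. T i) = X"
    "\<And>i j. i < m \<Longrightarrow> j < m \<Longrightarrow> i \<noteq> j \<Longrightarrow> disjnt (T i) (T j)"
    using assms(1) unfolding AP_partition_def by blast
  have "\<exists>y. y \<in> T i" if "i < m" for i
    using T(1)[OF that] by (auto simp: is_AP_def)
  then obtain f where f: "\<And>i. i < m \<Longrightarrow> f i \<in> T i"
    by metis
  have "inj_on f {..<m}"
    using f T(3) by (metis disjnt_iff inj_onI lessThan_iff)
  moreover have "f ` {..<m} \<subseteq> X"
    using f T(2) by auto
  ultimately show ?thesis
    using card_inj_on_le[OF _ _ assms(2)] by fastforce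
qed

text \<open>The sweep finds at most \<open>k\<close> progressions, whereas exactly \<open>k\<close>
  are required; splitting bridges the gap. The range of \<open>k\<close> is what the program tests
  first.\<close>

lemma XCAP_iff_at_most:
  assumes "finite X"
  shows "XCAP X k \<longleftrightarrow> 0 \<le> k \<and> k \<le> int (card X) \<and> (\<exists>m\<le>nat k. AP_partition X m)"
proof (cases "k \<ge> 0")
  case True
  then obtain m where k: "k = int m"
    using nonneg_int_cases by blast
  show ?thesis
    unfolding k XCAP_iff_AP_partition
    using AP_partition_le_card[OF _ assms] AP_partition_mono by auto
qed (auto simp: XCAP_def)

section \<open>The sweep\<close>

text \<open>
  Block \<open>i\<close> starts at \<open>bs i\<close>, has difference \<open>df i\<close> and expects \<open>nx i\<close> next. The first \<open>dn\<close> entries of \<open>tab\<close> are the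
  learnt differences, where \<open>tab 0 = 0\<close> stands for an unknown one: a block opened with it expects an
  element that has already been passed, and hence stays a singleton. The advice is read at \<open>ptr\<close>.
\<close>

record machine =
  pos :: nat
  ptr :: nat
  cnt :: nat
  dn :: nat
  bs :: "nat \<Rightarrow> int"
  df :: "nat \<Rightarrow> int"
  nx :: "nat \<Rightarrow> int"
  tab :: "nat \<Rightarrow> int"

text \<open>Division without a division instruction: a difference worth learning is realised by two
  input elements, so it can be found by trying all pairs. Failure yields 0, the code for an unknown
  difference.\<close>

definition quot :: "int list \<Rightarrow> nat \<Rightarrow> int \<Rightarrow> int" where
  "quot ys q z = (if 0 < q \<and> (\<exists>y\<in>set ys. \<exists>y'\<in>set ys. int q * (y - y') = z) then z div int q else 0)"

definition expecting :: "int list \<Rightarrow> machine \<Rightarrow> nat set" where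
  "expecting ys st = {i. i < cnt st \<and> nx st i = ys ! pos st}"

definition advance :: "nat \<Rightarrow> machine \<Rightarrow> machine" where
  "advance i st = st\<lparr>pos := Suc (pos st), nx := (nx st)(i := nx st i + df st i)\<rparr>"

definition open_block :: "int list \<Rightarrow> nat \<Rightarrow> machine \<Rightarrow> machine" where
  "open_block ys w st = st\<lparr>pos := Suc (pos st), cnt := Suc (cnt st),
     bs := (bs st)(cnt st := ys ! pos st), df := (df st)(cnt st := tab st w),
     nx := (nx st)(cnt st := ys ! pos st + tab st w)\<rparr>"

text \<open>The measured distance is entered at \<open>dn st\<close> before \<open>w\<close> is
  looked up. So \<open>w = dn st\<close> selects this distance and a smaller \<open>w\<close> an
  older entry, and one formula covers both ways of learning.\<close>

definition learn :: "int list \<Rightarrow> nat \<Rightarrow> nat \<Rightarrow> nat \<Rightarrow> nat \<Rightarrow> machine \<Rightarrow> machine" where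
  "learn ys h w q r st = (let tb = (tab st)(dn st := ys ! pos st - bs st h) in
     st\<lparr>pos := 0, cnt := 0, dn := dn st + 2,
       tab := tb(Suc (dn st) := quot ys q (int r * tb w))\<rparr>)"

text \<open>The entry \<open>h\<close> also encodes the kind of decision, and every value means
  something. Thus no advice is malformed and \<open>blocks\<close> survives all of them.\<close>

definition act :: "int list \<Rightarrow> nat \<Rightarrow> nat \<Rightarrow> nat \<Rightarrow> nat \<Rightarrow> nat \<Rightarrow> machine \<Rightarrow> machine" where
  "act ys k h w q r st =
     (if h < cnt st \<and> nx st h = ys ! pos st then advance h st
      else if cnt st \<le> h \<and> cnt st < k then open_block ys w st
      else learn ys h w q r st)"

definition step :: "int list \<Rightarrow> nat \<Rightarrow> (nat \<Rightarrow> nat) \<Rightarrow> machine \<Rightarrow> machine" where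
  "step ys k G st =
     (if card (expecting ys st) = 1 then advance (the_elem (expecting ys st)) st
      else act ys k (G (ptr st)) (G (ptr st + 1)) (G (ptr st + 2)) (G (ptr st + 3))
             (st\<lparr>ptr := ptr st + 4\<rparr>))"

text \<open>As in the loop guard of the program, \<open>ptr st < L\<close> is demanded before forced
  steps as well.\<close>

inductive wins :: "int list \<Rightarrow> nat \<Rightarrow> nat \<Rightarrow> (nat \<Rightarrow> nat) \<Rightarrow> machine \<Rightarrow> bool" for ys k L G where
  finished: "pos st = length ys \<Longrightarrow> wins ys k L G st"
| continue: "pos st < length ys \<Longrightarrow> ptr st < L \<Longrightarrow> wins ys k L G (step ys k G st) \<Longrightarrow> wins ys k L G st"

section \<open>Soundness of the sweep under arbitrary advice\<close>

definition seen :: "int list \<Rightarrow> machine \<Rightarrow> int set" where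
  "seen ys st = set (take (pos st) ys)"

lemma seen_Suc:
  "pos st < length ys \<Longrightarrow> pos st' = Suc (pos st) \<Longrightarrow> seen ys st' = insert (ys ! pos st) (seen ys st)"
  by (simp add: seen_def take_Suc_conv_app_nth)

lemma seen_less:
  assumes "sorted_wrt (<) ys" "pos st < length ys" "z \<in> seen ys st"
  shows "z < ys ! pos st"
  using assms sorted_wrt_nth_less by (fastforce simp: seen_def in_set_conv_nth)

lemma not_seen_le:
  assumes "sorted_wrt (<) ys" "pos st < length ys" "y \<in> set ys" "y \<notin> seen ys st"
  shows "ys ! pos st \<le> y"
proof -
  obtain i where i: "i < length ys" "y = ys ! i"
    using assms(3) by (auto simp: in_set_conv_nth)
  have "\<not> i < pos st"
    using assms(2,4) i by (force simp: seen_def in_set_conv_nth)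
  then show ?thesis
    using sorted_wrt_nth_less[OF assms(1), of "pos st" i] i by (cases "i = pos st") auto
qed

text \<open>The ghost function \<open>m\<close> counts how often each block has been extended.
  Nothing is assumed about the sign of differences: a block with a negative one merely expects an
  element that has been passed.\<close>

definition blocks :: "int list \<Rightarrow> nat \<Rightarrow> machine \<Rightarrow> (nat \<Rightarrow> nat) \<Rightarrow> bool" where
  "blocks ys k st m \<longleftrightarrow> cnt st \<le> k \<and> pos st \<le> length ys \<and>
     (\<forall>i<cnt st. nx st i = bs st i + int (Suc (m i)) * df st i) \<and>
     (\<forall>i<cnt st. \<forall>j<cnt st. i \<noteq> j \<longrightarrow> disjnt (ap (bs st i) (df st i) (m i)) (ap (bs st j) (df st j) (m j))) \<and>
     (\<Union>i<cnt st. ap (bs st i) (df st i) (m i)) = seen ys st"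

lemma blocks_advance:
  assumes "sorted_wrt (<) ys" "blocks ys k st m" "pos st < length ys"
    "i < cnt st" "nx st i = ys ! pos st"
  shows "blocks ys k (advance i st) (m(i := Suc (m i)))"
proof -
  let ?x = "ys ! pos st"
  let ?T = "\<lambda>j. ap (bs st j) (df st j) (m j)"
  let ?T' = "\<lambda>j. ap (bs st j) (df st j) ((m(i := Suc (m i))) j)"
  have new: "?x \<notin> seen ys st"
    using seen_less[OF assms(1,3)] by blast
  have U: "(\<Union>j<cnt st. ?T j) = seen ys st"
    using assms(2) by (simp add: blocks_def)
  have i: "?T' i = insert ?x (?T i)"
    using assms(2,4,5) by (simp add: blocks_def ap_Suc)
  have j: "?T' j = ?T j" if "j \<noteq> i" for j
    using that by simp
  have "(\<Union>j<cnt st. ?T' j) = ?T' i \<union> (\<Union>j\<in>{..<cnt st} - {i}. ?T' j)"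
    using assms(4) by blast
  also have "\<dots> = insert ?x (?T i \<union> (\<Union>j\<in>{..<cnt st} - {i}. ?T j))"
    unfolding i by simp
  also have "?T i \<union> (\<Union>j\<in>{..<cnt st} - {i}. ?T j) = (\<Union>j<cnt st. ?T j)"
    using assms(4) by blast
  finally have "(\<Union>j<cnt st. ?T' j) = insert ?x (\<Union>j<cnt st. ?T j)" .
  moreover have "disjnt (?T' j) (?T' j')" if "j < cnt st" "j' < cnt st" "j \<noteq> j'" for j j'
  proof -
    have "disjnt (?T j) (?T j')"
      using assms(2) that by (simp add: blocks_def)
    moreover have "?x \<notin> ?T j" "?x \<notin> ?T j'"
      using that new U by blast+
    ultimately show ?thesis
      using i j that(3) by (cases "j = i"; cases "j' = i") auto
  qed
  ultimately show ?thesis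
    using assms U unfolding blocks_def
    by (auto simp: advance_def seen_Suc[OF assms(3)] algebra_simps)
qed

lemma blocks_open_block:
  assumes "sorted_wrt (<) ys" "blocks ys k st m" "pos st < length ys" "cnt st < k"
  shows "blocks ys k (open_block ys w st) (m(cnt st := 0))"
proof -
  let ?x = "ys ! pos st"
  let ?T = "\<lambda>j. ap (bs st j) (df st j) (m j)"
  have new: "?x \<notin> seen ys st"
    using seen_less[OF assms(1,3)] by blast
  have U: "(\<Union>j<cnt st. ?T j) = seen ys st"
    using assms(2) by (simp add: blocks_def)
  let ?st = "open_block ys w st"
  let ?T' = "\<lambda>j. ap (bs ?st j) (df ?st j) ((m(cnt st := 0)) j)"
  have old: "?T' j = ?T j" if "j < cnt st" for j
    using that by (simp add: open_block_def)
  have fresh: "?T' (cnt st) = {?x}"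
    by (simp add: open_block_def ap_0)
  have "(\<Union>j<Suc (cnt st). ?T' j) = insert ?x (seen ys st)"
    using old fresh U by (simp add: lessThan_Suc)
  moreover have "disjnt (?T' j) (?T' j')" if "j < Suc (cnt st)" "j' < Suc (cnt st)" "j \<noteq> j'" for j j'
  proof -
    have "?x \<notin> ?T i" if "i < cnt st" for i
      using that new U by blast
    moreover have "disjnt (?T j) (?T j')" if "j < cnt st" "j' < cnt st"
      using assms(2) that \<open>j \<noteq> j'\<close> by (simp add: blocks_def)
    ultimately show ?thesis
      using old fresh that by (auto simp: less_Suc_eq)
  qed
  moreover have "nx ?st j = bs ?st j + int (Suc ((m(cnt st := 0)) j)) * df ?st j"
    if "j < Suc (cnt st)" for j
    using assms(2) that by (auto simp: blocks_def open_block_def less_Suc_eq)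
  moreover have "cnt ?st = Suc (cnt st)" "pos ?st = Suc (pos st)"
    by (simp_all add: open_block_def)
  ultimately show ?thesis
    using assms(3,4) seen_Suc[OF assms(3), of ?st] unfolding blocks_def by simp
qed

lemma blocks_initial: "pos st = 0 \<Longrightarrow> cnt st = 0 \<Longrightarrow> blocks ys k st m"
  by (simp add: blocks_def seen_def)

lemma blocks_ptr [simp]: "blocks ys k (st\<lparr>ptr := p\<rparr>) m = blocks ys k st m"
  by (simp add: blocks_def seen_def)

lemma blocks_step:
  assumes "sorted_wrt (<) ys" "\<exists>m. blocks ys k st m" "pos st < length ys"
  shows "\<exists>m. blocks ys k (step ys k G st) m"
proof -
  obtain m where m: "blocks ys k st m"
    using assms(2) by blast
  show ?thesis
  proof (cases "card (expecting ys st) = 1")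
    case True
    then obtain i where "expecting ys st = {i}"
      by (auto simp: card_1_singleton_iff)
    then show ?thesis
      using blocks_advance[OF assms(1) m assms(3), of i] True by (auto simp: step_def expecting_def)
  next
    case False
    let ?st = "st\<lparr>ptr := ptr st + 4\<rparr>"
    have m': "blocks ys k ?st m" "pos ?st < length ys"
      using m assms(3) by simp_all
    have "\<exists>m. blocks ys k (act ys k h w q r ?st) m" for h w q r
      unfolding act_def
      using blocks_advance[OF assms(1) m', of h] blocks_open_block[OF assms(1) m', of w]
        blocks_initial[of "learn ys h w q r ?st" ys k m]
      by (auto simp: learn_def Let_def)
    then show ?thesis
      using False by (simp add: step_def)
  qed
qed

lemma blocks_finished:
  assumes "blocks ys k st m" "pos st = length ys"
  shows "\<exists>c\<le>k. AP_partition (set ys) c"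
proof (intro exI[of _ "cnt st"] conjI)
  show "AP_partition (set ys) (cnt st)"
    using assms is_AP_ap unfolding blocks_def seen_def AP_partition_def
    by (intro exI[of _ "\<lambda>i. ap (bs st i) (df st i) (m i)"]) simp
qed (use assms in \<open>simp add: blocks_def\<close>)

section \<open>Following a solution\<close>

text \<open>The \<open>card U - 1\<close> open intervals between neighbours are disjoint, so they
  cannot each contain a point of the smaller set \<open>Z\<close>.\<close>

lemma consecutive_gap:
  fixes y :: "nat \<Rightarrow> int"
  assumes "finite U" "finite Z" "card Z + 1 < card U" "strict_mono y"
  obtains u u' where "u \<in> U" "u' \<in> U" "u < u'" "\<And>v. v \<in> U \<Longrightarrow> \<not> (u < v \<and> v < u')"
    "\<And>z. z \<in> Z \<Longrightarrow> \<not> (y u < z \<and> z < y u')"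
proof -
  have ne: "U \<noteq> {}"
    using assms(3) by auto
  define U0 where "U0 = U - {Max U}"
  define nxt where "nxt u = Min {v \<in> U. u < v}" for u
  have nxt: "nxt u \<in> U \<and> u < nxt u \<and> (\<forall>v\<in>U. u < v \<longrightarrow> nxt u \<le> v)" if "u \<in> U0" for u
  proof -
    have "Max U \<in> {v \<in> U. u < v}"
      using that ne assms(1) unfolding U0_def by (auto simp: order_less_le)
    then have "nxt u \<in> {v \<in> U. u < v}"
      unfolding nxt_def using assms(1) by (intro Min_in) auto
    then show ?thesis
      unfolding nxt_def using assms(1) by auto
  qed
  have "\<exists>u\<in>U0. \<forall>z\<in>Z. \<not> (y u < z \<and> z < y (nxt u))"
  proof (rule ccontr)
    assume "\<not> ?thesis"
    then obtain f where f: "\<And>u. u \<in> U0 \<Longrightarrow> f u \<in> Z \<and> y u < f u \<and> f u < y (nxt u)"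
      by metis
    have lt: "f u < f v" if "u \<in> U0" "v \<in> U0" "u < v" for u v
    proof -
      have "nxt u \<le> v"
        using nxt[OF that(1)] that(2,3) by (auto simp: U0_def)
      then have "y (nxt u) \<le> y v"
        using assms(4) by (simp add: strict_mono_less_eq)
      then show ?thesis
        using f[OF that(1)] f[OF that(2)] by linarith
    qed
    then have "inj_on f U0"
      by (metis inj_onI less_irrefl linorder_neqE_nat)
    then have "card U0 \<le> card Z"
      using f assms(2) by (intro card_inj_on_le[of f]) auto
    then show False
      using assms(1,3) ne by (simp add: U0_def card_Diff_singleton)
  qed
  then obtain u where "u \<in> U0" "\<And>z. z \<in> Z \<Longrightarrow> \<not> (y u < z \<and> z < y (nxt u))"
    by blast
  then show thesis
    using that[of u "nxt u"] nxt[of u] by (force simp: U0_def)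
qed

text \<open>
  Entries beyond \<open>cnt\<close> and \<open>dn\<close> are left over from earlier attempts. A winning advice must not
  depend on them.
\<close>

definition similar :: "machine \<Rightarrow> machine \<Rightarrow> bool" where
  "similar st st' \<longleftrightarrow> pos st' = pos st \<and> ptr st' = ptr st \<and> cnt st' = cnt st \<and> dn st' = dn st \<and>
     (\<forall>i<cnt st. bs st' i = bs st i \<and> df st' i = df st i \<and> nx st' i = nx st i) \<and>
     (\<forall>i<dn st. tab st' i = tab st i)"

lemma similar_ptr: "similar st st' \<Longrightarrow> similar (st\<lparr>ptr := p\<rparr>) (st'\<lparr>ptr := p\<rparr>)"
  by (simp add: similar_def)

lemma similar_advance: "similar st st' \<Longrightarrow> i < cnt st \<Longrightarrow> similar (advance i st) (advance i st')"
  by (simp add: similar_def advance_def)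

lemma similar_expecting: "similar st st' \<Longrightarrow> expecting ys st' = expecting ys st"
  by (auto simp: similar_def expecting_def)

lemma similar_act:
  assumes "similar st st'" "w \<le> dn st" "h < cnt st \<or> cnt st < k \<and> w < dn st"
  shows "similar (act ys k h w q r st) (act ys k h w q r st')"
  using assms unfolding similar_def act_def
  by (auto simp: advance_def open_block_def learn_def Let_def less_Suc_eq)

section \<open>The progressions of a fixed solution\<close>

locale solution =
  fixes ys :: "int list" and k :: nat and a d :: "nat \<Rightarrow> int" and l :: "nat \<Rightarrow> nat"
  assumes sorted: "sorted_wrt (<) ys"
    and d_pos: "\<And>j. j < k \<Longrightarrow> d j > 0"
    and disjoint: "\<And>i j. i < k \<Longrightarrow> j < k \<Longrightarrow> i \<noteq> j \<Longrightarrow> disjnt (ap (a i) (d i) (l i)) (ap (a j) (d j) (l j))"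
    and cover: "(\<Union>j<k. ap (a j) (d j) (l j)) = set ys"
begin

definition S :: "nat \<Rightarrow> int set" where
  "S j = ap (a j) (d j) (l j)"

lemma S_subset: "j < k \<Longrightarrow> y \<in> S j \<Longrightarrow> y \<in> set ys"
  using cover by (auto simp: S_def)

lemma S_ex: "y \<in> set ys \<Longrightarrow> \<exists>j<k. y \<in> S j"
  using cover by (auto simp: S_def)

lemma S_unique: "i < k \<Longrightarrow> j < k \<Longrightarrow> y \<in> S i \<Longrightarrow> y \<in> S j \<Longrightarrow> i = j"
  using disjoint[of i j] by (auto simp: S_def disjnt_def)

lemma mem_S_iff:
  assumes "j < k"
  shows "y \<in> S j \<longleftrightarrow> a j \<le> y \<and> y \<le> a j + int (l j) * d j \<and> d j dvd y - a j"
proof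
  assume "y \<in> S j"
  then obtain t where "t \<le> l j" "y = a j + int t * d j"
    by (auto simp: S_def mem_ap)
  then show "a j \<le> y \<and> y \<le> a j + int (l j) * d j \<and> d j dvd y - a j"
    using d_pos[OF assms] by (simp add: mult_right_mono)
next
  assume y: "a j \<le> y \<and> y \<le> a j + int (l j) * d j \<and> d j dvd y - a j"
  then obtain z where z: "y - a j = z * d j"
    by (metis dvd_def mult.commute)
  have "0 \<le> z"
    using y z d_pos[OF assms] by (metis diff_ge_0_iff_ge zero_le_mult_iff not_less)
  moreover have "z \<le> int (l j)"
    using y z d_pos[OF assms] by (metis add_le_cancel_left diff_add_cancel add.commute mult_le_cancel_right not_less)
  ultimately show "y \<in> S j"
    unfolding S_def mem_ap using z by (intro exI[of _ "nat z"]) auto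
qed

lemma S_between:
  assumes "j < k" "b \<in> S j" "y \<in> S j" "v = b + int t * d j" "v \<le> y"
  shows "v \<in> S j"
proof -
  have "b \<le> v"
    using assms(4) d_pos[OF assms(1)] by simp
  moreover have "d j dvd (b - a j) + int t * d j"
    using assms(1,2) by (intro dvd_add) (simp_all add: mem_S_iff)
  moreover have "(b - a j) + int t * d j = v - a j"
    using assms(4) by simp
  ultimately show ?thesis
    using assms(1,2,3,5) by (simp add: mem_S_iff)
qed

lemma S_distance:
  assumes "j < k" "b \<in> S j" "y \<in> S j" "b \<le> y"
  obtains t where "y = b + int t * d j"
proof -
  have "d j dvd (y - a j) - (b - a j)"
    by (rule dvd_diff) (use assms in \<open>simp_all add: mem_S_iff\<close>)
  then obtain z where z: "y - b = z * d j"
    by (metis diff_diff_eq2 diff_add_cancel dvd_def mult.commute)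
  then have "0 \<le> z"
    using assms(4) d_pos[OF assms(1)] by (metis diff_ge_0_iff_ge zero_le_mult_iff not_less)
  then show thesis
    using that[of "nat z"] z by simp
qed

section \<open>Relating the sweep to the solution\<close>

definition known :: "machine \<Rightarrow> nat \<Rightarrow> bool" where
  "known st j \<longleftrightarrow> d j \<in> tab st ` {..<dn st}"

text \<open>
  The sweep is lazy: a block follows its progression \<open>S (lam i)\<close> of the solution at first, but runs on beyond the end
  of the latter until it collides. Whenever it is stopped, \<open>S (lam i)\<close> has already ended.
\<close>

definition tracks :: "machine \<Rightarrow> (nat \<Rightarrow> nat) \<Rightarrow> (nat \<Rightarrow> nat) \<Rightarrow> bool" where
  "tracks st m lam \<longleftrightarrow> blocks ys k st m \<and> inj_on lam {..<cnt st} \<and>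
     (\<forall>i<cnt st. lam i < k \<and> bs st i \<in> S (lam i) \<and> df st i = (if known st (lam i) then d (lam i) else 0)) \<and>
     (\<forall>i<cnt st. df st i \<noteq> 0 \<longrightarrow> (\<forall>y\<in>S (lam i) - seen ys st. \<forall>z\<in>seen ys st. z < nx st i))"

lemma tracksD:
  assumes "tracks st m lam"
  shows "blocks ys k st m" "inj_on lam {..<cnt st}"
    "\<And>i. i < cnt st \<Longrightarrow> lam i < k"
    "\<And>i. i < cnt st \<Longrightarrow> bs st i \<in> S (lam i)"
    "\<And>i. i < cnt st \<Longrightarrow> df st i = (if known st (lam i) then d (lam i) else 0)"
    "\<And>i y z. i < cnt st \<Longrightarrow> df st i \<noteq> 0 \<Longrightarrow> y \<in> S (lam i) \<Longrightarrow> y \<notin> seen ys st \<Longrightarrow> z \<in> seen ys st \<Longrightarrow> z < nx st i"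
    "\<And>i. i < cnt st \<Longrightarrow> bs st i \<in> seen ys st"
    "\<And>i. i < cnt st \<Longrightarrow> nx st i = bs st i + int (Suc (m i)) * df st i"
    "\<And>i t. i < cnt st \<Longrightarrow> t \<le> m i \<Longrightarrow> bs st i + int t * df st i \<in> seen ys st"
    "\<And>z. z \<in> seen ys st \<Longrightarrow> \<exists>i<cnt st. z \<in> ap (bs st i) (df st i) (m i)"
proof -
  show B: "blocks ys k st m" and "inj_on lam {..<cnt st}"
    "\<And>i. i < cnt st \<Longrightarrow> lam i < k"
    "\<And>i. i < cnt st \<Longrightarrow> bs st i \<in> S (lam i)"
    "\<And>i. i < cnt st \<Longrightarrow> df st i = (if known st (lam i) then d (lam i) else 0)"
    "\<And>i y z. i < cnt st \<Longrightarrow> df st i \<noteq> 0 \<Longrightarrow> y \<in> S (lam i) \<Longrightarrow> y \<notin> seen ys st \<Longrightarrow> z \<in> seen ys st \<Longrightarrow> z < nx st i"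
    using assms unfolding tracks_def by blast+
  have U: "(\<Union>i<cnt st. ap (bs st i) (df st i) (m i)) = seen ys st"
    using B by (simp add: blocks_def)
  show *: "bs st i + int t * df st i \<in> seen ys st" if "i < cnt st" "t \<le> m i" for i t
    using that by (auto simp: mem_ap U[symmetric])
  show "bs st i \<in> seen ys st" if "i < cnt st" for i
    using *[OF that, of 0] by simp
  show "nx st i = bs st i + int (Suc (m i)) * df st i" if "i < cnt st" for i
    using B that by (simp add: blocks_def)
  show "\<exists>i<cnt st. z \<in> ap (bs st i) (df st i) (m i)" if "z \<in> seen ys st" for z
    using that U by auto
qed

lemma df_nonneg: "tracks st m lam \<Longrightarrow> i < cnt st \<Longrightarrow> df st i \<noteq> 0 \<Longrightarrow> df st i = d (lam i) \<and> 0 < df st i"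
  using tracksD(5)[of st m lam i] d_pos tracksD(3)[of st m lam i] by (auto split: if_splits)

text \<open>\<open>nx st i\<close> is congruent to the elements of \<open>S (lam i)\<close> and lies
  beyond one of them. If it is missing, the progression has ended before it.\<close>

lemma nx_not_in_S:
  assumes "tracks st m lam" "i < cnt st" "df st i \<noteq> 0" "nx st i \<notin> S (lam i)" "y \<in> S (lam i)"
  shows "y < nx st i"
  using S_between[OF tracksD(3,4)[OF assms(1,2)] assms(5), of "nx st i" "Suc (m i)"] assms(4)
    tracksD(8)[OF assms(1,2)] df_nonneg[OF assms(1-3)] by fastforce

text \<open>No block is passed over while its progression still has elements to come. If
  \<open>nx st i\<close> were at most the current element, it would lie outside
  \<open>S (lam i)\<close>; then \<open>y\<close> would precede \<open>nx st i\<close>, although no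
  unseen element precedes the current one.\<close>

lemma stopped:
  assumes "tracks st m lam" "pos st < length ys" "i < cnt st" "df st i \<noteq> 0"
    and "nx st i = ys ! pos st \<Longrightarrow> ys ! pos st \<notin> S (lam i)"
    and "y \<in> S (lam i)" "y \<notin> seen ys st" "y \<noteq> ys ! pos st"
  shows "ys ! pos st < nx st i" "\<And>z. z \<in> seen ys st \<Longrightarrow> z < nx st i"
proof -
  show lt: "z < nx st i" if "z \<in> seen ys st" for z
    using tracksD(6)[OF assms(1,3,4,6,7)] that by simp
  show "ys ! pos st < nx st i"
  proof (rule ccontr)
    assume le: "\<not> ?thesis"
    have "nx st i \<notin> S (lam i)"
    proof
      assume nx: "nx st i \<in> S (lam i)"
      then have "nx st i \<in> set ys" "nx st i \<notin> seen ys st"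
        using S_subset[OF tracksD(3)[OF assms(1,3)]] lt by blast+
      then show False
        using not_seen_le[OF sorted assms(2)] le nx assms(5) by (metis linorder_not_less order_antisym)
    qed
    then have "y < nx st i"
      using nx_not_in_S assms by blast
    moreover have "ys ! pos st \<le> y"
      using not_seen_le[OF sorted assms(2) S_subset[OF tracksD(3)[OF assms(1,3)] assms(6)] assms(7)] .
    ultimately show False
      using le by simp
  qed
qed

text \<open>A block of known difference is never out of phase with its progression. The current
  element is unseen, hence not before \<open>nx st i\<close>; by convexity \<open>nx st i\<close> is
  then in \<open>S (lam i)\<close>. It is unseen as well, hence not before the current
  element.\<close>

lemma hit_next:
  assumes "tracks st m lam" "pos st < length ys" "i < cnt st" "df st i \<noteq> 0" "ys ! pos st \<in> S (lam i)"
  shows "nx st i = ys ! pos st"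
proof -
  let ?x = "ys ! pos st"
  note df = df_nonneg[OF assms(1,3,4)]
  have fresh: "?x \<notin> seen ys st"
    using seen_less[OF sorted assms(2)] by blast
  have lt: "z < nx st i" if "z \<in> seen ys st" for z
    using tracksD(6)[OF assms(1,3,4,5) fresh] that by simp
  have "bs st i < ?x"
    using seen_less[OF sorted assms(2) tracksD(7)[OF assms(1,3)]] .
  then obtain t where t: "?x = bs st i + int t * d (lam i)"
    using S_distance[OF tracksD(3,4)[OF assms(1,3)] assms(5)] by auto
  have "\<not> t \<le> m i"
    using tracksD(9)[OF assms(1,3), of t] t df fresh by auto
  then have "int (Suc (m i)) * df st i \<le> int t * df st i"
    using df by (intro mult_right_mono) auto
  then have le: "nx st i \<le> ?x"
    using tracksD(8)[OF assms(1,3)] t df by simp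
  then have "nx st i \<in> S (lam i)"
    using S_between[OF tracksD(3,4)[OF assms(1,3)] assms(5), of _ "Suc (m i)"] tracksD(8)[OF assms(1,3)] df by auto
  then have "?x \<le> nx st i"
    using not_seen_le[OF sorted assms(2) S_subset[OF tracksD(3)[OF assms(1,3)]]] lt by blast
  then show ?thesis
    using le by simp
qed

lemma tracks_advance:
  assumes "tracks st m lam" "pos st < length ys" "i < cnt st" "nx st i = ys ! pos st" "df st i \<noteq> 0"
    and "\<And>i'. i' < cnt st \<Longrightarrow> i' \<noteq> i \<Longrightarrow> nx st i' = ys ! pos st \<Longrightarrow> ys ! pos st \<notin> S (lam i')"
  shows "tracks (advance i st) (m(i := Suc (m i))) lam"
proof -
  let ?st = "advance i st"
  have same: "cnt ?st = cnt st" "bs ?st = bs st" "df ?st = df st" "known ?st = known st"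
    by (simp_all add: advance_def known_def fun_eq_iff)
  have seen: "seen ys ?st = insert (ys ! pos st) (seen ys st)"
    by (rule seen_Suc[OF assms(2)]) (simp add: advance_def)
  have "z < nx ?st i'" if i': "i' < cnt st" "df st i' \<noteq> 0" and y: "y \<in> S (lam i')" "y \<notin> seen ys ?st"
    and z: "z \<in> seen ys ?st" for i' y z
  proof (cases "i' = i")
    case True
    have "z \<le> ys ! pos st"
      using z seen seen_less[OF sorted assms(2)] by fastforce
    then show ?thesis
      using True assms(4) df_nonneg[OF assms(1) i'] by (simp add: advance_def)
  next
    case False
    then show ?thesis
      using stopped[OF assms(1,2) i' assms(6)[OF i'(1) False] y(1)] y(2) z seen by (auto simp: advance_def)
  qed
  then show ?thesis
    using blocks_advance[OF sorted tracksD(1)[OF assms(1)] assms(2-4)] assms(1)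
    unfolding tracks_def same by blast
qed

lemma tracks_open_block:
  assumes "tracks st m lam" "pos st < length ys" "cnt st < k" "j < k" "ys ! pos st \<in> S j"
    "j \<notin> lam ` {..<cnt st}" "tab st w = (if known st j then d j else 0)"
  shows "tracks (open_block ys w st) (m(cnt st := 0)) (lam(cnt st := j))"
proof -
  let ?st = "open_block ys w st" and ?lam = "lam(cnt st := j)"
  let ?x = "ys ! pos st"
  have same: "cnt ?st = Suc (cnt st)" "known ?st = known st"
    by (simp_all add: open_block_def known_def fun_eq_iff)
  have old: "bs ?st i = bs st i" "df ?st i = df st i" "nx ?st i = nx st i" "?lam i = lam i" if "i < cnt st" for i
    using that by (simp_all add: open_block_def)
  have new: "bs ?st (cnt st) = ?x" "df ?st (cnt st) = tab st w" "nx ?st (cnt st) = ?x + tab st w"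
    by (simp_all add: open_block_def)
  have seen: "seen ys ?st = insert ?x (seen ys st)"
    by (rule seen_Suc[OF assms(2)]) (simp add: open_block_def)
  have inj: "inj_on ?lam {..<Suc (cnt st)}"
    using tracksD(2)[OF assms(1)] assms(6) by (auto simp: inj_on_def less_Suc_eq)
  have "z < nx ?st i" if i: "i < Suc (cnt st)" "df ?st i \<noteq> 0" and y: "y \<in> S (?lam i)" "y \<notin> seen ys ?st"
    and z: "z \<in> seen ys ?st" for i y z
  proof (cases "i = cnt st")
    case True
    have "z \<le> ?x"
      using z seen seen_less[OF sorted assms(2)] by fastforce
    moreover have "tab st w > 0"
      using i(2) True new d_pos[OF assms(4)] assms(7) by (auto split: if_splits)
    ultimately show ?thesis
      using True new by simp
  next
    case False
    then have i': "i < cnt st"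
      using i(1) by simp
    have "?x \<notin> S (lam i)"
      using S_unique[OF tracksD(3)[OF assms(1) i'] assms(4) _ assms(5)] assms(6) i' by blast
    then show ?thesis
      using stopped[OF assms(1,2) i', of y] y z i(2) seen old[OF i'] by auto
  qed
  moreover have "?lam i < k \<and> bs ?st i \<in> S (?lam i) \<and> df ?st i = (if known st (?lam i) then d (?lam i) else 0)"
    if "i < Suc (cnt st)" for i
  proof (cases "i = cnt st")
    case True
    then show ?thesis
      using new assms(4,5,7) by simp
  next
    case False
    then have "i < cnt st"
      using that by simp
    then show ?thesis
      using old tracksD(3-5)[OF assms(1)] by simp
  qed
  ultimately show ?thesis
    using blocks_open_block[OF sorted tracksD(1)[OF assms(1)] assms(2,3), of w] inj
    unfolding tracks_def same by blast
qed

section \<open>Bounding the number of decisions\<close>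

definition "unknown st = {j. j < k \<and> \<not> known st j}"

text \<open>The blocks that may still be extended. Once \<open>nx st i\<close> has been passed, the
  block stays as it is until a restart discards it.\<close>

definition "alive st = {i. i < cnt st \<and> df st i \<noteq> 0 \<and> (\<forall>z\<in>seen ys st. z < nx st i)}"

text \<open>An unopened block weighs 2, which pays for opening it and for stopping it later. After a
  restart the last two summands amount to \<open>2 * k\<close>, and the weight
  \<open>2 * k + 1\<close> of the difference just learnt pays for that.\<close>

definition "potential st = card (unknown st) * (2 * k + 1) + 2 * (k - cnt st) + card (alive st)"

lemma finite_unknown [simp]: "finite (unknown st)"
  by (simp add: unknown_def)

lemma finite_alive [simp]: "finite (alive st)"
  by (simp add: alive_def)

lemma expecting_alive:
  assumes "tracks st m lam" "pos st < length ys"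
  shows "expecting ys st \<subseteq> alive st"
proof
  fix i assume "i \<in> expecting ys st"
  then have i: "i < cnt st" "nx st i = ys ! pos st"
    by (simp_all add: expecting_def)
  have "bs st i \<noteq> nx st i"
    using seen_less[OF sorted assms(2) tracksD(7)[OF assms(1) i(1)]] i(2) by simp
  then have "df st i \<noteq> 0"
    using tracksD(8)[OF assms(1) i(1)] by auto
  then show "i \<in> alive st"
    using i seen_less[OF sorted assms(2)] by (simp add: alive_def)
qed

lemma alive_advance:
  assumes "tracks st m lam" "pos st < length ys" "i \<in> expecting ys st"
  shows "alive (advance i st) \<subseteq> alive st - (expecting ys st - {i})"
proof -
  have seen: "seen ys (advance i st) = insert (ys ! pos st) (seen ys st)"
    by (rule seen_Suc[OF assms(2)]) (simp add: advance_def)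
  have "i \<in> alive st"
    using expecting_alive assms by blast
  then show ?thesis
    unfolding alive_def seen by (auto simp: advance_def expecting_def split: if_splits)
qed

lemma alive_open_block:
  assumes "pos st < length ys"
  shows "alive (open_block ys w st) \<subseteq> insert (cnt st) (alive st)"
proof -
  have seen: "seen ys (open_block ys w st) = insert (ys ! pos st) (seen ys st)"
    by (rule seen_Suc[OF assms]) (simp add: open_block_def)
  show ?thesis
    unfolding alive_def seen by (auto simp: open_block_def less_Suc_eq)
qed

text \<open>
  If a singleton block is hit a second time by its progression \<open>S j\<close>, then \<open>d j\<close> can be learnt. When
  many elements of \<open>S j\<close> lie in between, some block \<open>i'\<close> contains many of them, and between two
  consecutive ones nothing of the solution starts or ends. The covering theorem bounds the length
  of this gap, as otherwise its left end would also be covered by a progression other than \<open>S j\<close>.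
\<close>

lemma learnable:
  assumes "tracks st m lam" "pos st < length ys" "i < cnt st" "df st i = 0" "ys ! pos st \<in> S (lam i)"
  obtains w q r where "w \<le> dn st" "0 < q" "q \<le> k * (2 * k + 2) + 1" "r \<le> 2 ^ k"
    "int q * d (lam i) = int r * ((tab st)(dn st := ys ! pos st - bs st i)) w"
proof -
  define x j b where "x = ys ! pos st" and "j = lam i" and "b = bs st i"
  define Q where "Q = k * (2 * k + 2)"
  define y where "y u = b + int u * d j" for u
  note T = tracksD[OF assms(1)]
  have j: "j < k" "b \<in> S j" "x \<in> S j" "d j > 0" "b < x"
    using T(3,4,7) assms(2,3,5) d_pos seen_less[OF sorted] by (auto simp: j_def b_def x_def)
  obtain t where t: "x = b + int t * d j"
    using S_distance[OF j(1,2,3)] j(5) by auto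
  have "t > 0"
    using t j(5) by (cases t) auto
  show thesis
  proof (cases "t \<le> Q + 1")
    \<comment> \<open>The singleton is only \<open>t\<close> differences away: the distance itself,
      entered at \<open>dn st\<close>, is used with \<open>q = t\<close> and
      \<open>r = 1\<close>.\<close>
    case True
    then show thesis
      using that[of "dn st" t 1] \<open>t > 0\<close> t by (simp add: Q_def x_def b_def j_def)
  next
    case False
    have "strict_mono y"
      using j(4) by (auto simp: strict_mono_def y_def)
    \<comment> \<open>As \<open>t > Q + 1\<close>, these elements of \<open>S j\<close> precede the
      current one and have all been given to blocks.\<close>
    have yS: "y u \<in> S j" "y u \<in> seen ys st" if "u \<le> Q" for u
    proof -
      have "int u * d j < int t * d j"
        using that False j(4) by (intro mult_strict_right_mono) auto
      then have lt: "y u < x"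
        by (simp add: y_def t)
      show "y u \<in> S j"
        using S_between[OF j(1,2,3) y_def] lt by simp
      then show "y u \<in> seen ys st"
        using not_seen_le[OF sorted assms(2) S_subset[OF j(1)]] lt by (force simp: x_def)
    qed
    define U where "U i' = {u \<in> {1..Q}. y u \<in> ap (bs st i') (df st i') (m i')}" for i'
    have "k > 0"
      using j(1) by simp
    \<comment> \<open>\<open>Q\<close> elements fall into at most \<open>k\<close> blocks. The
      \<open>2 * k + 2\<close> hits in one block leave \<open>2 * k + 1\<close> gaps, one more than
      there are ends in \<open>Z\<close>.\<close>
    have "\<exists>i'<cnt st. card (U i') > 2 * k + 1"
    proof (rule ccontr)
      assume "\<not> ?thesis"
      then have "(\<Sum>i'<cnt st. card (U i')) \<le> (\<Sum>i'<cnt st. 2 * k + 1)"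
        by (intro sum_mono) (meson lessThan_iff not_less)
      also have "\<dots> = cnt st * (2 * k + 1)"
        by simp
      also have "\<dots> \<le> k * (2 * k + 1)"
        using T(1) by (intro mult_right_mono) (simp_all add: blocks_def)
      also have "\<dots> < Q"
        using \<open>k > 0\<close> by (simp add: Q_def)
      finally have "(\<Sum>i'<cnt st. card (U i')) < Q" .
      moreover have "(\<Union>i'<cnt st. U i') = {1..Q}"
        using T(10) yS(2) by (fastforce simp: U_def)
      ultimately show False
        using card_UN_le[of "{..<cnt st}" U] by simp
    qed
    then obtain i' where i': "i' < cnt st" "card (U i') > 2 * k + 1"
      by blast
    define e where "e p = a p + int (l p) * d p" for p
    define Z where "Z = a ` {..<k} \<union> e ` {..<k}"
    have "card Z \<le> k + k"
      unfolding Z_def by (metis card_Un_le add_mono card_image_le card_lessThan finite_lessThan le_trans)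
    then have "card Z + 1 < card (U i')"
      using i'(2) by simp
    moreover have "finite (U i')" "finite Z"
      by (simp_all add: U_def Z_def)
    ultimately obtain u u' where u: "u \<in> U i'" "u' \<in> U i'" "u < u'" "\<And>v. v \<in> U i' \<Longrightarrow> \<not> (u < v \<and> v < u')"
      "\<And>z. z \<in> Z \<Longrightarrow> \<not> (y u < z \<and> z < y u')"
      using consecutive_gap[OF _ _ _ \<open>strict_mono y\<close>] by metis
    have u_le: "1 \<le> u" "u' \<le> Q"
      using u(1,2) by (auto simp: U_def)
    have lt: "y u < y u'"
      using u(3) \<open>strict_mono y\<close> by (simp add: strict_mono_less)
    define D where "D = df st i'"
    obtain s s' where s: "y u = bs st i' + int s * D" "y u' = bs st i' + int s' * D" "s' \<le> m i'"
      using u(1,2) by (auto simp: U_def mem_ap D_def)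
    have "D \<noteq> 0"
      using s lt by auto
    then have D: "D = d (lam i')" "D > 0" "known st (lam i')"
      using df_nonneg[OF assms(1) i'(1)] T(5)[OF i'(1)] by (auto simp: D_def split: if_splits)
    have "s < s'"
      using s(1,2) lt D(2) by (simp add: mult_less_cancel_right)
    define r where "r = s' - s"
    have r: "y u' = y u + int r * D"
      using s \<open>s < s'\<close> by (simp add: r_def of_nat_diff algebra_simps)
    have "r \<le> 2 ^ k"
    proof (rule ccontr)
      assume "\<not> r \<le> 2 ^ k"
      \<comment> \<open>These are the progressions other than \<open>S j\<close> that span the gap.
        The block has \<open>r - 1\<close>, hence at least \<open>2 ^ k\<close>, points strictly
        inside the gap. None is in \<open>S j\<close>, since \<open>u\<close> and \<open>u'\<close>
        are consecutive hits, and no progression starts or ends there, so all these points are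
        covered by \<open>P\<close>. The covering theorem then puts \<open>y u\<close> into a
        progression of \<open>P\<close>, although it belongs to \<open>S j\<close>.\<close>
      define P where "P = {p. p < k \<and> p \<noteq> j \<and> a p \<le> y u \<and> y u' \<le> e p}"
      have "card P \<le> card {..<k}"
        by (intro card_mono) (auto simp: P_def)
      then have P: "finite P" "card P \<le> k"
        by (simp_all add: P_def)
      have "\<exists>p\<in>P. d p dvd y u - a p"
      proof (rule covering_extends[OF P(1)])
        show "d p > 0" if "p \<in> P" for p
          using that d_pos by (simp add: P_def)
        fix t :: nat assume t: "1 \<le> t" "t \<le> 2 ^ card P"
        have "(2::nat) ^ card P \<le> 2 ^ k"
          using P(2) by (intro power_increasing) auto
        then have "t < r"
          using t(2) \<open>\<not> r \<le> 2 ^ k\<close> by linarith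
        let ?z = "y u + int t * D"
        have gap: "y u < ?z" "?z < y u'"
          using t(1) \<open>t < r\<close> D(2) by (simp_all add: r)
        have z: "?z = bs st i' + int (s + t) * D" "s + t \<le> m i'"
          using s \<open>t < r\<close> by (simp_all add: r_def algebra_simps)
        then have "?z \<in> seen ys st"
          using T(9)[OF i'(1) z(2)] by (simp add: D_def)
        then have "?z \<in> set ys"
          unfolding seen_def by (rule in_set_takeD)
        then obtain p where p: "p < k" "?z \<in> S p"
          using S_ex by blast
        have "p \<noteq> j"
        proof
          assume "p = j"
          moreover have "b \<le> ?z"
            using gap(1) j(4) by (simp add: y_def)
          ultimately obtain v where v: "?z = y v"
            using S_distance[OF j(1,2)] p(2) by (metis y_def)
          then have "u < v" "v < u'"
            using gap \<open>strict_mono y\<close> by (simp_all add: strict_mono_less)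
          moreover have "?z \<in> ap (bs st i') (df st i') (m i')"
            using z by (auto simp: mem_ap D_def)
          then have "v \<in> U i'"
            using v \<open>u < v\<close> \<open>v < u'\<close> u_le by (simp add: U_def)
          ultimately show False
            using u(4) by blast
        qed
        moreover have "a p \<le> ?z" "?z \<le> e p" "d p dvd ?z - a p"
          using p by (simp_all add: mem_S_iff e_def)
        moreover have "a p \<in> Z" "e p \<in> Z"
          using p(1) by (auto simp: Z_def)
        ultimately have "p \<in> P"
          using u(5)[of "a p"] u(5)[of "e p"] gap p(1) by (auto simp: P_def)
        moreover have "d p dvd y u - a p + int t * D"
          using \<open>d p dvd ?z - a p\<close> by (simp add: algebra_simps)
        ultimately show "\<exists>p\<in>P. d p dvd y u - a p + int t * D"
          by blast
      qed
      then obtain p where p: "p < k" "p \<noteq> j" "a p \<le> y u" "y u' \<le> e p" "d p dvd y u - a p"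
        by (auto simp: P_def)
      then have "y u \<in> S p"
        using lt by (simp add: mem_S_iff e_def)
      moreover have "y u \<in> S j"
        using yS(1)[of u] u(3) u_le by simp
      ultimately show False
        using S_unique p(1,2) j(1) by blast
    qed
    obtain w where w: "w < dn st" "tab st w = D"
      using D(1,3) by (auto simp: known_def)
    \<comment> \<open>The gap is measured twice: \<open>u' - u\<close> times the wanted difference
      is \<open>r\<close> times the known difference \<open>D\<close>.\<close>
    have "int (u' - u) * d j = y u' - y u"
      using u(3) by (simp add: y_def of_nat_diff algebra_simps)
    then show thesis
      using that[of w "u' - u" r] w u(3) u_le r \<open>r \<le> 2 ^ k\<close> by (simp add: Q_def j_def)
  qed
qed

text \<open>Learning adds two table entries and makes at least one more progression known. So the
  last conjunct is preserved; it caps \<open>dn st\<close>, and with it the table indices in the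
  advice, at \<open>2 * k + 1\<close>.\<close>

definition following :: "machine \<Rightarrow> bool" where
  "following st \<longleftrightarrow> (\<exists>m lam. tracks st m lam) \<and> tab st 0 = 0 \<and> 1 \<le> dn st \<and>
     dn st + 2 * card (unknown st) \<le> 2 * k + 1"

text \<open>Used for both kinds of extension: in a forced step \<open>expecting ys st - {i}\<close>
  is empty, in a decision it consists of the rivals that are stopped, and the potential pays for
  them.\<close>

lemma following_advance:
  assumes "following st" and T: "tracks st m lam" and "pos st < length ys" "i \<in> expecting ys st"
    and "\<And>i'. i' \<in> expecting ys st \<Longrightarrow> i' \<noteq> i \<Longrightarrow> ys ! pos st \<notin> S (lam i')"
  shows "following (advance i st)" "potential (advance i st) + card (expecting ys st - {i}) \<le> potential st"
proof -
  have i: "i < cnt st" "nx st i = ys ! pos st" "df st i \<noteq> 0"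
    using assms(4) expecting_alive[OF T assms(3)] by (auto simp: expecting_def alive_def)
  have same: "cnt (advance i st) = cnt st" "dn (advance i st) = dn st" "tab (advance i st) = tab st"
    "unknown (advance i st) = unknown st"
    by (simp_all add: advance_def unknown_def known_def)
  have "tracks (advance i st) (m(i := Suc (m i))) lam"
    by (rule tracks_advance[OF T assms(3) i]) (use assms(5) in \<open>auto simp: expecting_def\<close>)
  then show "following (advance i st)"
    using assms(1) unfolding following_def same by blast
  have "card (alive (advance i st)) \<le> card (alive st - (expecting ys st - {i}))"
    using alive_advance[OF T assms(3,4)] by (intro card_mono) auto
  also have "\<dots> = card (alive st) - card (expecting ys st - {i})"
    using expecting_alive[OF T assms(3)] by (intro card_Diff_subset) (auto intro: finite_subset)
  finally have "card (alive (advance i st)) + card (expecting ys st - {i}) \<le> card (alive st)"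
    using card_mono[of "alive st" "expecting ys st - {i}"] expecting_alive[OF T assms(3)] by force
  then show "potential (advance i st) + card (expecting ys st - {i}) \<le> potential st"
    by (simp add: potential_def same)
qed

lemma following_open_block:
  assumes "following st" "tracks st m lam" "pos st < length ys" "j < k" "ys ! pos st \<in> S j" "j \<notin> lam ` {..<cnt st}"
  shows "cnt st < k" "\<exists>w<dn st. following (open_block ys w st) \<and> potential (open_block ys w st) < potential st"
proof -
  have "card (insert j (lam ` {..<cnt st})) \<le> card {..<k}"
    using assms(4) tracksD(3)[OF assms(2)] by (intro card_mono) auto
  then show c: "cnt st < k"
    using assms(6) tracksD(2)[OF assms(2)] by (simp add: card_image)
  have tab: "tab st 0 = 0" "1 \<le> dn st"
    using assms(1) by (simp_all add: following_def)
  then obtain w where w: "w < dn st" "tab st w = (if known st j then d j else 0)"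
    by (cases "known st j") (force simp: known_def)+
  have same: "cnt (open_block ys w st) = Suc (cnt st)" "dn (open_block ys w st) = dn st"
    "tab (open_block ys w st) = tab st" "unknown (open_block ys w st) = unknown st"
    by (simp_all add: open_block_def unknown_def known_def)
  have "card (alive (open_block ys w st)) \<le> card (insert (cnt st) (alive st))"
    using alive_open_block[OF assms(3)] by (intro card_mono) auto
  also have "\<dots> \<le> Suc (card (alive st))"
    by (rule card_insert_le_m1) auto
  finally have "potential (open_block ys w st) < potential st"
    using c by (simp add: potential_def same)
  moreover have "following (open_block ys w st)"
    using tracks_open_block[OF assms(2,3) c assms(4-6) w(2)] assms(1) unfolding following_def same by blast
  ultimately show "\<exists>w<dn st. following (open_block ys w st) \<and> potential (open_block ys w st) < potential st"
    using w(1) by blast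
qed

text \<open>Two distinct elements of \<open>S j\<close> guarantee that \<open>a j\<close> and
  \<open>a j + d j\<close> both occur in the input, so the search over pairs succeeds.\<close>

lemma quot_eq:
  assumes "j < k" "y \<in> S j" "y' \<in> S j" "y \<noteq> y'" "0 < q" "int q * d j = z"
  shows "quot ys q z = d j"
proof -
  have "l j \<noteq> 0"
    using assms(2-4) by (metis S_def ap_0 singletonD)
  then have "a j \<in> S j" "a j + d j \<in> S j"
    using d_pos[OF assms(1)] mult_right_mono[of 1 "int (l j)" "d j"] by (simp_all add: mem_S_iff[OF assms(1)])
  then have "a j \<in> set ys" "a j + d j \<in> set ys"
    using S_subset assms(1) by blast+
  moreover have "int q * ((a j + d j) - a j) = z"
    using assms(6) by simp
  ultimately have "\<exists>y\<in>set ys. \<exists>y'\<in>set ys. int q * (y - y') = z"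
    by blast
  moreover have "z div int q = d j"
    using assms(5) by (simp flip: assms(6))
  ultimately show ?thesis
    using assms(5) by (simp add: quot_def)
qed

lemma following_learn:
  assumes "following st" "tracks st m lam" "pos st < length ys" "i < cnt st" "df st i = 0" "ys ! pos st \<in> S (lam i)"
  shows "\<exists>w q r. w \<le> dn st \<and> q \<le> k * (2 * k + 2) + 1 \<and> r \<le> 2 ^ k \<and>
    following (learn ys i w q r st) \<and> potential (learn ys i w q r st) < potential st"
proof -
  obtain w q r where wqr: "w \<le> dn st" "0 < q" "q \<le> k * (2 * k + 2) + 1" "r \<le> 2 ^ k"
    "int q * d (lam i) = int r * ((tab st)(dn st := ys ! pos st - bs st i)) w"
    using learnable[OF assms(2-6)] by metis
  let ?st = "learn ys i w q r st"
  note T = tracksD(3-5,7)[OF assms(2) assms(4)]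
  have fol: "tab st 0 = 0" "1 \<le> dn st" "dn st + 2 * card (unknown st) \<le> 2 * k + 1"
    using assms(1) by (simp_all add: following_def)
  have "bs st i \<noteq> ys ! pos st"
    using seen_less[OF sorted assms(3) T(4)] by simp
  then have "quot ys q (int r * ((tab st)(dn st := ys ! pos st - bs st i)) w) = d (lam i)"
    using quot_eq[OF T(1,2) assms(6) _ wqr(2,5)] by simp
  then have tab: "tab ?st = (tab st)(dn st := ys ! pos st - bs st i, Suc (dn st) := d (lam i))"
    and rest: "dn ?st = dn st + 2" "pos ?st = 0" "cnt ?st = 0"
    by (simp_all add: learn_def Let_def)
  have "known ?st j" if "known st j" for j
    using that unfolding known_def tab rest by (force simp: image_iff)
  moreover have "known ?st (lam i)"
    unfolding known_def tab rest by (intro image_eqI[of _ _ "Suc (dn st)"]) auto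
  ultimately have "unknown ?st \<subseteq> unknown st - {lam i}"
    by (auto simp: unknown_def)
  moreover have "lam i \<in> unknown st"
    using T(1,3) assms(5) d_pos[OF T(1)] by (auto simp: unknown_def split: if_splits)
  ultimately have less: "card (unknown ?st) < card (unknown st)"
    by (intro psubset_card_mono) auto
  \<comment> \<open>After the restart there are no blocks, so any \<open>m\<close> and
    \<open>lam\<close> will do.\<close>
  have "tracks ?st m lam"
    using blocks_initial[OF rest(2,3)] rest by (simp add: tracks_def)
  moreover have "tab ?st 0 = 0"
    using fol by (simp add: tab)
  ultimately have "following ?st"
    using fol less rest by (auto simp: following_def)
  moreover have "potential ?st < potential st"
  proof -
    have "Suc (card (unknown ?st)) * (2 * k + 1) \<le> card (unknown st) * (2 * k + 1)"
      using less by (intro mult_right_mono) auto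
    then show ?thesis
      using rest by (simp add: potential_def alive_def)
  qed
  ultimately show ?thesis
    using wqr by blast
qed

text \<open>Let \<open>S j\<close> contain the current element. If it has a block of known
  difference, that block expects the element, and a rival is stopped; if its block is a singleton,
  \<open>d j\<close> is learnt; if it has none, one is opened. The last conjuncts ensure that no
  stale entry is read, as \<open>similar_act\<close> requires.\<close>

lemma following_act:
  assumes "following st" "pos st < length ys" "card (expecting ys st) \<noteq> 1"
    and B: "2 * k + 1 < B" "k * (2 * k + 2) + 1 < B" "2 ^ k < B"
  shows "\<exists>h w q r. h < B \<and> w < B \<and> q < B \<and> r < B \<and>
    following (act ys k h w q r st) \<and> potential (act ys k h w q r st) < potential st \<and>
    ptr (act ys k h w q r st) = ptr st \<and> w \<le> dn st \<and> (h < cnt st \<or> cnt st < k \<and> w < dn st)"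
proof -
  let ?x = "ys ! pos st"
  obtain m lam where T: "tracks st m lam"
    using assms(1) by (auto simp: following_def)
  have c: "cnt st \<le> k" "dn st \<le> 2 * k + 1"
    using tracksD(1)[OF T] assms(1) by (simp_all add: blocks_def following_def)
  obtain j where j: "j < k" "?x \<in> S j"
    using S_ex[of ?x] assms(2) by auto
  consider i where "i < cnt st" "lam i = j" "df st i \<noteq> 0" | i where "i < cnt st" "lam i = j" "df st i = 0"
    | "j \<notin> lam ` {..<cnt st}"
    by blast
  then show ?thesis
  proof cases
    case (1 i)
    then have nx: "nx st i = ?x"
      using hit_next[OF T assms(2)] j(2) by simp
    then have i: "i \<in> expecting ys st"
      using 1 by (simp add: expecting_def)
    have "?x \<notin> S (lam i')" if i': "i' \<in> expecting ys st" "i' \<noteq> i" for i'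
    proof -
      have "i' < cnt st"
        using i'(1) by (simp add: expecting_def)
      moreover from this have "lam i' \<noteq> j"
        using tracksD(2)[OF T] 1(1,2) i'(2) by (auto simp: inj_on_def)
      ultimately show ?thesis
        using S_unique[OF tracksD(3)[OF T] j(1) _ j(2)] by blast
    qed
    note adv = following_advance[OF assms(1) T assms(2) i this]
    have "finite (expecting ys st)"
      by (simp add: expecting_def)
    then have "card (expecting ys st - {i}) \<noteq> 0"
      using i assms(3) by (simp add: card_Diff_singleton)
         (metis One_nat_def card_0_eq empty_iff le_antisym not_less_eq_eq le_0_eq)
    then have "potential (advance i st) < potential st"
      using adv(2) by simp
    moreover have "act ys k i 0 0 0 st = advance i st" "ptr (advance i st) = ptr st"
      using 1(1) nx by (simp_all add: act_def advance_def)
    ultimately show ?thesis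
      using adv(1) B 1(1) c by (intro exI[of _ i] exI[of _ 0]) simp
  next
    case (2 i)
    have "\<not> nx st i = ?x"
      using seen_less[OF sorted assms(2) tracksD(7)[OF T 2(1)]] tracksD(8)[OF T 2(1)] 2(3) by simp
    then have "act ys k i w q r st = learn ys i w q r st" for w q r
      using 2(1) by (simp add: act_def)
    moreover have "ptr (learn ys i w q r st) = ptr st" for w q r
      by (simp add: learn_def Let_def)
    moreover obtain w q r where "w \<le> dn st" "q \<le> k * (2 * k + 2) + 1" "r \<le> 2 ^ k"
      "following (learn ys i w q r st)" "potential (learn ys i w q r st) < potential st"
      using following_learn[OF assms(1) T assms(2) 2(1,3)] j(2) 2(2) by blast
    ultimately show ?thesis
      using B 2(1) c by (intro exI[of _ i] exI[of _ w] exI[of _ q] exI[of _ r]) simp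
  next
    case 3
    note o = following_open_block[OF assms(1) T assms(2) j 3]
    have "act ys k (cnt st) w 0 0 st = open_block ys w st" for w
      using o(1) by (simp add: act_def)
    moreover have "ptr (open_block ys w st) = ptr st" for w
      by (simp add: open_block_def)
    moreover obtain w where "w < dn st" "following (open_block ys w st)"
      "potential (open_block ys w st) < potential st"
      using o(2) by blast
    ultimately show ?thesis
      using B c o(1) by (intro exI[of _ "cnt st"] exI[of _ w] exI[of _ 0]) simp
  qed
qed

lemma following_step:
  assumes "following st" "pos st < length ys" "card (expecting ys st) = 1"
  shows "following (step ys k G st)" "potential (step ys k G st) \<le> potential st"
    "ptr (step ys k G st) = ptr st" "pos (step ys k G st) = Suc (pos st)"
proof -
  obtain m lam where T: "tracks st m lam"
    using assms(1) by (auto simp: following_def)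
  obtain i where i: "expecting ys st = {i}"
    using assms(3) by (auto simp: card_1_singleton_iff)
  then have step: "step ys k G st = advance i st"
    by (simp add: step_def)
  show "following (step ys k G st)" "potential (step ys k G st) \<le> potential st"
    unfolding step using following_advance[OF assms(1) T assms(2), of i] i by simp_all
  show "ptr (step ys k G st) = ptr st" "pos (step ys k G st) = Suc (pos st)"
    unfolding step by (simp_all add: advance_def)
qed

lemma following_ptr [simp]: "following (st\<lparr>ptr := p\<rparr>) \<longleftrightarrow> following st"
  by (simp add: following_def tracks_def known_def unknown_def seen_def)

lemma potential_ptr [simp]: "potential (st\<lparr>ptr := p\<rparr>) = potential st"
  by (simp add: potential_def alive_def known_def unknown_def seen_def)

text \<open>The advice is built backwards, by induction on a lexicographic measure: decisions lower
  the potential, forced steps raise \<open>pos\<close>. The bound is \<open>Suc L\<close> because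
  forced steps must remain possible after the last decision, when \<open>ptr\<close> may have
  reached \<open>L\<close>.\<close>

lemma wins_if_following:
  assumes "following st" "ptr st + 4 * potential st \<le> L"
    and B: "2 * k + 1 < B" "k * (2 * k + 2) + 1 < B" "2 ^ k < B"
  shows "\<exists>g. (\<forall>i. g i < B) \<and> (\<forall>G. (\<forall>i. ptr st \<le> i \<and> i < L \<longrightarrow> G i = g i) \<longrightarrow>
    (\<forall>st'. similar st st' \<longrightarrow> wins ys k (Suc L) G st'))"
  using assms(1,2)
proof (induction "potential st * (length ys + 1) + (length ys - pos st)" arbitrary: st rule: less_induct)
  case less
  have "B > 0"
    using B(1) by simp
  obtain m lam where T: "tracks st m lam"
    using less.prems(1) by (auto simp: following_def)
  have "pos st \<le> length ys"
    using tracksD(1)[OF T] by (simp add: blocks_def)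
  then consider "pos st = length ys" | "pos st < length ys" "card (expecting ys st) = 1"
    | "pos st < length ys" "card (expecting ys st) \<noteq> 1"
    by linarith
  then show ?case
  proof cases
    case 1
    then show ?thesis
      using wins.finished \<open>B > 0\<close> by (intro exI[of _ "\<lambda>_. 0"]) (simp add: similar_def)
  next
    case 2
    define st' where "st' = step ys k (\<lambda>_. 0) st"
    obtain i where i: "expecting ys st = {i}"
      using 2(2) by (auto simp: card_1_singleton_iff)
    then have "i < cnt st"
      by (auto simp: expecting_def)
    then have step: "similar st' (step ys k G st'')" if "similar st st''" for G st''
      using similar_advance[OF that] similar_expecting[OF that] i by (simp add: step_def st'_def)
    note f = following_step[OF less.prems(1) 2, of "\<lambda>_. 0", folded st'_def]
    have "potential st' * (length ys + 1) \<le> potential st * (length ys + 1)"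
      using f(2) by (intro mult_right_mono) auto
    then have "potential st' * (length ys + 1) + (length ys - pos st')
        < potential st * (length ys + 1) + (length ys - pos st)"
      using f(4) 2(1) by simp
    moreover have "ptr st' + 4 * potential st' \<le> L"
      using f(2,3) less.prems(2) by simp
    ultimately obtain g where g: "\<forall>i. g i < B"
      "\<And>G st''. (\<forall>i. ptr st' \<le> i \<and> i < L \<longrightarrow> G i = g i) \<Longrightarrow> similar st' st'' \<Longrightarrow> wins ys k (Suc L) G st''"
      using less.hyps[of st'] f(1) by blast
    have "wins ys k (Suc L) G st''" if "\<forall>i. ptr st \<le> i \<and> i < L \<longrightarrow> G i = g i" "similar st st''" for G st''
    proof (rule wins.continue)
      show "wins ys k (Suc L) G (step ys k G st'')"
        using g(2)[OF _ step[OF that(2)]] that(1) f(3) by simp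
    qed (use that(2) 2(1) less.prems(2) in \<open>simp_all add: similar_def\<close>)
    then show ?thesis
      using g(1) by blast
  next
    case 3
    obtain h w q r where b: "h < B" "w < B" "q < B" "r < B"
      and "following (act ys k h w q r (st\<lparr>ptr := ptr st + 4\<rparr>))"
        "potential (act ys k h w q r (st\<lparr>ptr := ptr st + 4\<rparr>)) < potential st"
        "ptr (act ys k h w q r (st\<lparr>ptr := ptr st + 4\<rparr>)) = ptr st + 4"
      and safe: "w \<le> dn st" "h < cnt st \<or> cnt st < k \<and> w < dn st"
      using following_act[of "st\<lparr>ptr := ptr st + 4\<rparr>", OF _ _ _ B] less.prems(1) 3
      by (auto simp: expecting_def)
    then obtain st' where st': "st' = act ys k h w q r (st\<lparr>ptr := ptr st + 4\<rparr>)"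
      and f: "following st'" "potential st' < potential st" "ptr st' = ptr st + 4"
      by blast
    have "Suc (potential st') * (length ys + 1) \<le> potential st * (length ys + 1)"
      using f(2) by (intro mult_right_mono) auto
    then have "potential st' * (length ys + 1) + (length ys - pos st')
        < potential st * (length ys + 1) + (length ys - pos st)"
      by simp
    moreover have "ptr st' + 4 * potential st' \<le> L"
      using f(2,3) less.prems(2) by simp
    ultimately obtain g where g: "\<forall>i. g i < B"
      "\<And>G st''. (\<forall>i. ptr st' \<le> i \<and> i < L \<longrightarrow> G i = g i) \<Longrightarrow> similar st' st'' \<Longrightarrow> wins ys k (Suc L) G st''"
      using less.hyps[of st'] f(1) by blast
    define p where "p = ptr st"
    \<comment> \<open>The advice \<open>g\<close> for the rest is consulted only from
      \<open>p + 4\<close> on, so the four entries of this decision can be put in front.\<close>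
    define g' where "g' = g(p := h, p + 1 := w, p + 2 := q, p + 3 := r)"
    have "wins ys k (Suc L) G st''" if G: "\<forall>i. p \<le> i \<and> i < L \<longrightarrow> G i = g' i" and sim: "similar st st''" for G st''
    proof (rule wins.continue)
      have "p + 3 < L"
        using less.prems(2) f(2) by (simp add: p_def)
      then show "ptr st'' < Suc L" "pos st'' < length ys"
        using sim 3(1) by (simp_all add: p_def similar_def)
      have ptr: "ptr st'' = p"
        using sim by (simp add: similar_def p_def)
      have "G p = h" "G (p + 1) = w" "G (p + 2) = q" "G (p + 3) = r"
        using G \<open>p + 3 < L\<close> by (simp_all add: g'_def)
      then have "step ys k G st'' = act ys k h w q r (st''\<lparr>ptr := p + 4\<rparr>)"
        using 3(2) similar_expecting[OF sim, of ys] ptr by (simp add: step_def)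
      moreover have "similar st' (act ys k h w q r (st''\<lparr>ptr := p + 4\<rparr>))"
        unfolding st' p_def by (rule similar_act[OF similar_ptr[OF sim]]) (use safe in simp_all)
      moreover have "\<forall>i. ptr st' \<le> i \<and> i < L \<longrightarrow> G i = g i"
        using G f(3) by (auto simp: g'_def p_def)
      ultimately show "wins ys k (Suc L) G (step ys k G st'')"
        using g(2) by simp
    qed
    moreover have "\<forall>i. g' i < B"
      using g(1) b by (simp add: g'_def)
    ultimately show ?thesis
      unfolding p_def by blast
  qed
qed

lemma wins_initial:
  assumes B: "2 * k + 1 < B" "k * (2 * k + 2) + 1 < B" "2 ^ k < B"
    and L: "4 * ((k + 1) * (2 * k + 1)) < L"
  shows "\<exists>g. (\<forall>i. g i < B) \<and> (\<forall>G st. (\<forall>i<L. G i = g i) \<longrightarrow> pos st = 0 \<longrightarrow> ptr st = 0 \<longrightarrow>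
    cnt st = 0 \<longrightarrow> dn st = 1 \<longrightarrow> tab st 0 = 0 \<longrightarrow> wins ys k L G st)"
proof -
  define st where "st = \<lparr>pos = 0, ptr = 0, cnt = 0, dn = 1, bs = (\<lambda>_. 0), df = (\<lambda>_. 0), nx = (\<lambda>_. 0), tab = (\<lambda>_. 0)\<rparr>"
  have st: "pos st = 0" "ptr st = 0" "cnt st = 0" "dn st = 1" "tab st 0 = 0"
    by (simp_all add: st_def)
  have "card (unknown st) \<le> card {..<k}"
    by (intro card_mono) (auto simp: unknown_def)
  then have u: "card (unknown st) \<le> k"
    by simp
  have "tracks st m lam" for m lam
    using blocks_initial[OF st(1,3)] st(3) by (simp add: tracks_def)
  then have "following st"
    using st(4,5) u by (simp add: following_def)
  have "card (unknown st) * (2 * k + 1) \<le> k * (2 * k + 1)"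
    using u by (intro mult_right_mono) auto
  \<comment> \<open>At most \<open>k\<close> differences are unknown, the \<open>k\<close> unopened
    blocks weigh \<open>2 * k\<close>, and nothing is alive.\<close>
  then have "potential st \<le> (k + 1) * (2 * k + 1)"
    using st(3) by (simp add: potential_def alive_def)
  then have "ptr st + 4 * potential st \<le> L - 1"
    using st(2) L by simp
  moreover have "Suc (L - 1) = L"
    using L by simp
  ultimately obtain g where g: "\<forall>i. g i < B"
    "\<And>G st'. (\<forall>i. ptr st \<le> i \<and> i < L - 1 \<longrightarrow> G i = g i) \<Longrightarrow> similar st st' \<Longrightarrow> wins ys k L G st'"
    using wins_if_following[OF \<open>following st\<close> _ B, of "L - 1"] by metis
  have "wins ys k L G st'" if "\<forall>i<L. G i = g i" "pos st' = 0" "ptr st' = 0" "cnt st' = 0" "dn st' = 1" "tab st' 0 = 0"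
    for G st'
    by (rule g(2)) (use that st in \<open>simp_all add: similar_def\<close>)
  then show ?thesis
    using g(1) by blast
qed

end

lemma winning_advice:
  assumes "sorted_wrt (<) ys" "AP_partition (set ys) k"
    and "2 * k + 1 < B" "k * (2 * k + 2) + 1 < B" "2 ^ k < B" "4 * ((k + 1) * (2 * k + 1)) < L"
  shows "\<exists>g. (\<forall>i. g i < B) \<and> (\<forall>G st. (\<forall>i<L. G i = g i) \<longrightarrow> pos st = 0 \<longrightarrow> ptr st = 0 \<longrightarrow>
    cnt st = 0 \<longrightarrow> dn st = 1 \<longrightarrow> tab st 0 = 0 \<longrightarrow> wins ys k L G st)"
proof -
  obtain T where T: "\<And>i. i < k \<Longrightarrow> is_AP (T i)" "(\<Union>i<k. T i) = set ys"
    "\<And>i j. i < k \<Longrightarrow> j < k \<Longrightarrow> i \<noteq> j \<Longrightarrow> disjnt (T i) (T j)"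
    using assms(2) unfolding AP_partition_def by blast
  have "\<exists>a d l. d > 0 \<and> T i = ap a d l" if "i < k" for i
    using T(1)[OF that] by (metis is_AP_positive)
  then obtain a d l where adl: "\<And>i. i < k \<Longrightarrow> d i > 0 \<and> T i = ap (a i) (d i) (l i)"
    by metis
  interpret solution ys k a d l
  proof
    show "(\<Union>j<k. ap (a j) (d j) (l j)) = set ys"
      using adl T(2) by simp
  qed (use assms(1) adl T(3) in auto)
  show ?thesis
    by (rule wins_initial) (use assms in auto)
qed

section \<open>The program\<close>

text \<open>\<open>h\<close> remembers the last expecting block, which is the only one when
  \<open>c\<close> is 1. Then no advice is read, and the first branch of \<open>act_prog\<close>
  performs the forced step.\<close>

definition count_prog :: com where
  "count_prog = Seq (assign ''x'' (Read ''Y'' (var ''pos''))) (Seq (assign ''c'' (Const 0)) (Seq (assign ''h'' (Const 0))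
     (For ''i'' (var ''cnt'')
        (Cond (Equal (Read ''nx'' (var ''i'')) (var ''x''))
           (Seq (assign ''c'' (Add (var ''c'') (Const 1))) (assign ''h'' (var ''i''))) Skip))))"

definition advice_prog :: com where
  "advice_prog = Cond (Equal (var ''c'') (Const 1)) Skip
     (Seq (assign ''h'' (Read ''G'' (var ''ptr'')))
     (Seq (assign ''w'' (Read ''G'' (Add (var ''ptr'') (Const 1))))
     (Seq (assign ''q'' (Read ''G'' (Add (var ''ptr'') (Const 2))))
     (Seq (assign ''r'' (Read ''G'' (Add (var ''ptr'') (Const 3))))
          (assign ''ptr'' (Add (var ''ptr'') (Const 4)))))))"

text \<open>Repeated addition replaces multiplication by \<open>q\<close>. For positive
  \<open>q\<close> all matching pairs have the same difference, so overwriting \<open>u\<close> is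
  harmless.\<close>

definition search_prog :: com where
  "search_prog = Seq (assign ''u'' (Const 0))
     (For ''i'' (var ''n'') (For ''j'' (var ''n'')
        (Seq (Seq (assign ''v'' (Sub (Read ''Y'' (var ''i'')) (Read ''Y'' (var ''j'')))) (assign ''y'' (Const 0)))
        (Seq (For ''m'' (var ''q'') (assign ''y'' (Add (var ''y'') (var ''v''))))
             (Cond (Conj (Equal (var ''y'') (var ''z'')) (Less (Const 0) (var ''q''))) (assign ''u'' (var ''v'')) Skip)))))"

definition learn_prog :: com where
  "learn_prog = Seq (Seq (Write ''tab'' (var ''dn'') (Sub (var ''x'') (Read ''bs'' (var ''h'')))) (assign ''z'' (Const 0)))
     (Seq (For ''m'' (var ''r'') (assign ''z'' (Add (var ''z'') (Read ''tab'' (var ''w'')))))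
     (Seq search_prog
     (Seq (Write ''tab'' (Add (var ''dn'') (Const 1)) (var ''u''))
     (Seq (assign ''dn'' (Add (var ''dn'') (Const 2)))
     (Seq (assign ''pos'' (Const 0)) (assign ''cnt'' (Const 0)))))))"

definition advance_prog :: com where
  "advance_prog = Seq (Write ''nx'' (var ''h'') (Add (Read ''nx'' (var ''h'')) (Read ''df'' (var ''h''))))
     (assign ''pos'' (Add (var ''pos'') (Const 1)))"

definition open_prog :: com where
  "open_prog = Seq (Write ''bs'' (var ''cnt'') (var ''x''))
     (Seq (Write ''df'' (var ''cnt'') (Read ''tab'' (var ''w'')))
     (Seq (Write ''nx'' (var ''cnt'') (Add (var ''x'') (Read ''tab'' (var ''w''))))
     (Seq (assign ''cnt'' (Add (var ''cnt'') (Const 1)))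
          (assign ''pos'' (Add (var ''pos'') (Const 1))))))"

definition act_prog :: com where
  "act_prog = Cond (Conj (Less (var ''h'') (var ''cnt'')) (Equal (Read ''nx'' (var ''h'')) (var ''x''))) advance_prog
     (Cond (Conj (Leq (var ''cnt'') (var ''h'')) (Less (var ''cnt'') (var ''k''))) open_prog learn_prog)"

definition step_prog :: com where
  "step_prog = Seq count_prog (Seq advice_prog act_prog)"

text \<open>Arrays are mirrored at all natural indices, leftovers included. Hence a machine can be
  read off the store at the start of any attempt.\<close>

definition represents :: "machine \<Rightarrow> store \<Rightarrow> bool" where
  "represents st \<sigma> \<longleftrightarrow> \<sigma> ''pos'' 0 = int (pos st) \<and> \<sigma> ''ptr'' 0 = int (ptr st) \<and>
     \<sigma> ''cnt'' 0 = int (cnt st) \<and> \<sigma> ''dn'' 0 = int (dn st) \<and>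
     (\<forall>i. \<sigma> ''bs'' (int i) = bs st i) \<and> (\<forall>i. \<sigma> ''df'' (int i) = df st i) \<and>
     (\<forall>i. \<sigma> ''nx'' (int i) = nx st i) \<and> (\<forall>i. \<sigma> ''tab'' (int i) = tab st i)"

definition prepared :: "int list \<Rightarrow> nat \<Rightarrow> (nat \<Rightarrow> nat) \<Rightarrow> store \<Rightarrow> bool" where
  "prepared ys k G \<sigma> \<longleftrightarrow> \<sigma> ''n'' 0 = int (length ys) \<and> \<sigma> ''k'' 0 = int k \<and>
     (\<forall>i<length ys. \<sigma> ''Y'' (int i) = ys ! i) \<and> (\<forall>i. \<sigma> ''G'' (int i) = int (G i))"

section \<open>Simulation of one step of the sweep\<close>

lemma writes_progs [simp]:
  "writes count_prog = {''x'', ''c'', ''h'', ''i''}"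
  "writes advice_prog = {''h'', ''w'', ''q'', ''r'', ''ptr''}"
  "writes search_prog = {''u'', ''i'', ''j'', ''v'', ''y'', ''m''}"
  "writes learn_prog = {''tab'', ''z'', ''u'', ''i'', ''j'', ''v'', ''y'', ''m'', ''dn'', ''pos'', ''cnt''}"
  "writes advance_prog = {''nx'', ''pos''}"
  "writes open_prog = {''bs'', ''df'', ''nx'', ''cnt'', ''pos''}"
  by (auto simp: count_prog_def advice_prog_def search_prog_def learn_prog_def advance_prog_def open_prog_def)

lemma run_count_prog:
  assumes "represents st \<sigma>" "prepared ys k G \<sigma>" "pos st < length ys"
  shows "run count_prog ((cnt st + 1) * 60) \<sigma> (\<lambda>\<tau>. \<tau> ''x'' 0 = ys ! pos st \<and>
    \<tau> ''c'' 0 = int (card (expecting ys st)) \<and>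
    (expecting ys st \<noteq> {} \<longrightarrow> (\<exists>i\<in>expecting ys st. \<tau> ''h'' 0 = int i)))"
proof -
  define E where "E i = {i'. i' < i \<and> nx st i' = ys ! pos st}" for i
  have E_Suc: "E (Suc i) = (if nx st i = ys ! pos st then insert i (E i) else E i)" for i
    by (auto simp: E_def less_Suc_eq)
  have E: "E 0 = {}" "finite (E i)" "i \<notin> E i" "E (cnt st) = expecting ys st" for i
    by (auto simp: E_def expecting_def)
  let ?c = "Cond (Equal (Read ''nx'' (var ''i'')) (var ''x''))
           (Seq (assign ''c'' (Add (var ''c'') (Const 1))) (assign ''h'' (var ''i''))) Skip"
  have x: "\<sigma> ''Y'' (\<sigma> ''pos'' 0) = ys ! pos st" "\<sigma> ''cnt'' 0 = int (cnt st)" "\<And>i. \<sigma> ''nx'' (int i) = nx st i"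
    using assms by (simp_all add: represents_def prepared_def)
  define \<rho> where "\<rho> = sem (assign ''h'' (Const 0)) (sem (assign ''c'' (Const 0)) (sem (assign ''x'' (Read ''Y'' (var ''pos''))) \<sigma>))"
  have \<rho>: "\<rho> ''x'' 0 = ys ! pos st" "\<rho> ''c'' 0 = 0" "\<rho> ''cnt'' 0 = int (cnt st)" "\<And>i. \<rho> ''nx'' (int i) = nx st i"
    by (simp_all add: \<rho>_def x)
  have loop: "run (For ''i'' (var ''cnt'') ?c) ((cnt st + 1) * (2 + 13 + 30)) \<rho> (\<lambda>\<tau>. \<tau> ''x'' 0 = ys ! pos st \<and>
    \<tau> ''c'' 0 = int (card (expecting ys st)) \<and>
    (expecting ys st \<noteq> {} \<longrightarrow> (\<exists>i\<in>expecting ys st. \<tau> ''h'' 0 = int i)))"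
  proof (rule run_For[where N = "cnt st" and t = 30 and
        Inv = "\<lambda>i \<tau>. \<tau> ''c'' 0 = int (card (E i)) \<and> (E i \<noteq> {} \<longrightarrow> (\<exists>i'\<in>E i. \<tau> ''h'' 0 = int i'))"])
    fix i \<tau>
    assume inv: "\<tau> ''c'' 0 = int (card (E i)) \<and> (E i \<noteq> {} \<longrightarrow> (\<exists>i'\<in>E i. \<tau> ''h'' 0 = int i'))"
      and i: "\<tau> ''i'' 0 = int i" and fr: "\<And>u. u \<notin> insert ''i'' (writes ?c) \<Longrightarrow> \<tau> u = \<rho> u"
    have "\<tau> ''nx'' (int i) = nx st i" "\<tau> ''x'' 0 = ys ! pos st"
      using fr[of "''nx''"] fr[of "''x''"] \<rho> by simp_all
    then show "run ?c 30 \<tau> (\<lambda>\<tau>. \<tau> ''c'' 0 = int (card (E (Suc i))) \<and>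
        (E (Suc i) \<noteq> {} \<longrightarrow> (\<exists>i'\<in>E (Suc i). \<tau> ''h'' 0 = int i')))"
      using inv i E by (intro run_sem) (auto simp: E_Suc)
  next
    fix \<tau>
    assume fr: "\<And>u. u \<notin> insert ''i'' (writes ?c) \<Longrightarrow> \<tau> u = \<rho> u"
    then show "aval (var ''cnt'') \<tau> = int (cnt st)"
      using fr[of "''cnt''"] \<rho> by simp
  next
    fix \<tau>
    assume inv: "\<tau> ''c'' 0 = int (card (E (cnt st))) \<and> (E (cnt st) \<noteq> {} \<longrightarrow> (\<exists>i'\<in>E (cnt st). \<tau> ''h'' 0 = int i'))"
      and fr: "\<And>u. u \<notin> insert ''i'' (writes ?c) \<Longrightarrow> \<tau> u = \<rho> u"
    then show "\<tau> ''x'' 0 = ys ! pos st \<and> \<tau> ''c'' 0 = int (card (expecting ys st)) \<and>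
      (expecting ys st \<noteq> {} \<longrightarrow> (\<exists>i\<in>expecting ys st. \<tau> ''h'' 0 = int i))"
      using fr[of "''x''"] \<rho> E(4) by simp
  qed (use \<rho> E in simp_all)
  have "run count_prog (5 + (3 + (3 + (cnt st + 1) * (2 + 13 + 30)))) \<sigma> (\<lambda>\<tau>. \<tau> ''x'' 0 = ys ! pos st \<and>
    \<tau> ''c'' 0 = int (card (expecting ys st)) \<and>
    (expecting ys st \<noteq> {} \<longrightarrow> (\<exists>i\<in>expecting ys st. \<tau> ''h'' 0 = int i)))"
    unfolding count_prog_def
    by (intro run_Seq[OF run_sem] loop[unfolded \<rho>_def]) simp_all
  then show ?thesis
    by (rule run_mono) auto
qed

lemma run_search_prog:
  assumes "prepared ys k G \<sigma>" "\<sigma> ''q'' 0 = int q" "\<sigma> ''z'' 0 = z" "q \<le> B"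
  shows "run search_prog ((length ys + 1)\<^sup>2 * (B + 1) * 200) \<sigma> (\<lambda>\<tau>. \<tau> ''u'' 0 = quot ys q z)"
proof -
  let ?n = "length ys"
  \<comment> \<open>The value of \<open>u\<close> after the pairs of indices in \<open>F\<close>
    have been tried; the set \<open>P i j\<close> below lists the pairs before \<open>(i, j)\<close>
    in the order of the two loops.\<close>
  define found where "found F = (if 0 < q \<and> (\<exists>(i, j)\<in>F. int q * (ys ! i - ys ! j) = z) then z div int q else 0)"
    for F :: "(nat \<times> nat) set"
  have found_insert: "found (insert (i, j) F) =
      (if int q * (ys ! i - ys ! j) = z \<and> 0 < q then ys ! i - ys ! j else found F)" for i j F
    by (auto simp: found_def)
  have found_empty: "found {} = 0"
    by (simp add: found_def)
  have found_all: "found ({..<?n} \<times> {..<?n}) = quot ys q z"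
    unfolding found_def quot_def by (rule if_cong) (fastforce simp: in_set_conv_nth)+
  define P where "P i j = {..<i} \<times> {..<?n} \<union> {i} \<times> {..<j}" for i j :: nat
  have P: "P i (Suc j) = insert (i, j) (P i j)" "P i ?n = P (Suc i) 0" "P 0 0 = {}" "P ?n 0 = {..<?n} \<times> {..<?n}" for i j :: nat
    by (auto simp: P_def less_Suc_eq)
  let ?read = "Seq (assign ''v'' (Sub (Read ''Y'' (var ''i'')) (Read ''Y'' (var ''j'')))) (assign ''y'' (Const 0))"
  let ?mul = "For ''m'' (var ''q'') (assign ''y'' (Add (var ''y'') (var ''v'')))"
  let ?test = "Cond (Conj (Equal (var ''y'') (var ''z'')) (Less (Const 0) (var ''q''))) (assign ''u'' (var ''v'')) Skip"
  let ?inner = "Seq ?read (Seq ?mul ?test)"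
  let ?T = "12 + ((q + 1) * 40 + 40)"
  have inner: "run ?inner ?T \<tau> (\<lambda>\<tau>'. \<tau>' ''u'' 0 = found (P i (Suc j)))"
    if "i < ?n" "j < ?n" "\<tau> ''i'' 0 = int i" "\<tau> ''j'' 0 = int j" "\<tau> ''u'' 0 = found (P i j)"
      "\<tau> ''Y'' = \<sigma> ''Y''" "\<tau> ''q'' = \<sigma> ''q''" "\<tau> ''z'' = \<sigma> ''z''" for i j \<tau>
  proof (rule run_Seq, rule run_sem)
    define \<rho> where "\<rho> = sem ?read \<tau>"
    have \<rho>: "\<rho> ''v'' 0 = ys ! i - ys ! j" "\<rho> ''y'' 0 = 0" "\<rho> ''u'' 0 = found (P i j)"
      "\<rho> ''q'' 0 = int q" "\<rho> ''z'' 0 = z"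
      using that assms by (simp_all add: \<rho>_def prepared_def)
    have "run ?mul ((q + 1) * 40) \<rho> (\<lambda>\<tau>'. \<tau>' ''y'' 0 = int q * (ys ! i - ys ! j))"
    proof (rule run_For[where N = q and t = 10 and Inv = "\<lambda>m \<tau>'. \<tau>' ''y'' 0 = int m * (ys ! i - ys ! j)"])
      fix m \<tau>'
      assume "\<tau>' ''y'' 0 = int m * (ys ! i - ys ! j)"
        and fr: "\<And>u. u \<notin> insert ''m'' (writes (assign ''y'' (Add (var ''y'') (var ''v'')))) \<Longrightarrow> \<tau>' u = \<rho> u"
      then show "run (assign ''y'' (Add (var ''y'') (var ''v''))) 10 \<tau>' (\<lambda>\<tau>'. \<tau>' ''y'' 0 = int (Suc m) * (ys ! i - ys ! j))"
        using \<rho> fr[of "''v''"] by (intro run_sem) (simp_all add: algebra_simps)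
    next
      fix \<tau>'
      assume fr: "\<And>u. u \<notin> insert ''m'' (writes (assign ''y'' (Add (var ''y'') (var ''v'')))) \<Longrightarrow> \<tau>' u = \<rho> u"
      show "aval (var ''q'') \<tau>' = int q"
        using \<rho> fr[of "''q''"] by simp
    qed (use \<rho> in simp_all)
    then have "run ?mul ((q + 1) * 40) \<rho> (\<lambda>\<tau>'. run ?test 40 \<tau>' (\<lambda>\<tau>'. \<tau>' ''u'' 0 = found (P i (Suc j))))"
    proof (rule run_mono)
      fix \<tau>'
      assume y: "\<tau>' ''y'' 0 = int q * (ys ! i - ys ! j)" and fr: "\<And>u. u \<notin> writes ?mul \<Longrightarrow> \<tau>' u = \<rho> u"
      have "\<tau>' ''v'' 0 = ys ! i - ys ! j" "\<tau>' ''u'' 0 = found (P i j)" "\<tau>' ''q'' 0 = int q" "\<tau>' ''z'' 0 = z"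
        using \<rho> fr by simp_all
      then show "run ?test 40 \<tau>' (\<lambda>\<tau>'. \<tau>' ''u'' 0 = found (P i (Suc j)))"
        using y by (intro run_sem) (auto simp: P(1) found_insert)
    qed simp
    then show "run (Seq ?mul ?test) ((q + 1) * 40 + 40) (sem ?read \<tau>) (\<lambda>\<tau>'. \<tau>' ''u'' 0 = found (P i (Suc j)))"
      unfolding \<rho>_def by (rule run_Seq)
  qed simp_all
  define \<rho> where "\<rho> = sem (assign ''u'' (Const 0)) \<sigma>"
  have row: "run (For ''j'' (var ''n'') ?inner) ((?n + 1) * (15 + ?T)) \<tau> (\<lambda>\<tau>'. \<tau>' ''u'' 0 = found (P (Suc i) 0))"
    if i: "i < ?n" "\<tau> ''i'' 0 = int i" "\<tau> ''u'' 0 = found (P i 0)"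
      and \<tau>: "\<tau> ''Y'' = \<sigma> ''Y''" "\<tau> ''q'' = \<sigma> ''q''" "\<tau> ''z'' = \<sigma> ''z''" "\<tau> ''n'' = \<sigma> ''n''" for i \<tau>
  proof (rule run_For[where N = ?n and t = ?T and Inv = "\<lambda>j \<tau>'. \<tau>' ''u'' 0 = found (P i j)"])
    fix j \<tau>'
    assume "j < ?n" "\<tau>' ''u'' 0 = found (P i j)" "\<tau>' ''j'' 0 = int j"
      and fr: "\<And>u. u \<notin> insert ''j'' (writes ?inner) \<Longrightarrow> \<tau>' u = \<tau> u"
    then show "run ?inner ?T \<tau>' (\<lambda>\<tau>'. \<tau>' ''u'' 0 = found (P i (Suc j)))"
      using i \<tau> by (intro inner) simp_all
  next
    fix \<tau>'
    assume fr: "\<And>u. u \<notin> insert ''j'' (writes ?inner) \<Longrightarrow> \<tau>' u = \<tau> u"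
    then show "aval (var ''n'') \<tau>' = int ?n"
      using \<tau> assms(1) by (simp add: prepared_def)
  qed (use i P in simp_all)
  have "run (For ''i'' (var ''n'') (For ''j'' (var ''n'') ?inner)) ((?n + 1) * (15 + (?n + 1) * (15 + ?T))) \<rho>
      (\<lambda>\<tau>'. \<tau>' ''u'' 0 = quot ys q z)"
  proof (rule run_For[where N = ?n and t = "(?n + 1) * (15 + ?T)" and Inv = "\<lambda>i \<tau>'. \<tau>' ''u'' 0 = found (P i 0)"])
    fix i \<tau>
    assume i: "i < ?n" "\<tau> ''u'' 0 = found (P i 0)" "\<tau> ''i'' 0 = int i"
      and fr: "\<And>u. u \<notin> insert ''i'' (writes (For ''j'' (var ''n'') ?inner)) \<Longrightarrow> \<tau> u = \<rho> u"
    show "run (For ''j'' (var ''n'') ?inner) ((?n + 1) * (15 + ?T)) \<tau> (\<lambda>\<tau>'. \<tau>' ''u'' 0 = found (P (Suc i) 0))"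
      using row[of i \<tau>] i fr[of "''Y''"] fr[of "''q''"] fr[of "''z''"] fr[of "''n''"]
      by (simp add: \<rho>_def)
  next
    fix \<tau>
    assume fr: "\<And>u. u \<notin> insert ''i'' (writes (For ''j'' (var ''n'') ?inner)) \<Longrightarrow> \<tau> u = \<rho> u"
    then show "aval (var ''n'') \<tau> = int ?n"
      using assms(1) by (simp add: prepared_def \<rho>_def)
  qed (use P found_empty found_all in \<open>simp_all add: \<rho>_def\<close>)
  then have run: "run search_prog (3 + (?n + 1) * (15 + (?n + 1) * (15 + ?T))) \<sigma> (\<lambda>\<tau>'. \<tau>' ''u'' 0 = quot ys q z)"
    unfolding search_prog_def by (intro run_Seq[OF run_sem]) (simp_all add: \<rho>_def)
  have "3 + (?n + 1) * (15 + (?n + 1) * (15 + ?T)) \<le> (?n + 1)\<^sup>2 * (B + 1) * 200"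
  proof -
    define c where "c = (?n + 1) * (B + 1)"
    have "15 + ?T \<le> (B + 1) * 120"
      using assms(4) by simp
    then have "(?n + 1) * (15 + ?T) \<le> (?n + 1) * ((B + 1) * 120)"
      by (rule mult_left_mono) simp
    also have "\<dots> = c * 120"
      by (simp only: c_def mult.assoc)
    finally have "15 + (?n + 1) * (15 + ?T) \<le> c * 140"
      by (simp add: c_def)
    then have "(?n + 1) * (15 + (?n + 1) * (15 + ?T)) \<le> (?n + 1) * (c * 140)"
      by (rule mult_left_mono) simp
    also have "\<dots> = (?n + 1) * c * 140"
      by (simp only: mult.assoc)
    finally have "3 + (?n + 1) * (15 + (?n + 1) * (15 + ?T)) \<le> (?n + 1) * c * 200"
      using mult_le_mono[of 1 "?n + 1" 1 c] by (simp add: c_def)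
    then show ?thesis
      by (simp only: c_def power2_eq_square mult.assoc)
  qed
  then show ?thesis
    by (intro run_mono[OF run]) simp_all
qed

lemma le_cost: "c \<le> (n + 1)\<^sup>2 * (B + 1) * c" "B + 1 \<le> (n + 1)\<^sup>2 * (B + 1)" for n B c :: nat
  using mult_right_mono[of 1 "(n + 1)\<^sup>2 * (B + 1)" c] mult_right_mono[of 1 "(n + 1)\<^sup>2" "B + 1"]
  by simp_all

lemma run_learn_prog:
  assumes "represents st \<sigma>" "prepared ys k G \<sigma>" "\<sigma> ''x'' 0 = ys ! pos st"
    and hwqr: "\<sigma> ''h'' 0 = int h" "\<sigma> ''w'' 0 = int w" "\<sigma> ''q'' 0 = int q" "\<sigma> ''r'' 0 = int r"
    and B: "q \<le> B" "r \<le> B"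
  shows "run learn_prog ((length ys + 1)\<^sup>2 * (B + 1) * 300) \<sigma> (represents (learn ys h w q r st))"
proof -
  let ?first = "Seq (Write ''tab'' (var ''dn'') (Sub (var ''x'') (Read ''bs'' (var ''h'')))) (assign ''z'' (Const 0))"
  let ?add = "assign ''z'' (Add (var ''z'') (Read ''tab'' (var ''w'')))"
  let ?last = "Seq (Write ''tab'' (Add (var ''dn'') (Const 1)) (var ''u''))
     (Seq (assign ''dn'' (Add (var ''dn'') (Const 2)))
     (Seq (assign ''pos'' (Const 0)) (assign ''cnt'' (Const 0))))"
  let ?T = "(length ys + 1)\<^sup>2 * (B + 1) * 200"
  define tb where "tb = (tab st)(dn st := ys ! pos st - bs st h)"
  define \<rho> where "\<rho> = sem ?first \<sigma>"
  note rep = assms(1)[unfolded represents_def]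
  have \<rho>: "\<rho> ''z'' 0 = 0" "\<And>i. \<rho> ''tab'' (int i) = tb i"
    using rep assms(3) hwqr(1) by (auto simp: \<rho>_def tb_def)
  have \<rho>_other: "\<rho> v = \<sigma> v" if "v \<noteq> ''tab''" "v \<noteq> ''z''" for v
    using that by (simp add: \<rho>_def)
  have "run (For ''m'' (var ''r'') ?add) ((r + 1) * 40) \<rho> (\<lambda>\<tau>. \<tau> ''z'' 0 = int r * tb w)"
  proof (rule run_For[where N = r and t = 10 and Inv = "\<lambda>m \<tau>. \<tau> ''z'' 0 = int m * tb w"])
    fix m \<tau>
    assume "\<tau> ''z'' 0 = int m * tb w" and fr: "\<And>u. u \<notin> insert ''m'' (writes ?add) \<Longrightarrow> \<tau> u = \<rho> u"
    then show "run ?add 10 \<tau> (\<lambda>\<tau>. \<tau> ''z'' 0 = int (Suc m) * tb w)"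
      using \<rho>(2) \<rho>_other[of "''w''"] hwqr(2) fr[of "''w''"] fr[of "''tab''"]
      by (intro run_sem) (simp_all add: algebra_simps)
  next
    fix \<tau>
    assume fr: "\<And>u. u \<notin> insert ''m'' (writes ?add) \<Longrightarrow> \<tau> u = \<rho> u"
    show "aval (var ''r'') \<tau> = int r"
      using fr[of "''r''"] \<rho>_other[of "''r''"] hwqr(4) by simp
  qed (use \<rho> in simp_all)
  then have "run (For ''m'' (var ''r'') ?add) ((r + 1) * 40) \<rho>
      (\<lambda>\<tau>. run (Seq search_prog ?last) (?T + 40) \<tau> (represents (learn ys h w q r st)))"
  proof (rule run_mono)
    fix \<tau>
    assume z: "\<tau> ''z'' 0 = int r * tb w" and fr: "\<And>v. v \<notin> writes (For ''m'' (var ''r'') ?add) \<Longrightarrow> \<tau> v = \<rho> v"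
    have \<tau>: "\<tau> v = \<sigma> v" if "v \<notin> {''m'', ''z'', ''tab''}" for v
      using fr[of v] \<rho>_other[of v] that by simp
    have "run search_prog ?T \<tau> (\<lambda>\<tau>. \<tau> ''u'' 0 = quot ys q (int r * tb w))"
    proof (rule run_search_prog)
      show "prepared ys k G \<tau>"
        using assms(2) by (simp add: prepared_def \<tau>)
    qed (use z hwqr(3) B(1) \<tau> in simp_all)
    then have "run search_prog ?T \<tau> (\<lambda>\<tau>. run ?last 40 \<tau> (represents (learn ys h w q r st)))"
    proof (rule run_mono)
      fix \<tau>'
      assume u: "\<tau>' ''u'' 0 = quot ys q (int r * tb w)" and fr': "\<And>v. v \<notin> writes search_prog \<Longrightarrow> \<tau>' v = \<tau> v"
      have "\<tau>' v = \<sigma> v" if "v \<in> {''ptr'', ''dn'', ''bs'', ''df'', ''nx''}" for v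
        using fr'[of v] \<tau>[of v] that by auto
      moreover have "\<tau>' ''tab'' (int i) = tb i" for i
        using fr'[of "''tab''"] fr[of "''tab''"] \<rho>(2) by simp
      ultimately show "run ?last 40 \<tau>' (represents (learn ys h w q r st))"
        using rep u by (intro run_sem) (auto simp: represents_def learn_def Let_def tb_def)
    qed simp
    then show "run (Seq search_prog ?last) (?T + 40) \<tau> (represents (learn ys h w q r st))"
      by (rule run_Seq)
  qed simp
  then have "run (Seq (For ''m'' (var ''r'') ?add) (Seq search_prog ?last)) ((r + 1) * 40 + (?T + 40)) (sem ?first \<sigma>)
      (represents (learn ys h w q r st))"
    unfolding \<rho>_def by (rule run_Seq)
  then have run: "run learn_prog (15 + ((r + 1) * 40 + (?T + 40))) \<sigma> (represents (learn ys h w q r st))"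
    unfolding learn_prog_def by (rule run_Seq[OF run_sem, rotated 2]) simp_all
  have "B + 1 \<le> (length ys + 1)\<^sup>2 * (B + 1)"
    by (rule le_cost)
  moreover have "15 + ((r + 1) * 40 + (c * 200 + 40)) \<le> c * 300" if "B + 1 \<le> c" for c
    using that B(2) by simp
  ultimately have "15 + ((r + 1) * 40 + (?T + 40)) \<le> (length ys + 1)\<^sup>2 * (B + 1) * 300"
    by blast
  then show ?thesis
    by (intro run_mono[OF run]) simp_all
qed

lemma run_act_prog:
  assumes "represents st \<sigma>" "prepared ys k G \<sigma>" "\<sigma> ''x'' 0 = ys ! pos st"
    and hwqr: "\<sigma> ''h'' 0 = int h" "\<sigma> ''w'' 0 = int w" "\<sigma> ''q'' 0 = int q" "\<sigma> ''r'' 0 = int r"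
    and B: "q \<le> B" "r \<le> B"
  shows "run act_prog ((length ys + 1)\<^sup>2 * (B + 1) * 400) \<sigma> (represents (act ys k h w q r st))"
proof -
  note rep = assms(1)[unfolded represents_def] and pre = assms(2)[unfolded prepared_def]
  let ?Q = "represents (act ys k h w q r st)"
  let ?T = "(length ys + 1)\<^sup>2 * (B + 1) * 300"
  have "?T \<ge> 300"
    by (rule le_cost)
  have adv: "run advance_prog ?T \<sigma> ?Q" if "h < cnt st" "nx st h = ys ! pos st"
  proof (rule run_sem)
    show "?Q (sem advance_prog \<sigma>)"
      using that rep hwqr(1) by (auto simp: advance_prog_def act_def advance_def represents_def)
  qed (use \<open>?T \<ge> 300\<close> in \<open>simp_all add: advance_prog_def\<close>)
  have opn: "run open_prog ?T \<sigma> ?Q" if "\<not> h < cnt st" "cnt st < k"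
  proof (rule run_sem)
    show "?Q (sem open_prog \<sigma>)"
      using that rep hwqr(2) assms(3) by (auto simp: open_prog_def act_def open_block_def represents_def)
  qed (use \<open>?T \<ge> 300\<close> in \<open>simp_all add: open_prog_def\<close>)
  have lrn: "run learn_prog ?T \<sigma> ?Q"
    if "\<not> (h < cnt st \<and> nx st h = ys ! pos st)" "\<not> (cnt st \<le> h \<and> cnt st < k)"
  proof -
    have "act ys k h w q r st = learn ys h w q r st"
      using that by (auto simp: act_def)
    then show ?thesis
      using run_learn_prog[OF assms] by simp
  qed
  let ?b1 = "Conj (Less (var ''h'') (var ''cnt'')) (Equal (Read ''nx'' (var ''h'')) (var ''x''))"
  let ?b2 = "Conj (Leq (var ''cnt'') (var ''h'')) (Less (var ''cnt'') (var ''k''))"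
  have b1: "bval ?b1 \<sigma> \<longleftrightarrow> h < cnt st \<and> nx st h = ys ! pos st"
    using rep hwqr(1) assms(3) by auto
  have b2: "bval ?b2 \<sigma> \<longleftrightarrow> cnt st \<le> h \<and> cnt st < k"
    using rep pre hwqr(1) by auto
  have no: "run (Cond ?b2 open_prog learn_prog) (bcost ?b2 + 1 + ?T) \<sigma> ?Q" if "\<not> bval ?b1 \<sigma>"
    by (rule run_Cond) (use that b1 b2 opn lrn in auto)
  have yes: "run advance_prog (bcost ?b2 + 1 + ?T) \<sigma> ?Q" if "bval ?b1 \<sigma>"
    by (rule run_mono[OF adv]) (use that b1 in simp_all)
  have "run act_prog (bcost ?b1 + 1 + (bcost ?b2 + 1 + ?T)) \<sigma> ?Q"
    unfolding act_prog_def by (rule run_Cond[OF yes no])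
  moreover have "bcost ?b1 + 1 + (bcost ?b2 + 1 + c * 300) \<le> c * 400" if "100 \<le> c * 100" for c
    using that by simp
  ultimately show ?thesis
    using run_mono le_cost(1) by blast
qed

lemma run_step_prog:
  assumes "represents st \<sigma>" "prepared ys k G \<sigma>" "pos st < length ys" "cnt st \<le> length ys"
    and B: "\<And>i. G i \<le> B"
  shows "run step_prog ((length ys + 1)\<^sup>2 * (B + 1) * 600) \<sigma> (represents (step ys k G st))"
proof -
  let ?n = "length ys" and ?E = "expecting ys st"
  let ?Q = "represents (step ys k G st)"
  let ?T = "(?n + 1)\<^sup>2 * (B + 1) * 400"
  have "run count_prog ((cnt st + 1) * 60) \<sigma> (\<lambda>\<tau>. run (Seq advice_prog act_prog) (60 + ?T) \<tau> ?Q)"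
  proof (rule run_mono[OF run_count_prog[OF assms(1-3)]])
    fix \<tau>
    assume 1: "\<tau> ''x'' 0 = ys ! pos st \<and> \<tau> ''c'' 0 = int (card ?E) \<and> (?E \<noteq> {} \<longrightarrow> (\<exists>i\<in>?E. \<tau> ''h'' 0 = int i))"
      and fr: "\<And>v. v \<notin> writes count_prog \<Longrightarrow> \<tau> v = \<sigma> v"
    have rep: "represents st \<tau>" and pre: "prepared ys k G \<tau>"
      using assms(1,2) by (simp_all add: represents_def prepared_def fr)
    have "run act_prog ?T (sem advice_prog \<tau>) ?Q"
    proof (cases "card ?E = 1")
      case True
      then obtain i where i: "?E = {i}"
        by (auto simp: card_1_singleton_iff)
      then have h: "\<tau> ''h'' 0 = int i" "i < cnt st" "nx st i = ys ! pos st"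
        using 1 by (auto simp: expecting_def)
      have sem: "sem advice_prog \<tau> = \<tau>"
        using 1 True by (simp add: advice_prog_def)
      have "run advance_prog 300 \<tau> (represents (advance i st))"
      proof (rule run_sem)
        show "represents (advance i st) (sem advance_prog \<tau>)"
          using h(1) rep by (auto simp: advance_prog_def advance_def represents_def)
      qed (simp_all add: advance_prog_def)
      then have "run act_prog (bcost (Conj (Less (var ''h'') (var ''cnt'')) (Equal (Read ''nx'' (var ''h'')) (var ''x''))) + 1 + 300)
          \<tau> (represents (advance i st))"
        unfolding act_prog_def
        by (intro run_Cond) (use h rep 1 in \<open>simp_all add: represents_def\<close>)
      moreover have "400 \<le> ?T"
        by (rule le_cost)
      ultimately show ?thesis
        unfolding sem using True i by (elim run_mono) (simp_all add: step_def)
    next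
      case False
      let ?st = "st\<lparr>ptr := ptr st + 4\<rparr>"
      have E: "Suc 0 < card ?E \<or> card ?E = 0"
        using False by linarith
      have G: "\<tau> ''ptr'' 0 = int (ptr st)" "\<And>i. \<tau> ''G'' (int i) = int (G i)"
        using rep pre by (simp_all add: represents_def prepared_def)
      have G': "\<tau> ''G'' (int (ptr st) + 1) = int (G (ptr st + 1))" "\<tau> ''G'' (int (ptr st) + 2) = int (G (ptr st + 2))"
        "\<tau> ''G'' (int (ptr st) + 3) = int (G (ptr st + 3))"
        using G(2)[of "ptr st + 1"] G(2)[of "ptr st + 2"] G(2)[of "ptr st + 3"] by (simp_all add: add.commute)
      have "step ys k G st = act ys k (G (ptr st)) (G (ptr st + 1)) (G (ptr st + 2)) (G (ptr st + 3)) ?st"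
        using False by (simp add: step_def)
      moreover have "run act_prog ?T (sem advice_prog \<tau>)
          (represents (act ys k (G (ptr st)) (G (ptr st + 1)) (G (ptr st + 2)) (G (ptr st + 3)) ?st))"
      proof (rule run_act_prog)
        show "represents ?st (sem advice_prog \<tau>)"
          using rep G(1) E 1 by (simp add: advice_prog_def represents_def)
        show "prepared ys k G (sem advice_prog \<tau>)"
          using pre E 1 by (simp add: advice_prog_def prepared_def)
      qed (use 1 E G G' B in \<open>auto simp: advice_prog_def\<close>)
      ultimately show ?thesis
        by simp
    qed
    then show "run (Seq advice_prog act_prog) (60 + ?T) \<tau> ?Q"
      by (intro run_Seq[OF run_sem]) (simp_all add: advice_prog_def)
  qed simp
  then have run: "run step_prog ((cnt st + 1) * 60 + (60 + ?T)) \<sigma> ?Q"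
    unfolding step_prog_def by (rule run_Seq)
  have "cnt st + 1 \<le> (?n + 1)\<^sup>2 * (B + 1)"
  proof -
    have "(?n + 1) * 1 \<le> (?n + 1) * ((?n + 1) * (B + 1))"
      by (rule mult_left_mono) simp_all
    then show ?thesis
      using assms(4) by (simp add: power2_eq_square algebra_simps)
  qed
  moreover have "(cnt st + 1) * 60 + (60 + c * 400) \<le> c * 600"
    if "cnt st + 1 \<le> c" for c
    using that by simp
  ultimately have "(cnt st + 1) * 60 + (60 + ?T) \<le> (?n + 1)\<^sup>2 * (B + 1) * 600"
    by blast
  then show ?thesis
    by (intro run_mono[OF run]) simp_all
qed

section \<open>Sorting and parameters\<close>

text \<open>Sorting by rank: each element is written to the position given by the number of smaller
  ones. As the elements are distinct, no two positions coincide.\<close>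

definition sort_prog :: com where
  "sort_prog = For ''i'' (var ''n'') (Seq (assign ''r'' (Const 0))
     (Seq (For ''j'' (var ''n'')
        (Cond (Less (Read ''X'' (var ''j'')) (Read ''X'' (var ''i''))) (assign ''r'' (Add (var ''r'') (Const 1))) Skip))
     (Write ''Y'' (var ''r'') (Read ''X'' (var ''i'')))))"

lemma card_less_nth:
  assumes "sorted_wrt (<) (ys :: int list)" "p < length ys"
  shows "card {y \<in> set ys. y < ys ! p} = p"
proof -
  have inj: "inj_on ((!) ys) {..<p}"
    using assms by (intro inj_on_nth) (auto simp: strict_sorted_iff)
  have "{y \<in> set ys. y < ys ! p} = (!) ys ` {..<p}"
  proof (intro equalityI subsetI)
    fix y assume "y \<in> {y \<in> set ys. y < ys ! p}"
    then obtain i where i: "i < length ys" "y = ys ! i" "ys ! i < ys ! p"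
      by (auto simp: in_set_conv_nth)
    then have "i < p"
      using sorted_wrt_nth_less[OF assms(1), of p i] by (metis less_asym linorder_neqE_nat less_irrefl)
    then show "y \<in> (!) ys ` {..<p}"
      using i by auto
  qed (use assms sorted_wrt_nth_less[OF assms(1)] in auto)
  then show ?thesis
    using inj by (simp add: card_image)
qed

lemma card_less_indices:
  assumes "distinct xs"
  shows "card {j. j < length xs \<and> xs ! j < x} = card {y \<in> set xs. y < x}"
proof -
  have "inj_on ((!) xs) {j. j < length xs \<and> xs ! j < x}"
    using assms by (auto simp: inj_on_def nth_eq_iff_index_eq)
  moreover have "{y \<in> set xs. y < x} = (!) xs ` {j. j < length xs \<and> xs ! j < x}"
    by (auto simp: in_set_conv_nth)
  ultimately show ?thesis
    by (simp add: card_image)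
qed

lemma writes_sort_prog [simp]: "writes sort_prog = {''i'', ''j'', ''r'', ''Y''}"
  by (auto simp: sort_prog_def)

lemma run_sort_prog:
  assumes n: "\<sigma> ''n'' 0 = int (length xs)" and X: "\<And>i. i < length xs \<Longrightarrow> \<sigma> ''X'' (int i) = xs ! i"
    and "distinct xs" and ys: "sorted_wrt (<) ys" "set ys = set xs" "length ys = length xs"
  shows "run sort_prog ((length xs + 1)\<^sup>2 * 200) \<sigma> (\<lambda>\<tau>. \<forall>i<length ys. \<tau> ''Y'' (int i) = ys ! i)"
proof -
  let ?n = "length xs"
  define rank where "rank x = card {y \<in> set xs. y < x}" for x
  define E where "E x i = {j. j < i \<and> xs ! j < x}" for x and i :: nat
  have E: "E x (Suc i) = (if xs ! i < x then insert i (E x i) else E x i)" "finite (E x i)" "i \<notin> E x i"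
    "E x 0 = {}" "card (E x ?n) = rank x" for x i
    using card_less_indices[OF assms(3), of x] by (auto simp: E_def rank_def less_Suc_eq)
  have rank: "rank (ys ! p) = p" if "p < length ys" for p
    using card_less_nth[OF ys(1) that] ys(2) by (simp add: rank_def)
  let ?cmp = "Cond (Less (Read ''X'' (var ''j'')) (Read ''X'' (var ''i''))) (assign ''r'' (Add (var ''r'') (Const 1))) Skip"
  let ?cnt = "For ''j'' (var ''n'') ?cmp"
  let ?put = "Write ''Y'' (var ''r'') (Read ''X'' (var ''i''))"
  let ?body = "Seq (assign ''r'' (Const 0)) (Seq ?cnt ?put)"
  let ?T = "(?n + 1) * 40"
  have count: "run ?cnt ?T \<tau> (\<lambda>\<tau>'. \<tau>' ''r'' 0 = int (rank (xs ! i)))"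
    if i: "i < ?n" "\<tau> ''i'' 0 = int i" "\<tau> ''r'' 0 = 0" "\<tau> ''X'' = \<sigma> ''X''" "\<tau> ''n'' = \<sigma> ''n''" for i \<tau>
  proof (rule run_For[where N = ?n and t = 20 and Inv = "\<lambda>j \<tau>'. \<tau>' ''r'' 0 = int (card (E (xs ! i) j))"])
    fix j \<tau>'
    assume j: "j < ?n" "\<tau>' ''r'' 0 = int (card (E (xs ! i) j))" "\<tau>' ''j'' 0 = int j"
      and fr: "\<And>u. u \<notin> insert ''j'' (writes ?cmp) \<Longrightarrow> \<tau>' u = \<tau> u"
    have "\<tau>' ''X'' (int j) = xs ! j" "\<tau>' ''X'' (int i) = xs ! i" "\<tau>' ''i'' 0 = int i"
      using fr[of "''X''"] fr[of "''i''"] i j(1) X by simp_all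
    then show "run ?cmp 20 \<tau>' (\<lambda>\<tau>'. \<tau>' ''r'' 0 = int (card (E (xs ! i) (Suc j))))"
      using j E by (intro run_sem) auto
  next
    fix \<tau>'
    assume fr: "\<And>u. u \<notin> insert ''j'' (writes ?cmp) \<Longrightarrow> \<tau>' u = \<tau> u"
    show "aval (var ''n'') \<tau>' = int ?n"
      using fr[of "''n''"] i n by simp
  qed (use i E in simp_all)
  have body: "run ?body (3 + (?T + 10)) \<tau> (\<lambda>\<tau>'. \<forall>i'<Suc i. \<tau>' ''Y'' (int (rank (xs ! i'))) = xs ! i')"
    if i: "i < ?n" "\<tau> ''i'' 0 = int i" "\<tau> ''X'' = \<sigma> ''X''" "\<tau> ''n'' = \<sigma> ''n''"
      and inv: "\<forall>i'<i. \<tau> ''Y'' (int (rank (xs ! i'))) = xs ! i'" for i \<tau>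
  proof -
    let ?\<rho> = "sem (assign ''r'' (Const 0)) \<tau>"
    have "run ?cnt ?T ?\<rho> (\<lambda>\<tau>'. run ?put 10 \<tau>' (\<lambda>\<tau>'. \<forall>i'<Suc i. \<tau>' ''Y'' (int (rank (xs ! i'))) = xs ! i'))"
    proof (rule run_mono[OF count[OF i(1)]])
      fix \<tau>'
      assume r: "\<tau>' ''r'' 0 = int (rank (xs ! i))" and fr: "\<And>v. v \<notin> writes ?cnt \<Longrightarrow> \<tau>' v = ?\<rho> v"
      have "\<tau>' ''X'' (int i) = xs ! i" "\<tau>' ''i'' 0 = int i" "\<tau>' ''Y'' = \<tau> ''Y''"
        using fr[of "''X''"] fr[of "''i''"] fr[of "''Y''"] i X by simp_all
      moreover have "xs ! i = xs ! i'" if "rank (xs ! i') = rank (xs ! i)" "i' < i" for i'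
      proof -
        have "xs ! i \<in> set ys" "xs ! i' \<in> set ys"
          using ys(2) i(1) that(2) by simp_all
        then show ?thesis
          using rank that(1) by (metis in_set_conv_nth)
      qed
      ultimately show "run ?put 10 \<tau>' (\<lambda>\<tau>'. \<forall>i'<Suc i. \<tau>' ''Y'' (int (rank (xs ! i'))) = xs ! i')"
        using r inv by (intro run_sem) (auto simp: less_Suc_eq)
    qed (use i in simp_all)
    then show ?thesis
      by (intro run_sem_Seq[OF _ _ run_Seq]) simp_all
  qed
  have "(?n + 1) * (15 + (3 + (?T + 10))) \<le> (?n + 1)\<^sup>2 * 200"
    by (simp add: power2_eq_square algebra_simps)
  then show ?thesis
    unfolding sort_prog_def
  proof (intro run_For[where N = ?n and t = "3 + (?T + 10)" and
        Inv = "\<lambda>i \<tau>. \<forall>i'<i. \<tau> ''Y'' (int (rank (xs ! i'))) = xs ! i'"])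
    fix i \<tau>
    assume i: "i < ?n" "\<forall>i'<i. \<tau> ''Y'' (int (rank (xs ! i'))) = xs ! i'" "\<tau> ''i'' 0 = int i"
      and fr: "\<And>u. u \<notin> insert ''i'' (writes ?body) \<Longrightarrow> \<tau> u = \<sigma> u"
    show "run ?body (3 + (?T + 10)) \<tau> (\<lambda>\<tau>'. \<forall>i'<Suc i. \<tau>' ''Y'' (int (rank (xs ! i'))) = xs ! i')"
      using body[of i \<tau>] i fr[of "''X''"] fr[of "''n''"] by simp
  next
    fix \<tau>
    assume fr: "\<And>u. u \<notin> insert ''i'' (writes ?body) \<Longrightarrow> \<tau> u = \<sigma> u"
    show "aval (var ''n'') \<tau> = int ?n"
      using fr[of "''n''"] n by simp
  next
    fix \<tau>
    assume inv: "\<forall>i'<?n. \<tau> ''Y'' (int (rank (xs ! i'))) = xs ! i'"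
    show "\<forall>i<length ys. \<tau> ''Y'' (int i) = ys ! i"
    proof (intro allI impI)
      fix p assume p: "p < length ys"
      then have "ys ! p \<in> set xs"
        using nth_mem[OF p] ys(2) by simp
      then obtain i where "i < ?n" "xs ! i = ys ! p"
        by (auto simp: in_set_conv_nth)
      then show "\<tau> ''Y'' (int p) = ys ! p"
        using inv rank[OF p] by metis
    qed
  qed simp_all
qed

text \<open>Powers and products have to be built from additions: \<open>k\<close> quadruplings give
  the base, and a double loop gives the length.\<close>

definition params_prog :: com where
  "params_prog = Seq (assign ''B'' (Const 8))
     (Seq (For ''i'' (var ''k'') (assign ''B'' (Add (Add (var ''B'') (var ''B'')) (Add (var ''B'') (var ''B'')))))
     (Seq (assign ''L'' (Const 0))
     (For ''i'' (Add (var ''k'') (Const 1)) (For ''j'' (Add (var ''k'') (Const 1))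
        (assign ''L'' (Add (var ''L'') (Const 8)))))))"

lemma writes_params_prog [simp]: "writes params_prog = {''i'', ''j'', ''B'', ''L''}"
  by (auto simp: params_prog_def)

text \<open>A common bound for all entries of an advice: block and table indices, \<open>q\<close>
  and \<open>r\<close>. It is a power of two that quadruplings produce.\<close>

definition base :: "nat \<Rightarrow> nat" where
  "base k = 8 * 4 ^ k"

text \<open>Four entries for each of at most \<open>(k + 1) * (2 * k + 1)\<close> decisions, rounded
  up.\<close>

definition advice_length :: "nat \<Rightarrow> nat" where
  "advice_length k = 8 * ((k + 1) * (k + 1))"

lemma run_params_prog:
  assumes k: "\<sigma> ''k'' 0 = int k"
  shows "run params_prog ((k + 2)\<^sup>2 * 200) \<sigma> (\<lambda>\<tau>. \<tau> ''B'' 0 = int (base k) \<and> \<tau> ''L'' 0 = int (advice_length k))"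
proof -
  let ?quad = "assign ''B'' (Add (Add (var ''B'') (var ''B'')) (Add (var ''B'') (var ''B'')))"
  let ?add = "assign ''L'' (Add (var ''L'') (Const 8))"
  let ?row = "For ''j'' (Add (var ''k'') (Const 1)) ?add"
  let ?TB = "(k + 1) * 50" and ?TL = "(k + 2) * (17 + (k + 2) * 40)"
  have powers: "run (For ''i'' (var ''k'') ?quad) ?TB \<tau> (\<lambda>\<tau>'. \<tau>' ''B'' 0 = int (base k))"
    if "\<tau> ''k'' 0 = int k" "\<tau> ''B'' 0 = 8" for \<tau>
  proof (rule run_For[where N = k and t = 20 and Inv = "\<lambda>i \<tau>'. \<tau>' ''B'' 0 = int (base i)"])
    show "run ?quad 20 \<tau>' (\<lambda>\<tau>'. \<tau>' ''B'' 0 = int (base (Suc i)))" if "\<tau>' ''B'' 0 = int (base i)" for i \<tau>'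
      using that by (intro run_sem) (simp_all add: base_def)
  next
    fix \<tau>'
    assume fr: "\<And>u. u \<notin> insert ''i'' (writes ?quad) \<Longrightarrow> \<tau>' u = \<tau> u"
    show "aval (var ''k'') \<tau>' = int k"
      using fr[of "''k''"] that by simp
  qed (use that in \<open>simp_all add: base_def\<close>)
  have row: "run ?row ((k + 2) * 40) \<tau> (\<lambda>\<tau>'. \<tau>' ''L'' 0 = int (8 * (Suc i * (k + 1))))"
    if "\<tau> ''k'' 0 = int k" "\<tau> ''L'' 0 = int (8 * (i * (k + 1)))" for i \<tau>
  proof (rule run_For[where N = "k + 1" and t = 10 and Inv = "\<lambda>j \<tau>'. \<tau>' ''L'' 0 = int (8 * (i * (k + 1) + j))"])
    show "run ?add 10 \<tau>' (\<lambda>\<tau>'. \<tau>' ''L'' 0 = int (8 * (i * (k + 1) + Suc j)))"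
      if "\<tau>' ''L'' 0 = int (8 * (i * (k + 1) + j))" for j \<tau>'
      using that by (intro run_sem) (simp_all add: algebra_simps)
  next
    fix \<tau>'
    assume fr: "\<And>u. u \<notin> insert ''j'' (writes ?add) \<Longrightarrow> \<tau>' u = \<tau> u"
    show "aval (Add (var ''k'') (Const 1)) \<tau>' = int (k + 1)"
      using fr[of "''k''"] that by simp
  qed (use that in \<open>simp_all add: algebra_simps\<close>)
  have square: "run (For ''i'' (Add (var ''k'') (Const 1)) ?row) ?TL \<tau> (\<lambda>\<tau>'. \<tau>' ''L'' 0 = int (advice_length k))"
    if "\<tau> ''k'' 0 = int k" "\<tau> ''L'' 0 = 0" for \<tau>
  proof (rule run_For[where N = "k + 1" and t = "(k + 2) * 40" and Inv = "\<lambda>i \<tau>'. \<tau>' ''L'' 0 = int (8 * (i * (k + 1)))"])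
    fix i \<tau>'
    assume i: "\<tau>' ''L'' 0 = int (8 * (i * (k + 1)))"
      and fr: "\<And>u. u \<notin> insert ''i'' (writes ?row) \<Longrightarrow> \<tau>' u = \<tau> u"
    show "run ?row ((k + 2) * 40) \<tau>' (\<lambda>\<tau>'. \<tau>' ''L'' 0 = int (8 * (Suc i * (k + 1))))"
      using fr[of "''k''"] that by (intro row i) simp
  next
    fix \<tau>'
    assume fr: "\<And>u. u \<notin> insert ''i'' (writes ?row) \<Longrightarrow> \<tau>' u = \<tau> u"
    show "aval (Add (var ''k'') (Const 1)) \<tau>' = int (k + 1)"
      using fr[of "''k''"] that by simp
  qed (use that in \<open>simp_all add: advice_length_def\<close>)
  have "run params_prog (3 + (?TB + (3 + ?TL))) \<sigma>
    (\<lambda>\<tau>. \<tau> ''B'' 0 = int (base k) \<and> \<tau> ''L'' 0 = int (advice_length k))"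
  proof -
    have "run (For ''i'' (var ''k'') ?quad) ?TB (sem (assign ''B'' (Const 8)) \<sigma>)
      (\<lambda>\<tau>. run (Seq (assign ''L'' (Const 0)) (For ''i'' (Add (var ''k'') (Const 1)) ?row)) (3 + ?TL) \<tau>
        (\<lambda>\<tau>. \<tau> ''B'' 0 = int (base k) \<and> \<tau> ''L'' 0 = int (advice_length k)))"
    proof (rule run_mono[OF powers])
      fix \<tau>
      assume B: "\<tau> ''B'' 0 = int (base k)"
        and fr: "\<And>v. v \<notin> writes (For ''i'' (var ''k'') ?quad) \<Longrightarrow> \<tau> v = sem (assign ''B'' (Const 8)) \<sigma> v"
      let ?\<tau> = "sem (assign ''L'' (Const 0)) \<tau>"
      have "run (For ''i'' (Add (var ''k'') (Const 1)) ?row) ?TL ?\<tau>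
        (\<lambda>\<tau>. \<tau> ''B'' 0 = int (base k) \<and> \<tau> ''L'' 0 = int (advice_length k))"
        by (rule run_mono[OF square]) (use B k fr[of "''k''"] in simp_all)
      then show "run (Seq (assign ''L'' (Const 0)) (For ''i'' (Add (var ''k'') (Const 1)) ?row)) (3 + ?TL) \<tau>
        (\<lambda>\<tau>. \<tau> ''B'' 0 = int (base k) \<and> \<tau> ''L'' 0 = int (advice_length k))"
        by (intro run_sem_Seq) simp_all
    qed (use k in simp_all)
    then show ?thesis
      unfolding params_prog_def by (intro run_sem_Seq[OF _ _ run_Seq]) simp_all
  qed
  then show ?thesis
    by (rule run_mono) (simp_all add: power2_eq_square algebra_simps)
qed

section \<open>Enumerating the advice\<close>

definition attempt_prog :: com where
  "attempt_prog = Seq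
     (Seq (assign ''pos'' (Const 0)) (Seq (assign ''ptr'' (Const 0)) (Seq (assign ''cnt'' (Const 0))
       (Seq (assign ''dn'' (Const 1)) (Write ''tab'' (Const 0) (Const 0))))))
     (Seq (While (Conj (Less (var ''pos'') (var ''n'')) (Less (var ''ptr'') (var ''L''))) step_prog)
     (Cond (Less (var ''pos'') (var ''n'')) Skip (assign ''out'' (Const 1))))"

text \<open>An odometer: \<open>G\<close> holds the digits of a number in base \<open>B\<close>, the
  least significant first, and overflow clears \<open>go\<close>.\<close>

definition next_prog :: com where
  "next_prog = Seq (assign ''i'' (Const 0))
     (Seq (While (Conj (Less (var ''i'') (var ''L'')) (Equal (Read ''G'' (var ''i'')) (Sub (var ''B'') (Const 1))))
        (Seq (Write ''G'' (var ''i'') (Const 0)) (assign ''i'' (Add (var ''i'') (Const 1)))))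
     (Cond (Less (var ''i'') (var ''L'')) (Write ''G'' (var ''i'') (Add (Read ''G'' (var ''i'')) (Const 1)))
        (assign ''go'' (Const 0))))"

definition XCAP_prog :: com where
  "XCAP_prog = Cond (Conj (Leq (Const 0) (var ''k'')) (Leq (var ''k'') (var ''n'')))
     (Seq sort_prog (Seq params_prog (Seq (assign ''go'' (Const 1))
        (While (Less (Const 0) (var ''go'')) (Seq attempt_prog next_prog))))) Skip"

lemma writes_step_prog:
  "''L'' \<notin> writes step_prog" "''n'' \<notin> writes step_prog" "''k'' \<notin> writes step_prog" "''Y'' \<notin> writes step_prog"
  "''G'' \<notin> writes step_prog" "''B'' \<notin> writes step_prog" "''go'' \<notin> writes step_prog" "''out'' \<notin> writes step_prog"
  by (simp_all add: step_prog_def act_prog_def)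

lemma writes_attempt_prog:
  "''L'' \<notin> writes attempt_prog" "''n'' \<notin> writes attempt_prog" "''k'' \<notin> writes attempt_prog" "''Y'' \<notin> writes attempt_prog"
  "''G'' \<notin> writes attempt_prog" "''B'' \<notin> writes attempt_prog" "''go'' \<notin> writes attempt_prog"
  by (simp_all add: attempt_prog_def writes_step_prog)

text \<open>The remaining fields are left open because the arrays still contain the leftovers of the
  preceding attempts.\<close>

definition winning :: "int list \<Rightarrow> nat \<Rightarrow> nat \<Rightarrow> (nat \<Rightarrow> nat) \<Rightarrow> bool" where
  "winning ys k L G \<longleftrightarrow> (\<forall>st. pos st = 0 \<longrightarrow> ptr st = 0 \<longrightarrow> cnt st = 0 \<longrightarrow> dn st = 1 \<longrightarrow> tab st 0 = 0 \<longrightarrow>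
     wins ys k L G st)"

text \<open>Fewer than \<open>n + 1\<close> forced steps fit between decisions, and each decision
  raises \<open>ptr\<close>; this gives at most \<open>L * (n + 1) + n\<close> rounds.\<close>

definition attempt_time :: "nat \<Rightarrow> nat \<Rightarrow> nat \<Rightarrow> nat" where
  "attempt_time n L B = 30 + ((L * (n + 1) + n + 1) * (12 + (n + 1)\<^sup>2 * (B + 1) * 600) + 20)"

text \<open>Success \<open>b\<close> is only enclosed between two conditions, since an advice may
  succeed from some leftovers without being winning for all of them. Soundness and completeness need
  one implication each.\<close>

lemma run_attempt_prog:
  assumes pre: "prepared ys k G \<sigma>" "\<sigma> ''L'' 0 = int L" and "\<And>i. G i \<le> B" "k \<le> length ys"
    and sorted: "sorted_wrt (<) ys"
  shows "run attempt_prog (attempt_time (length ys) L B) \<sigma> (\<lambda>\<tau>. \<exists>b. \<tau> ''out'' 0 = (if b then 1 else \<sigma> ''out'' 0) \<and>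
    (b \<longrightarrow> (\<exists>c\<le>k. AP_partition (set ys) c)) \<and> (winning ys k L G \<longrightarrow> b))"
proof -
  let ?n = "length ys"
  let ?init = "Seq (assign ''pos'' (Const 0)) (Seq (assign ''ptr'' (Const 0)) (Seq (assign ''cnt'' (Const 0))
       (Seq (assign ''dn'' (Const 1)) (Write ''tab'' (Const 0) (Const 0)))))"
  let ?guard = "Conj (Less (var ''pos'') (var ''n'')) (Less (var ''ptr'') (var ''L''))"
  let ?final = "Cond (Less (var ''pos'') (var ''n'')) Skip (assign ''out'' (Const 1))"
  let ?Q = "\<lambda>\<tau>. \<exists>b. \<tau> ''out'' 0 = (if b then 1 else \<sigma> ''out'' 0) \<and>
    (b \<longrightarrow> (\<exists>c\<le>k. AP_partition (set ys) c)) \<and> (winning ys k L G \<longrightarrow> b)"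
  define Inv where "Inv m \<tau> \<longleftrightarrow> (\<exists>st. represents st \<tau> \<and> (\<exists>f. blocks ys k st f) \<and>
      (winning ys k L G \<longrightarrow> wins ys k L G st) \<and> m = (L - ptr st) * (?n + 1) + (?n - pos st)) \<and>
    (\<forall>v\<in>{''L'', ''n'', ''k'', ''Y'', ''G'', ''out''}. \<tau> v = \<sigma> v)" for m \<tau>
  have prepared: "prepared ys k G \<tau>" if "\<forall>v\<in>{''L'', ''n'', ''k'', ''Y'', ''G'', ''out''}. \<tau> v = \<sigma> v" for \<tau>
    using pre(1) that by (simp add: prepared_def)
  define \<rho> where "\<rho> = sem ?init \<sigma>"
  define st0 where "st0 = \<lparr>pos = 0, ptr = 0, cnt = 0, dn = 1, bs = (\<lambda>i. \<rho> ''bs'' (int i)),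
    df = (\<lambda>i. \<rho> ''df'' (int i)), nx = (\<lambda>i. \<rho> ''nx'' (int i)), tab = (\<lambda>i. \<rho> ''tab'' (int i))\<rparr>"
  have "Inv (L * (?n + 1) + ?n) \<rho>"
    unfolding Inv_def
  proof (intro conjI exI[of _ st0])
    show "represents st0 \<rho>"
      by (simp add: represents_def st0_def \<rho>_def)
    show "\<exists>f. blocks ys k st0 f"
      using blocks_initial[of st0] by (simp add: st0_def)
    have "tab st0 0 = 0"
      by (simp add: st0_def \<rho>_def)
    then show "winning ys k L G \<longrightarrow> wins ys k L G st0"
      unfolding winning_def by (simp add: st0_def)
  qed (simp_all add: st0_def \<rho>_def)
  then have loop: "run (While ?guard step_prog)
      ((L * (?n + 1) + ?n + 1) * (bcost ?guard + 1 + (?n + 1)\<^sup>2 * (B + 1) * 600)) \<rho>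
      (\<lambda>\<tau>. run ?final 20 \<tau> ?Q)"
  proof (rule run_While[where Inv = Inv and m = "L * (?n + 1) + ?n"])
    fix m \<tau>
    assume "Inv m \<tau>" and guard: "bval ?guard \<tau>"
    then obtain st f where st: "represents st \<tau>" "blocks ys k st f"
      "winning ys k L G \<longrightarrow> wins ys k L G st" "m = (L - ptr st) * (?n + 1) + (?n - pos st)"
      and fr: "\<forall>v\<in>{''L'', ''n'', ''k'', ''Y'', ''G'', ''out''}. \<tau> v = \<sigma> v"
      unfolding Inv_def by blast
    have lt: "pos st < ?n" "ptr st < L"
      using guard st(1) fr pre by (simp_all add: represents_def prepared_def)
    have "cnt st \<le> ?n"
      using st(2) assms(4) by (simp add: blocks_def)
    note step = run_step_prog[OF st(1) prepared[OF fr] lt(1) this assms(3)]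
    let ?st = "step ys k G st"
    have "winning ys k L G \<longrightarrow> wins ys k L G ?st"
      using st(3) lt by (auto elim: wins.cases)
    moreover have "\<exists>f. blocks ys k ?st f"
      using blocks_step[OF sorted _ lt(1)] st(2) by blast
    \<comment> \<open>A decision may throw \<open>pos\<close> back to 0, which costs at most
      \<open>?n\<close>, but the increase of \<open>ptr\<close> is worth
      \<open>?n + 1\<close>.\<close>
    moreover have "(L - ptr ?st) * (?n + 1) + (?n - pos ?st) < m"
    proof (cases "card (expecting ys st) = 1")
      case True
      then show ?thesis
        using st(4) lt by (simp add: step_def advance_def)
    next
      case False
      then have "ptr ?st = ptr st + 4"
        by (simp add: step_def act_def advance_def open_block_def learn_def Let_def)
      then have "(L - ptr ?st + 1) * (?n + 1) \<le> (L - ptr st) * (?n + 1)"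
        using lt(2) by (intro mult_right_mono) auto
      then have "(L - ptr ?st) * (?n + 1) + (?n + 1) \<le> (L - ptr st) * (?n + 1)"
        by (simp only: add_mult_distrib mult_1)
      then show ?thesis
        using st(4) lt(1) by linarith
    qed
    ultimately show "run step_prog ((?n + 1)\<^sup>2 * (B + 1) * 600) \<tau> (\<lambda>\<tau>'. \<exists>m'<m. Inv m' \<tau>')"
    proof (intro run_mono[OF step])
      fix \<tau>'
      assume st': "represents ?st \<tau>'" and fr': "\<And>v. v \<notin> writes step_prog \<Longrightarrow> \<tau>' v = \<tau> v"
        and "winning ys k L G \<longrightarrow> wins ys k L G ?st" "\<exists>f. blocks ys k ?st f"
          "(L - ptr ?st) * (?n + 1) + (?n - pos ?st) < m"
      moreover have "\<forall>v\<in>{''L'', ''n'', ''k'', ''Y'', ''G'', ''out''}. \<tau>' v = \<sigma> v"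
        using fr'[OF writes_step_prog(1)] fr'[OF writes_step_prog(2)] fr'[OF writes_step_prog(3)]
          fr'[OF writes_step_prog(4)] fr'[OF writes_step_prog(5)] fr'[OF writes_step_prog(8)] fr by simp
      ultimately show "\<exists>m'<m. Inv m' \<tau>'"
        unfolding Inv_def by blast
    qed simp
  next
    fix m \<tau>
    assume "Inv m \<tau>" and guard: "\<not> bval ?guard \<tau>"
    then obtain st f where st: "represents st \<tau>" "blocks ys k st f" "winning ys k L G \<longrightarrow> wins ys k L G st"
      and fr: "\<forall>v\<in>{''L'', ''n'', ''k'', ''Y'', ''G'', ''out''}. \<tau> v = \<sigma> v"
      unfolding Inv_def by blast
    define b where "b \<longleftrightarrow> pos st = ?n"
    have le: "pos st \<le> ?n"
      using st(2) by (simp add: blocks_def)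
    have vals: "\<tau> ''pos'' 0 = int (pos st)" "\<tau> ''n'' 0 = int ?n" "\<tau> ''ptr'' 0 = int (ptr st)" "\<tau> ''L'' 0 = int L"
      "\<tau> ''out'' 0 = \<sigma> ''out'' 0"
      using st(1) fr pre by (simp_all add: represents_def prepared_def)
    have "winning ys k L G \<longrightarrow> b"
      using st(3) guard vals by (auto simp: b_def elim: wins.cases)
    moreover have "b \<longrightarrow> (\<exists>c\<le>k. AP_partition (set ys) c)"
      using blocks_finished[OF st(2)] by (simp add: b_def)
    moreover have "sem ?final \<tau> ''out'' 0 = (if b then 1 else \<sigma> ''out'' 0)"
      using vals le by (auto simp: b_def)
    ultimately show "run ?final 20 \<tau> ?Q"
      by (intro run_sem) (simp, simp, blast)
  qed
  have "run attempt_prog (30 + ((L * (?n + 1) + ?n + 1) * (bcost ?guard + 1 + (?n + 1)\<^sup>2 * (B + 1) * 600) + 20)) \<sigma> ?Q"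
    unfolding attempt_prog_def
    by (rule run_sem_Seq[OF _ _ run_Seq[OF loop[unfolded \<rho>_def]]]) simp_all
  moreover have "bcost ?guard + 1 = 12"
    by simp
  ultimately show ?thesis
    unfolding attempt_time_def by metis
qed

section \<open>Advice strings as numbers in base \<open>B\<close>\<close>

definition val :: "nat \<Rightarrow> nat \<Rightarrow> (nat \<Rightarrow> nat) \<Rightarrow> nat" where
  "val B L G = (\<Sum>i<L. G i * B ^ i)"

lemma val_less:
  assumes "\<And>i. i < L \<Longrightarrow> G i < B"
  shows "val B L G < B ^ L"
  using assms
proof (induction L)
  case (Suc L)
  have "val B (Suc L) G = val B L G + G L * B ^ L"
    by (simp add: val_def)
  also have "\<dots> < B ^ L + G L * B ^ L"
    using Suc by simp
  also have "\<dots> = (G L + 1) * B ^ L"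
    by simp
  also have "\<dots> \<le> B * B ^ L"
    using Suc.prems[of L] by (intro mult_right_mono) auto
  finally show ?case
    by simp
qed (simp add: val_def)

lemma val_inject:
  assumes "\<And>i. i < L \<Longrightarrow> G i < B" "\<And>i. i < L \<Longrightarrow> G' i < B" "val B L G = val B L G'" "i < L"
  shows "G i = G' i"
  using assms
proof (induction L)
  case (Suc L)
  have eq: "val B L G + G L * B ^ L = val B L G' + G' L * B ^ L"
    using Suc.prems(3) by (simp add: val_def)
  have lt: "val B L G < B ^ L" "val B L G' < B ^ L"
    using val_less Suc.prems(1,2) by simp_all
  have "(x + c * b) div b = c" if "x < b" for x c b :: nat
    using that by simp
  then have top: "G L = G' L"
    using eq lt by metis
  then have "val B L G = val B L G'"
    using eq by simp
  then show ?case
    using Suc.IH Suc.prems(1,2,4) top by (cases "i = L") auto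
qed simp

lemma val_update:
  assumes "i < L"
  shows "val B L (G(i := c)) + G i * B ^ i = val B L G + c * B ^ i"
proof -
  have "val B L G = G i * B ^ i + (\<Sum>j\<in>{..<L} - {i}. G j * B ^ j)" for G
    unfolding val_def using assms by (subst sum.remove[of _ i]) auto
  note split = this[of G] this[of "G(i := c)"]
  have "(\<Sum>j\<in>{..<L} - {i}. (G(i := c)) j * B ^ j) = (\<Sum>j\<in>{..<L} - {i}. G j * B ^ j)"
    by (intro sum.cong) auto
  then show ?thesis
    unfolding split by simp
qed

lemma run_next_prog:
  assumes "\<sigma> ''B'' 0 = int B" "\<sigma> ''L'' 0 = int L" "\<And>i. \<sigma> ''G'' (int i) = int (G i)" "\<And>i. G i < B"
  shows "run next_prog ((L + 1) * 50 + 40) \<sigma> (\<lambda>\<tau>.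
    (\<exists>G'. (\<forall>i. \<tau> ''G'' (int i) = int (G' i) \<and> G' i < B) \<and> val B L G' = val B L G + 1 \<and> \<tau> ''go'' = \<sigma> ''go'') \<or>
    (val B L G + 1 \<ge> B ^ L \<and> \<tau> ''go'' 0 = 0))"
proof -
  let ?Q = "\<lambda>\<tau>. (\<exists>G'. (\<forall>i. \<tau> ''G'' (int i) = int (G' i) \<and> G' i < B) \<and> val B L G' = val B L G + 1 \<and> \<tau> ''go'' = \<sigma> ''go'') \<or>
    (val B L G + 1 \<ge> B ^ L \<and> \<tau> ''go'' 0 = 0)"
  let ?guard = "Conj (Less (var ''i'') (var ''L'')) (Equal (Read ''G'' (var ''i'')) (Sub (var ''B'') (Const 1)))"
  let ?body = "Seq (Write ''G'' (var ''i'') (Const 0)) (assign ''i'' (Add (var ''i'') (Const 1)))"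
  let ?final = "Cond (Less (var ''i'') (var ''L'')) (Write ''G'' (var ''i'') (Add (Read ''G'' (var ''i'')) (Const 1)))
        (assign ''go'' (Const 0))"
  \<comment> \<open>\<open>B ^ i\<close> is the carry pending at digit \<open>i\<close>; at the
    start it is the 1 to be added.\<close>
  define Inv where "Inv m \<tau> \<longleftrightarrow> (\<exists>i G'. \<tau> ''i'' 0 = int i \<and> m + i = L \<and>
    (\<forall>i. \<tau> ''G'' (int i) = int (G' i) \<and> G' i < B) \<and> val B L G' + B ^ i = val B L G + 1 \<and>
    \<tau> ''go'' = \<sigma> ''go'' \<and> \<tau> ''B'' = \<sigma> ''B'' \<and> \<tau> ''L'' = \<sigma> ''L'')" for m \<tau>
  let ?\<rho> = "sem (assign ''i'' (Const 0)) \<sigma>"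
  have "Inv L ?\<rho>"
    unfolding Inv_def using assms by (intro exI[of _ 0] exI[of _ G]) simp
  then have loop: "run (While ?guard ?body) ((L + 1) * (bcost ?guard + 1 + 20)) ?\<rho> (\<lambda>\<tau>. run ?final 30 \<tau> ?Q)"
  proof (rule run_While[where Inv = Inv and m = L])
    fix m \<tau>
    assume "Inv m \<tau>" and guard: "bval ?guard \<tau>"
    then obtain i G' where i: "\<tau> ''i'' 0 = int i" "m + i = L" "\<And>i. \<tau> ''G'' (int i) = int (G' i)" "\<And>i. G' i < B"
      "val B L G' + B ^ i = val B L G + 1" "\<tau> ''go'' = \<sigma> ''go''" "\<tau> ''B'' = \<sigma> ''B''" "\<tau> ''L'' = \<sigma> ''L''"
      unfolding Inv_def by blast
    have "i < L" and Gi: "int (G' i) = int B - 1"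
      using guard i assms(1,2) by auto
    then have "B = G' i + 1"
      by linarith
    then have "B ^ Suc i = G' i * B ^ i + B ^ i"
      by simp
    moreover have "val B L (G'(i := 0)) + G' i * B ^ i = val B L G'"
      using val_update[OF \<open>i < L\<close>, of B G' 0] by simp
    ultimately have "val B L (G'(i := 0)) + B ^ Suc i = val B L G + 1"
      using i(5) by simp
    moreover have "0 < B"
      using i(4)[of 0] by simp
    ultimately have "Inv (m - 1) (sem ?body \<tau>)"
      unfolding Inv_def using i \<open>i < L\<close>
      by (intro exI[of _ "Suc i"] exI[of _ "G'(i := 0)"]) (auto simp del: power_Suc)
    moreover have "m - 1 < m"
      using i(2) \<open>i < L\<close> by simp
    ultimately show "run ?body 20 \<tau> (\<lambda>\<tau>'. \<exists>m'<m. Inv m' \<tau>')"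
      by (intro run_sem) (simp, simp, blast)
  next
    fix m \<tau>
    assume "Inv m \<tau>" and guard: "\<not> bval ?guard \<tau>"
    then obtain i G' where i: "\<tau> ''i'' 0 = int i" "m + i = L" "\<And>i. \<tau> ''G'' (int i) = int (G' i)" "\<And>i. G' i < B"
      "val B L G' + B ^ i = val B L G + 1" "\<tau> ''go'' = \<sigma> ''go''" "\<tau> ''B'' = \<sigma> ''B''" "\<tau> ''L'' = \<sigma> ''L''"
      unfolding Inv_def by blast
    have "?Q (sem ?final \<tau>)"
    proof (cases "i < L")
      case True
      then have "G' i + 1 < B"
        using guard i assms(1,2) i(4)[of i] by auto
      moreover have "val B L (G'(i := G' i + 1)) = val B L G' + B ^ i"
        using val_update[OF True, of B G' "G' i + 1"] by simp
      ultimately show ?thesis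
        using i assms(2) True by (intro disjI1 exI[of _ "G'(i := G' i + 1)"]) auto
    next
      case False
      then show ?thesis
        using i assms(2) by (intro disjI2) auto
    qed
    then show "run ?final 30 \<tau> ?Q"
      by (intro run_sem) (simp, simp, blast)
  qed
  have "run next_prog (3 + ((L + 1) * (bcost ?guard + 1 + 20) + 30)) \<sigma> ?Q"
    unfolding next_prog_def
    by (rule run_sem_Seq[OF _ _ run_Seq[OF loop]]) simp_all
  then show ?thesis
    by (rule run_mono) simp_all
qed

section \<open>Correctness and running time\<close>

lemma run_main_loop:
  assumes pre: "prepared ys k (\<lambda>_. 0) \<sigma>" "\<sigma> ''L'' 0 = int L" "\<sigma> ''B'' 0 = int B" "\<sigma> ''go'' 0 = 1" "\<sigma> ''out'' 0 = 0"
    and "k \<le> length ys" "sorted_wrt (<) ys" "B > 0"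
    and advice: "\<And>c. c \<le> k \<Longrightarrow> AP_partition (set ys) c \<Longrightarrow>
      \<exists>g. (\<forall>i. g i < B) \<and> (\<forall>G. (\<forall>i<L. G i = g i) \<longrightarrow> winning ys k L G)"
  shows "run (While (Less (Const 0) (var ''go'')) (Seq attempt_prog next_prog))
    ((B ^ L + 1) * (5 + (attempt_time (length ys) L B + ((L + 1) * 50 + 40)))) \<sigma>
    (\<lambda>\<tau>. \<tau> ''out'' 0 = answer (\<exists>c\<le>k. AP_partition (set ys) c))"
proof -
  let ?yes = "\<exists>c\<le>k. AP_partition (set ys) c"
  define fixed where "fixed \<tau> \<longleftrightarrow> (\<forall>v\<in>{''L'', ''B'', ''n'', ''k'', ''Y''}. \<tau> v = \<sigma> v)" for \<tau> :: store
  define good where "good g \<longleftrightarrow> (\<forall>i. g i < B) \<and> (\<forall>G. (\<forall>i<L. G i = g i) \<longrightarrow> winning ys k L G)" for g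
  \<comment> \<open>Here \<open>m\<close> is the number of strings left to try: a good advice of
    value below \<open>B ^ L - m\<close> has had its turn. Goodness depends on the first
    \<open>L\<close> digits, which the value determines by \<open>val_inject\<close>.\<close>
  define tried where "tried m \<tau> \<longleftrightarrow> (\<tau> ''out'' 0 = 0 \<or> \<tau> ''out'' 0 = 1 \<and> ?yes) \<and>
      (\<forall>g. good g \<longrightarrow> val B L g + m < B ^ L \<longrightarrow> \<tau> ''out'' 0 = 1)" for m and \<tau> :: store
  define Inv where "Inv m \<tau> \<longleftrightarrow> fixed \<tau> \<and> tried m \<tau> \<and> (if m = 0 then \<tau> ''go'' 0 = 0 else \<tau> ''go'' 0 = 1 \<and>
      (\<exists>G. (\<forall>i. \<tau> ''G'' (int i) = int (G i) \<and> G i < B) \<and> val B L G + m = B ^ L))" for m \<tau>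
  have "bcost (Less (Const 0) (var ''go'')) + 1 = 5"
    by simp
  moreover have "run (While (Less (Const 0) (var ''go'')) (Seq attempt_prog next_prog))
    ((B ^ L + 1) * (bcost (Less (Const 0) (var ''go'')) + 1 + (attempt_time (length ys) L B + ((L + 1) * 50 + 40)))) \<sigma>
    (\<lambda>\<tau>. \<tau> ''out'' 0 = answer ?yes)"
  proof (rule run_While[where Inv = Inv and m = "B ^ L"])
    show "Inv (B ^ L) \<sigma>"
      unfolding Inv_def fixed_def tried_def using assms
      by (auto simp: val_def prepared_def intro!: exI[of _ "\<lambda>_. 0"])
  next
    fix m \<tau>
    assume inv: "Inv m \<tau>" and "bval (Less (Const 0) (var ''go'')) \<tau>"
    then have "m > 0" and go: "\<tau> ''go'' 0 = 1"
      by (auto simp: Inv_def split: if_splits)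
    then obtain G where G: "\<And>i. \<tau> ''G'' (int i) = int (G i)" "\<And>i. G i < B" "val B L G + m = B ^ L"
      and fx: "fixed \<tau>" and tr: "tried m \<tau>"
      using inv unfolding Inv_def by auto
    have "prepared ys k G \<tau>" "\<tau> ''L'' 0 = int L" "\<tau> ''B'' 0 = int B"
      using pre fx G(1) by (simp_all add: fixed_def prepared_def)
    note attempt = run_attempt_prog[OF this(1,2) less_imp_le[OF G(2)] assms(6,7)]
    have "run attempt_prog (attempt_time (length ys) L B) \<tau>
      (\<lambda>\<tau>'. run next_prog ((L + 1) * 50 + 40) \<tau>' (\<lambda>\<tau>'. \<exists>m'<m. Inv m' \<tau>'))"
    proof (rule run_mono[OF attempt])
      fix \<tau>'
      assume "\<exists>b. \<tau>' ''out'' 0 = (if b then 1 else \<tau> ''out'' 0) \<and> (b \<longrightarrow> ?yes) \<and> (winning ys k L G \<longrightarrow> b)"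
        and fr: "\<And>v. v \<notin> writes attempt_prog \<Longrightarrow> \<tau>' v = \<tau> v"
      then obtain b where b: "\<tau>' ''out'' 0 = (if b then 1 else \<tau> ''out'' 0)" "b \<longrightarrow> ?yes" "winning ys k L G \<longrightarrow> b"
        by blast
      note fr = writes_attempt_prog[THEN fr]
      have fx': "fixed \<tau>'"
        using fx by (simp add: fixed_def fr)
      have tr': "tried (m - 1) \<tau>'"
        unfolding tried_def
      proof (intro conjI allI impI)
        show "\<tau>' ''out'' 0 = 0 \<or> \<tau>' ''out'' 0 = 1 \<and> ?yes"
          using tr b(1,2) unfolding tried_def by auto
        fix g assume g: "good g" "val B L g + (m - 1) < B ^ L"
        show "\<tau>' ''out'' 0 = 1"
        proof (cases "val B L g + m < B ^ L")
          case True
          then show ?thesis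
            using tr g(1) b(1) unfolding tried_def by auto
        next
          case False
          then have "val B L G = val B L g"
            using g(2) G(3) \<open>m > 0\<close> by linarith
          then have "\<forall>i<L. G i = g i"
            using val_inject[of L G B g] G(2) g(1) unfolding good_def by blast
          then show ?thesis
            using g(1) b(1,3) unfolding good_def by auto
        qed
      qed
      have "run next_prog ((L + 1) * 50 + 40) \<tau>' (\<lambda>\<tau>'.
          (\<exists>G'. (\<forall>i. \<tau>' ''G'' (int i) = int (G' i) \<and> G' i < B) \<and> val B L G' = val B L G + 1 \<and> \<tau>' ''go'' = \<tau> ''go'') \<or>
          (val B L G + 1 \<ge> B ^ L \<and> \<tau>' ''go'' 0 = 0))"
        using run_next_prog[of \<tau>' B L G] fx' pre G(1,2) fr by (simp add: fixed_def)
      then show "run next_prog ((L + 1) * 50 + 40) \<tau>' (\<lambda>\<tau>'. \<exists>m'<m. Inv m' \<tau>')"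
      proof (rule run_mono)
        fix \<rho>
        assume step: "(\<exists>G'. (\<forall>i. \<rho> ''G'' (int i) = int (G' i) \<and> G' i < B) \<and> val B L G' = val B L G + 1 \<and> \<rho> ''go'' = \<tau> ''go'') \<or>
          (val B L G + 1 \<ge> B ^ L \<and> \<rho> ''go'' 0 = 0)"
          and fr': "\<And>v. v \<notin> writes next_prog \<Longrightarrow> \<rho> v = \<tau>' v"
        have fx'': "fixed \<rho>" and tr'': "tried (m - 1) \<rho>"
          using fx' tr' by (simp_all add: fixed_def tried_def fr' next_prog_def)
        have "Inv (m - 1) \<rho>"
          using step
        proof
          assume "\<exists>G'. (\<forall>i. \<rho> ''G'' (int i) = int (G' i) \<and> G' i < B) \<and> val B L G' = val B L G + 1 \<and> \<rho> ''go'' = \<tau> ''go''"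
          then obtain G' where G': "\<forall>i. \<rho> ''G'' (int i) = int (G' i) \<and> G' i < B" "val B L G' = val B L G + 1" "\<rho> ''go'' = \<tau> ''go''"
            by blast
          have "val B L G' < B ^ L"
            using G'(1) by (intro val_less) blast
          then have "m - 1 \<noteq> 0" "val B L G' + (m - 1) = B ^ L"
            using G'(2) G(3) \<open>m > 0\<close> by linarith+
          then show ?thesis
            unfolding Inv_def using fx'' tr'' G' go by auto
        next
          assume last: "val B L G + 1 \<ge> B ^ L \<and> \<rho> ''go'' 0 = 0"
          then have "m - 1 = 0"
            using G(3) by linarith
          then show ?thesis
            unfolding Inv_def using fx'' tr'' last by simp
        qed
        then show "\<exists>m'<m. Inv m' \<rho>"
          using \<open>m > 0\<close> by (intro exI[of _ "m - 1"]) simp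
      qed simp
    qed simp
    then show "run (Seq attempt_prog next_prog) (attempt_time (length ys) L B + ((L + 1) * 50 + 40)) \<tau> (\<lambda>\<tau>'. \<exists>m'<m. Inv m' \<tau>')"
      by (rule run_Seq)
  next
    fix m \<tau>
    assume inv: "Inv m \<tau>" and "\<not> bval (Less (Const 0) (var ''go'')) \<tau>"
    then have "m = 0"
      by (auto simp: Inv_def split: if_splits)
    then have tr: "tried 0 \<tau>"
      using inv by (simp add: Inv_def)
    have "\<tau> ''out'' 0 = 1" if yes: ?yes
    proof -
      obtain g where g: "good g"
        using advice yes unfolding good_def by metis
      then have "val B L g < B ^ L"
        unfolding good_def by (intro val_less) blast
      then show ?thesis
        using tr g by (simp add: tried_def)
    qed
    then show "\<tau> ''out'' 0 = answer ?yes"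
      using tr unfolding tried_def answer_def by auto
  qed
  ultimately show ?thesis
    by simp
qed

lemma base_bounds: "2 * k + 1 < base k" "k * (2 * k + 2) + 1 < base k" "2 ^ k < base k"
proof -
  have sq: "k * k \<le> 4 ^ k"
  proof -
    have "k \<le> 2 ^ k"
      using less_exp[of k] by simp
    then have "k * k \<le> 2 ^ k * 2 ^ k"
      by (rule mult_le_mono) (rule \<open>k \<le> 2 ^ k\<close>)
    then show ?thesis
      by (simp flip: power_mult_distrib)
  qed
  have "(2::nat) ^ k \<le> 4 ^ k"
    by (rule power_mono) simp_all
  moreover have "k < 2 ^ k"
    by (rule less_exp)
  moreover have "(1::nat) \<le> 4 ^ k"
    by simp
  ultimately show "2 * k + 1 < base k" "k * (2 * k + 2) + 1 < base k" "2 ^ k < base k"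
    using sq unfolding base_def distrib_left by linarith+
qed

text \<open>The exponent 5 arises from \<open>L + 1 = O(N\<^sup>2)\<close>, which rests on
  \<open>k \<le> n\<close>, from \<open>N\<close> rounds per decision, and from
  \<open>N\<^sup>2\<close> pairs in a search. Each pair costs up to \<open>B\<close> additions,
  which explains the exponent \<open>L + 1\<close> of \<open>B\<close>.\<close>

lemma total_time:
  fixes n k B L :: nat
  assumes "k \<le> n" "L \<le> 8 * (n + 1)\<^sup>2" "B > 0"
  shows "20 + ((n + 1)\<^sup>2 * 200 + ((k + 2)\<^sup>2 * 200 +
      (3 + (B ^ L + 1) * (5 + (attempt_time n L B + ((L + 1) * 50 + 40)))))) \<le> 30000 * (n + 1) ^ 5 * B ^ (L + 1)"
proof -
  define N where "N = n + 1"
  have N: "1 \<le> N" "k + 2 \<le> 2 * N"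
    using assms(1) by (simp_all add: N_def)
  define M where "M = N ^ 5 * B"
  have N5: "N ^ 5 = N\<^sup>2 * N * N\<^sup>2"
    by (simp add: eval_nat_numeral)
  have NM: "N ^ i \<le> M" if "i \<le> 5" for i
  proof -
    have "N ^ i \<le> N ^ 5"
      using N(1) that by (rule power_increasing[rotated])
    then show ?thesis
      using assms(3) unfolding M_def by (metis Suc_leI One_nat_def mult.right_neutral mult_le_mono)
  qed
  have M: "1 \<le> M" "N\<^sup>2 \<le> M"
    using NM[of 0] NM[of 2] by simp_all
  have L1: "L + 1 \<le> 9 * N\<^sup>2"
    using assms(2) one_le_power[OF N(1), of 2] unfolding N_def by linarith
  have "12 + N\<^sup>2 * (B + 1) * 600 \<le> 1212 * (N\<^sup>2 * B)"
  proof -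
    have "1 \<le> N\<^sup>2 * B"
      using assms(3) N(1) by simp
    moreover have "N\<^sup>2 * (B + 1) \<le> N\<^sup>2 * (2 * B)"
      using assms(3) by (intro mult_left_mono) auto
    ultimately show ?thesis
      by linarith
  qed
  then have "(L + 1) * N * (12 + N\<^sup>2 * (B + 1) * 600) \<le> 9 * N\<^sup>2 * N * (1212 * (N\<^sup>2 * B))"
    using L1 by (intro mult_le_mono) simp_all
  also have "\<dots> = 10908 * M"
    by (simp add: M_def N5)
  also have "(L + 1) * N = L * (n + 1) + n + 1"
    by (simp add: N_def algebra_simps)
  finally have "attempt_time n L B \<le> 10958 * M"
    using M(1) unfolding attempt_time_def N_def by linarith
  moreover have "L + 1 \<le> 9 * M"
    using L1 mult_le_mono2[OF M(2), of 9] by (rule le_trans)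
  then have "(L + 1) * 50 + 40 * 1 \<le> 9 * M * 50 + 40 * M"
    by (intro add_mono mult_le_mono M(1)) simp_all
  then have "(L + 1) * 50 + 40 \<le> 490 * M"
    by simp
  ultimately have body: "5 + (attempt_time n L B + ((L + 1) * 50 + 40)) \<le> 11500 * M"
    using M(1) by linarith
  have BL: "1 \<le> B ^ L"
    using assms(3) by simp
  then have "(B ^ L + 1) * (5 + (attempt_time n L B + ((L + 1) * 50 + 40))) \<le> (2 * B ^ L) * (11500 * M)"
    using body by (intro mult_le_mono) simp_all
  also have "\<dots> = 23000 * (M * B ^ L)"
    by simp
  finally have main: "(B ^ L + 1) * (5 + (attempt_time n L B + ((L + 1) * 50 + 40))) \<le> 23000 * (M * B ^ L)" .
  have "(k + 2)\<^sup>2 \<le> (2 * N)\<^sup>2"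
    using N(2) by (rule power_mono) simp
  then have k2: "(k + 2)\<^sup>2 \<le> 4 * M"
    using M(2) by (simp add: power_mult_distrib)
  have "M * 1 \<le> M * B ^ L"
    using BL by (rule mult_left_mono) simp
  then have "20 + (N\<^sup>2 * 200 + ((k + 2)\<^sup>2 * 200 +
      (3 + (B ^ L + 1) * (5 + (attempt_time n L B + ((L + 1) * 50 + 40)))))) \<le> 30000 * (M * B ^ L)"
    using main k2 M by linarith
  also have "\<dots> = 30000 * (n + 1) ^ 5 * B ^ (L + 1)"
    by (simp add: M_def N_def)
  finally show ?thesis
    by (simp only: N_def)
qed

lemma run_XCAP_prog:
  assumes "distinct xs"
  shows "run XCAP_prog (30000 * (length xs + 1) ^ 5 * base (nat k) ^ (advice_length (nat k) + 1)) (input_store xs k)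
    (\<lambda>\<tau>. \<tau> ''out'' 0 = answer (XCAP (set xs) k))"
proof -
  let ?\<sigma> = "input_store xs k" and ?n = "length xs"
  let ?T = "30000 * (?n + 1) ^ 5 * base (nat k) ^ (advice_length (nat k) + 1)"
  let ?guard = "Conj (Leq (Const 0) (var ''k'')) (Leq (var ''k'') (var ''n''))"
  let ?loop = "While (Less (Const 0) (var ''go'')) (Seq attempt_prog next_prog)"
  have card: "card (set xs) = ?n"
    using assms by (rule distinct_card)
  have XCAP: "XCAP (set xs) k \<longleftrightarrow> 0 \<le> k \<and> k \<le> int ?n \<and> (\<exists>c\<le>nat k. AP_partition (set xs) c)"
    using XCAP_iff_at_most[of "set xs" k] card by simp
  have \<sigma>: "?\<sigma> ''n'' 0 = int ?n" "?\<sigma> ''k'' 0 = k" "\<And>i. i < ?n \<Longrightarrow> ?\<sigma> ''X'' (int i) = xs ! i"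
    "\<And>i. ?\<sigma> ''G'' i = 0" "?\<sigma> ''out'' 0 = 0"
    by (simp_all add: input_store_def)
  have "30000 * 1 \<le> 30000 * ((?n + 1) ^ 5 * base (nat k) ^ (advice_length (nat k) + 1))"
    by (rule mult_left_mono) (simp_all add: base_def)
  then have T: "30000 \<le> ?T"
    by (simp only: mult_1_right mult.assoc)
  show ?thesis
  proof (cases "0 \<le> k \<and> k \<le> int ?n")
    \<comment> \<open>The program skips everything, and \<open>out\<close> keeps its initial value
      0.\<close>
    case False
    then have "run XCAP_prog (bcost ?guard + 1 + 1) ?\<sigma> (\<lambda>\<tau>. \<tau> ''out'' 0 = answer (XCAP (set xs) k))"
      unfolding XCAP_prog_def
      by (intro run_Cond) (use \<sigma>(1,2,5) XCAP in \<open>auto simp: answer_def intro!: run_sem\<close>)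
    moreover have "bcost ?guard + 1 + 1 \<le> 30000"
      by simp
    ultimately show ?thesis
      using T by (elim run_mono) linarith+
  next
    case True
    define K where "K = nat k"
    have K: "k = int K" "K \<le> ?n"
      using True by (simp_all add: K_def nat_le_iff)
    define ys where "ys = sorted_list_of_set (set xs)"
    have ys: "sorted_wrt (<) ys" "set ys = set xs" "length ys = ?n"
      using card by (simp_all add: ys_def strict_sorted_iff)
    let ?B = "base K" and ?L = "advice_length K"
    let ?T' = "(?B ^ ?L + 1) * (5 + (attempt_time ?n ?L ?B + ((?L + 1) * 50 + 40)))"
    let ?Q = "\<lambda>\<tau>. \<tau> ''out'' 0 = answer (XCAP (set xs) k)"
    have "4 * ((K + 1) * (2 * K + 1)) < advice_length K"
      by (simp add: advice_length_def algebra_simps)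
    note advice = winning_advice[OF ys(1) _ base_bounds this, folded winning_def]
    have adv: "\<exists>g. (\<forall>i. g i < ?B) \<and> (\<forall>G. (\<forall>i<?L. G i = g i) \<longrightarrow> winning ys K ?L G)"
      if "c \<le> K" "AP_partition (set ys) c" for c
      using advice AP_partition_mono[OF that(2,1)] ys(2) card K(2) by (simp add: winning_def)
    have loop: "run ?loop ?T' \<tau> ?Q"
      if "\<And>v. v \<in> {''n'', ''k'', ''G'', ''out''} \<Longrightarrow> \<tau> v = ?\<sigma> v" "\<forall>i<?n. \<tau> ''Y'' (int i) = ys ! i"
        "\<tau> ''B'' 0 = int ?B" "\<tau> ''L'' 0 = int ?L" "\<tau> ''go'' 0 = 1" for \<tau>
    proof -
      have "prepared ys K (\<lambda>_. 0) \<tau>"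
        using that \<sigma> ys(3) K(1) by (simp add: prepared_def)
      moreover have "\<tau> ''out'' 0 = 0"
        using that(1) \<sigma>(5) by simp
      moreover have "0 < ?B"
        by (simp add: base_def)
      ultimately have "run ?loop ((?B ^ ?L + 1) * (5 + (attempt_time (length ys) ?L ?B + ((?L + 1) * 50 + 40)))) \<tau>
          (\<lambda>\<tau>. \<tau> ''out'' 0 = answer (\<exists>c\<le>K. AP_partition (set ys) c))"
        by (intro run_main_loop[where k = K] adv) (use that(3-5) ys(1,3) K(2) in simp_all)
      then show ?thesis
        using ys(2,3) K XCAP by simp
    qed
    have go: "run (Seq (assign ''go'' (Const 1)) ?loop) (3 + ?T') \<tau> ?Q"
      if "\<And>v. v \<in> {''n'', ''k'', ''G'', ''out''} \<Longrightarrow> \<tau> v = ?\<sigma> v" "\<forall>i<?n. \<tau> ''Y'' (int i) = ys ! i"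
        "\<tau> ''B'' 0 = int ?B" "\<tau> ''L'' 0 = int ?L" for \<tau>
      by (rule run_sem_Seq, simp, simp, rule loop) (use that in auto)
    have params: "run (Seq params_prog (Seq (assign ''go'' (Const 1)) ?loop)) ((K + 2)\<^sup>2 * 200 + (3 + ?T')) \<tau> ?Q"
      if old: "\<And>v. v \<in> {''n'', ''k'', ''G'', ''out''} \<Longrightarrow> \<tau> v = ?\<sigma> v" "\<forall>i<?n. \<tau> ''Y'' (int i) = ys ! i" for \<tau>
    proof (rule run_Seq, rule run_mono[OF run_params_prog])
      show "\<tau> ''k'' 0 = int K"
        using old(1) \<sigma>(2) K(1) by simp
      fix \<tau>'
      assume BL: "\<tau>' ''B'' 0 = int ?B \<and> \<tau>' ''L'' 0 = int ?L" and fr: "\<And>v. v \<notin> writes params_prog \<Longrightarrow> \<tau>' v = \<tau> v"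
      have "\<tau>' v = ?\<sigma> v" if "v \<in> {''n'', ''k'', ''G'', ''out''}" for v
        using fr[of v] old(1)[of v] that by auto
      moreover have "\<forall>i<?n. \<tau>' ''Y'' (int i) = ys ! i"
        using fr[of "''Y''"] old(2) by simp
      ultimately show "run (Seq (assign ''go'' (Const 1)) ?loop) (3 + ?T') \<tau>' ?Q"
        using BL by (intro go) simp_all
    qed simp
    have "run (Seq sort_prog (Seq params_prog (Seq (assign ''go'' (Const 1)) ?loop)))
        ((?n + 1)\<^sup>2 * 200 + ((K + 2)\<^sup>2 * 200 + (3 + ?T'))) ?\<sigma> ?Q"
    proof (rule run_Seq, rule run_mono[OF run_sort_prog[where xs = xs and ys = ys]])
      fix \<tau>
      assume Y: "\<forall>i<length ys. \<tau> ''Y'' (int i) = ys ! i" and fr: "\<And>v. v \<notin> writes sort_prog \<Longrightarrow> \<tau> v = ?\<sigma> v"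
      have "\<tau> v = ?\<sigma> v" if "v \<in> {''n'', ''k'', ''G'', ''out''}" for v
        using fr[of v] that by auto
      then show "run (Seq params_prog (Seq (assign ''go'' (Const 1)) ?loop)) ((K + 2)\<^sup>2 * 200 + (3 + ?T')) \<tau> ?Q"
        using Y ys(3) by (intro params) simp_all
    qed (use \<sigma> assms ys in simp_all)
    then have "run XCAP_prog (bcost ?guard + 1 + ((?n + 1)\<^sup>2 * 200 + ((K + 2)\<^sup>2 * 200 + (3 + ?T')))) ?\<sigma> ?Q"
      unfolding XCAP_prog_def by (rule run_Cond) (use True \<sigma>(1,2) in simp)
    moreover have "bcost ?guard + 1 \<le> 20"
      by simp
    moreover have "?L \<le> 8 * (?n + 1)\<^sup>2"
      using K(2) unfolding advice_length_def power2_eq_square by (intro mult_le_mono) simp_all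
    then have "20 + ((?n + 1)\<^sup>2 * 200 + ((K + 2)\<^sup>2 * 200 + (3 + ?T'))) \<le> ?T"
      unfolding K_def[symmetric] by (intro total_time K(2)) (simp_all add: base_def)
    ultimately show ?thesis
      by (elim run_mono) linarith+
  qed
qed

theorem theorem2:
  "\<exists>(P :: com) (f :: nat \<Rightarrow> real) (p :: real poly).
     f \<in> O(\<lambda>k. real k ^ 3) \<and>
     decides_XCAP_in_time P (\<lambda>n k. 2 powr f (nat k) * poly p (real n))"
proof (intro exI conjI)
  \<comment> \<open>The binary logarithm of \<open>base k ^ (advice_length k + 1)\<close>, as
    \<open>base k = 2 ^ (2 * k + 3)\<close>.\<close>
  let ?f = "\<lambda>k. real ((2 * k + 3) * (advice_length k + 1))"
  let ?p = "smult 30000 ([:1, 1:] ^ 5) :: real poly"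
  \<comment> \<open>For positive \<open>k\<close> the factors are at most \<open>5 * k\<close> and
    \<open>(8 * 4 + 1) * (k * k)\<close>, and 165 is 5 times 33.\<close>
  have "(2 * k + 3) * (advice_length k + 1) \<le> 165 * k ^ 3" if "k \<ge> 1" for k :: nat
  proof -
    have "(k + 1) * (k + 1) \<le> (2 * k) * (2 * k)"
      using that by (intro mult_le_mono) simp_all
    moreover have "1 \<le> k * k"
      using that by simp
    ultimately have "advice_length k + 1 \<le> 33 * (k * k)"
      unfolding advice_length_def by linarith
    then have "(2 * k + 3) * (advice_length k + 1) \<le> (5 * k) * (33 * (k * k))"
      using that by (intro mult_le_mono) simp_all
    then show ?thesis
      by (simp add: power3_eq_cube)
  qed
  then have "?f k \<le> real (165 * k ^ 3)" if "k \<ge> 1" for k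
    using that by (simp only: of_nat_le_iff)
  then have "?f k \<le> 165 * real k ^ 3" if "k \<ge> 1" for k
    using that by simp
  then show "?f \<in> O(\<lambda>k. real k ^ 3)"
    by (intro bigoI[of _ 165] eventually_mono[OF eventually_ge_at_top[of 1]]) simp
  show "decides_XCAP_in_time XCAP_prog (\<lambda>n k. 2 powr ?f (nat k) * poly ?p (real n))"
    unfolding decides_XCAP_in_time_def
  proof (intro allI impI)
    fix X :: "int set" and k :: int and xs :: "int list"
    assume X: "set xs = X \<and> distinct xs"
    then have card: "card X = length xs"
      using distinct_card by blast
    obtain t \<tau> where "exec XCAP_prog (input_store xs k) t \<tau>" "\<tau> ''out'' 0 = answer (XCAP X k)"
      and t: "t \<le> 30000 * (length xs + 1) ^ 5 * base (nat k) ^ (advice_length (nat k) + 1)"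
      using run_XCAP_prog[of xs k] X unfolding run_def by blast
    moreover have "real t \<le> 2 powr ?f (nat k) * poly ?p (real (card X))"
    proof -
      have "base (nat k) = 2 ^ (2 * nat k + 3)"
        by (simp add: base_def power_add power_mult)
      then have "real (base (nat k) ^ (advice_length (nat k) + 1)) = 2 powr ?f (nat k)"
        by (simp only: power_mult[symmetric] of_nat_power of_nat_numeral powr_realpow[symmetric] zero_less_numeral)
      moreover have "real (30000 * (length xs + 1) ^ 5) = poly ?p (real (card X))"
        by (simp add: card poly_power add.commute)
      ultimately show ?thesis
        using t by (metis mult.commute of_nat_le_iff of_nat_mult)
    qed
    ultimately show "\<exists>t \<tau>. exec XCAP_prog (input_store xs k) t \<tau> \<and> \<tau> ''out'' 0 = answer (XCAP X k) \<and>
        real t \<le> 2 powr ?f (nat k) * poly ?p (real (card X))"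
      by blast
  qed
qed

end
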